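(* Let $\mathbf{V}$ be a semigroup variety of finite axiomatic rank. Then $\mathbf{V}$ is locally $\mathcal{R}$-finite if and only if at least one of the following holds: (1) $\mathbf{V}$ is locally finite; (2) every semigroup $S\in\mathbf{V}$ is a locally finite extension of an ideal of the form $SR$, where $R$ is a periodic completely regular right ideal of $S$ (that is, of an ideal generated by a periodic completely regular right ideal), and $\mathbf{V}$ contains none of the semigroups $L(G)$ where $G$ is a Novikov--Adian group.
   Context: A semigroup variety is a class of semigroups defined by a set of semigroup identities; it is of finite axiomatic rank if for some fixed $n>0$ it can be given by a set of identities each involving at most $n$ letters. A semigroup is locally finite if each of its finitely generated subsemigroups is finite, and periodic if each of its monogenic subsemigroups is finite; a variety is locally finite if all its members are. On a semigroup $S$, $x\,\mathcal{R}\,y\iff xS^1=yS^1$, where $S^1$ is $S$ if $S$ has an identity and $S$ with an identity adjoined otherwise. A semigroup is $\mathcal{R}$-finite if it has only finitely many $\mathcal{R}$-classes; a variety is locally $\mathcal{R}$-finite if each finitely generated semigroup in it is $\mathcal{R}$-finite. A semigroup is completely regular if it is a union of its subgroups. A semigroup $S$ is a locally finite extension of its (nonempty) ideal $J$ if the Rees quotient $S/J$ is locally finite. Ideals and right ideals are nonempty. (If $R$ is a completely regular right ideal of $S$, then $R\subseteq SR$ and $SR$ is the ideal of $S$ generated by $R$.) A Novikov--Adian group is an infinite finitely generated group of finite exponent. For a group $G$, $L(G)$ is the semigroup on the disjoint union of $G$ and a copy $\overline{G}=\{\overline{g}\mid g\in G\}$ of $G$, with multiplication extending that of $G$ and $g_1\overline{g_2}=\overline{g_1g_2}$,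 $\overline{g_1}g_2=\overline{g_1}\,\overline{g_2}=\overline{g_1}$ for all $g_1,g_2\in G$. *)

theory Defs
  imports "HOL-Algebra.Generated_Groups"
begin

text \<open>Semigroups are given, in the style of HOL-Algebra, by an explicit carrier inside a type;
  they are nonempty.\<close>

record 'a sgrp = "'a partial_object" +
  sprod :: "['a, 'a] \<Rightarrow> 'a" (infixl \<open>\<cdot>\<index>\<close> 70)

locale sgrp =
  fixes S :: "'a sgrp" (structure)
  assumes nonempty: "carrier S \<noteq> {}"
    and closed: "\<lbrakk>x \<in> carrier S; y \<in> carrier S\<rbrakk> \<Longrightarrow> x \<cdot> y \<in> carrier S"
    and assoc: "\<lbrakk>x \<in> carrier S; y \<in> carrier S; z \<in> carrier S\<rbrakk> \<Longrightarrow> (x \<cdot> y) \<cdot> z = x \<cdot> (y \<cdot> z)"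

text \<open>The subsemigroup of \<open>S\<close> on a closed subset \<open>T\<close> is written \<open>sub S T\<close>.\<close>

abbreviation sub :: "'a sgrp \<Rightarrow> 'a set \<Rightarrow> 'a sgrp"
  where "sub S T \<equiv> S\<lparr>carrier := T\<rparr>"

inductive_set sgenerate :: "'a sgrp \<Rightarrow> 'a set \<Rightarrow> 'a set"
  for S :: "'a sgrp" and A :: "'a set" where
    incl: "a \<in> A \<Longrightarrow> a \<in> sgenerate S A"
  | prod: "\<lbrakk>x \<in> sgenerate S A; y \<in> sgenerate S A\<rbrakk> \<Longrightarrow> x \<cdot>\<^bsub>S\<^esub> y \<in> sgenerate S A"

definition finitely_generated :: "'a sgrp \<Rightarrow> bool"
  where "finitely_generated S \<longleftrightarrow>
    (\<exists>A. finite A \<and> A \<subseteq> carrier S \<and> sgenerate S A = carrier S)"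

definition locally_finite :: "'a sgrp \<Rightarrow> bool"
  where "locally_finite S \<longleftrightarrow>
    (\<forall>A. finite A \<and> A \<subseteq> carrier S \<longrightarrow> finite (sgenerate S A))"

definition periodic :: "'a sgrp \<Rightarrow> bool"
  where "periodic S \<longleftrightarrow> (\<forall>x \<in> carrier S. finite (sgenerate S {x}))"

definition completely_regular :: "'a sgrp \<Rightarrow> bool"
  where "completely_regular S \<longleftrightarrow>
    (\<forall>x \<in> carrier S. \<exists>H e. x \<in> H \<and> H \<subseteq> carrier S \<and>
        group \<lparr>carrier = H, monoid.mult = sprod S, one = e\<rparr>)"

text \<open>\<open>S\<^sup>1\<close>: the elements of \<open>S\<close> appear as \<open>Some x\<close>; the identity \<open>None\<close> belongs to the carrier
  only if \<open>S\<close> has no identity of its own.\<close>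

definition has_identity :: "'a sgrp \<Rightarrow> bool"
  where "has_identity S \<longleftrightarrow>
    (\<exists>e \<in> carrier S. \<forall>x \<in> carrier S. e \<cdot>\<^bsub>S\<^esub> x = x \<and> x \<cdot>\<^bsub>S\<^esub> e = x)"

definition adjoin_identity :: "'a sgrp \<Rightarrow> 'a option sgrp"
  where "adjoin_identity S =
    \<lparr>carrier = (if has_identity S then Some ` carrier S else insert None (Some ` carrier S)),
     sprod = (\<lambda>a b. case a of None \<Rightarrow> b
                | Some x \<Rightarrow> (case b of None \<Rightarrow> a | Some y \<Rightarrow> Some (x \<cdot>\<^bsub>S\<^esub> y)))\<rparr>"

definition principal_right :: "'a sgrp \<Rightarrow> 'a \<Rightarrow> 'a option set"
  where "principal_right S x =
    {Some x \<cdot>\<^bsub>adjoin_identity S\<^esub> t | t. t \<in> carrier (adjoin_identity S)}"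

definition R_rel :: "'a sgrp \<Rightarrow> ('a \<times> 'a) set"
  where "R_rel S = {(x, y). x \<in> carrier S \<and> y \<in> carrier S \<and>
    principal_right S x = principal_right S y}"

definition R_finite :: "'a sgrp \<Rightarrow> bool"
  where "R_finite S \<longleftrightarrow> finite (carrier S // R_rel S)"

definition right_ideal :: "'a sgrp \<Rightarrow> 'a set \<Rightarrow> bool"
  where "right_ideal S R \<longleftrightarrow> R \<noteq> {} \<and> R \<subseteq> carrier S \<and>
    (\<forall>r \<in> R. \<forall>s \<in> carrier S. r \<cdot>\<^bsub>S\<^esub> s \<in> R)"

definition semigroup_ideal :: "'a sgrp \<Rightarrow> 'a set \<Rightarrow> bool"
  where "semigroup_ideal S J \<longleftrightarrow> J \<noteq> {} \<and> J \<subseteq> carrier S \<and>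
    (\<forall>j \<in> J. \<forall>s \<in> carrier S. j \<cdot>\<^bsub>S\<^esub> s \<in> J \<and> s \<cdot>\<^bsub>S\<^esub> j \<in> J)"

definition left_multiples :: "'a sgrp \<Rightarrow> 'a set \<Rightarrow> 'a set"
  where "left_multiples S R = {s \<cdot>\<^bsub>S\<^esub> r | s r. s \<in> carrier S \<and> r \<in> R}"

definition rees_congruence :: "'a sgrp \<Rightarrow> 'a set \<Rightarrow> ('a \<times> 'a) set"
  where "rees_congruence S J = Id_on (carrier S) \<union> J \<times> J"

definition rees_quotient :: "'a sgrp \<Rightarrow> 'a set \<Rightarrow> 'a set sgrp"
  where "rees_quotient S J =
    \<lparr>carrier = carrier S // rees_congruence S J,
     sprod = (\<lambda>X Y. rees_congruence S J `` {x \<cdot>\<^bsub>S\<^esub> y | x y. x \<in> X \<and> y \<in> Y})\<rparr>"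

definition locally_finite_extension :: "'a sgrp \<Rightarrow> 'a set \<Rightarrow> bool"
  where "locally_finite_extension S J \<longleftrightarrow>
    semigroup_ideal S J \<and> locally_finite (rees_quotient S J)"

text \<open>Semigroup words are nonempty lists of letters; each identity involves finitely many letters,
  so the countable alphabet \<^typ>\<open>nat\<close> loses no generality.\<close>

type_synonym identity = "nat list \<times> nat list"

fun word_value :: "'a sgrp \<Rightarrow> (nat \<Rightarrow> 'a) \<Rightarrow> nat list \<Rightarrow> 'a" where
  "word_value S \<phi> [] = undefined"
| "word_value S \<phi> [i] = \<phi> i"
| "word_value S \<phi> (i # j # w) = \<phi> i \<cdot>\<^bsub>S\<^esub> word_value S \<phi> (j # w)"

definition is_identity :: "identity \<Rightarrow> bool"
  where "is_identity p \<longleftrightarrow> fst p \<noteq> [] \<and> snd p \<noteq> []"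

definition identity_letters :: "identity \<Rightarrow> nat set"
  where "identity_letters p = set (fst p) \<union> set (snd p)"

definition satisfies :: "'a sgrp \<Rightarrow> identity \<Rightarrow> bool"
  where "satisfies S p \<longleftrightarrow>
    (\<forall>\<phi>. range \<phi> \<subseteq> carrier S \<longrightarrow> word_value S \<phi> (fst p) = word_value S \<phi> (snd p))"

text \<open>A variety is a class of semigroups over all types.  It is represented by a defining set \<open>E\<close>
  of identities: \<open>variety E\<close>, a constant polymorphic in \<open>'a\<close>, is its part over the type \<open>'a\<close>.
  Since a formula cannot quantify over types, statements about all members of a variety range over
  arbitrary infinite carrier types, chosen independently for each property of the variety.\<close>

definition variety :: "identity set \<Rightarrow> 'a sgrp set"
  where "variety E = {S. sgrp S \<and> (\<forall>p \<in> E. satisfies S p)}"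

definition locally_finite_variety :: "'a sgrp set \<Rightarrow> bool"
  where "locally_finite_variety V \<longleftrightarrow> (\<forall>S \<in> V. locally_finite S)"

definition locally_R_finite_variety :: "'a sgrp set \<Rightarrow> bool"
  where "locally_R_finite_variety V \<longleftrightarrow> (\<forall>S \<in> V. finitely_generated S \<longrightarrow> R_finite S)"

definition novikov_adian :: "'a monoid \<Rightarrow> bool"
  where "novikov_adian G \<longleftrightarrow> group G \<and> infinite (carrier G) \<and>
    (\<exists>A. finite A \<and> A \<subseteq> carrier G \<and> generate G A = carrier G) \<and>
    (\<exists>k::nat. k > 0 \<and> (\<forall>x \<in> carrier G. x [^]\<^bsub>G\<^esub> k = \<one>\<^bsub>G\<^esub>))"

text \<open>\<open>Inl g\<close> is the element \<open>g\<close> of \<open>G\<close>, and \<open>Inr g\<close> its copy with a bar.\<close>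

definition L :: "'a monoid \<Rightarrow> ('a + 'a) sgrp"
  where "L G =
    \<lparr>carrier = carrier G <+> carrier G,
     sprod = (\<lambda>a b. case a of
         Inl g \<Rightarrow> (case b of Inl h \<Rightarrow> Inl (g \<otimes>\<^bsub>G\<^esub> h) | Inr h \<Rightarrow> Inr (g \<otimes>\<^bsub>G\<^esub> h))
       | Inr g \<Rightarrow> Inr g)\<rparr>"

end

theory Submission
  imports Defs "HOL-Library.Countable_Set"
begin

text \<open>Suppose \<open>V\<close> is locally R-finite but not locally finite.  A monogenic infinite semigroup is
  R-trivial, so \<open>V\<close> satisfies an identity making \<open>x ^ p\<close> idempotent.  The monoid \<open>CC = {1, a, 0}\<close>
  with \<open>a a = 0\<close>, and \<open>PP = {e, a, 0}\<close> with \<open>e e = e\<close>, \<open>e a = a\<close> and all other products \<open>0\<close>,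
  are not in \<open>V\<close>: multiplied with a finitely generated infinite member of \<open>V\<close> they would produce
  infinitely many R-classes.  Identities failing in \<open>PP\<close> and \<open>CC\<close> force \<open>e s\<close> to be a group element
  for every idempotent \<open>e\<close>.  Hence the set \<open>R\<close> of all \<open>x\<close> for which \<open>x S\<^sup>1\<close> consists of group
  elements contains all idempotents, so \<open>S / S R\<close> is nil; a finitely generated nil semigroup is
  R-trivial, hence finite here.

  Conversely, if \<open>S\<close> is finitely generated and \<open>S / S R\<close> is locally finite, R-finiteness of \<open>S\<close>
  reduces to that of a finitely generated subsemigroup of \<open>R\<close>.  In a finitely generated periodic
  completely regular semigroup the products with a fixed set of letters are treated by induction
  on that set; infinitely many R-classes can only arise as an infinite orbit \<open>G y\<close> of a maximal
  subgroup \<open>G\<close>, which is finitely generated by a Schreier argument, and then \<open>L\<close> of a Novikov-Adian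
  quotient of \<open>G\<close> lies in \<open>V\<close>.\<close>

section \<open>Products of lists and Green's relation R\<close>

text \<open>Green's relation R is a left congruence only. The number of R-classes stays finite under
  left multiplication by one fixed element, but a whole group acting from the left may spread one
  class into infinitely many. \<open>L G\<close> is the pure form of this: its barred elements are
  left zeros, hence pairwise R-inequivalent, and yet \<open>G\<close> permutes them transitively.
  For \<open>G\<close> of finite exponent \<open>L G\<close> is itself a periodic union of groups,
  so the condition on right ideals does not detect it. \<open>PP\<close> and \<open>CC\<close> come
  from a concrete situation. For an idempotent \<open>e\<close> and an element \<open>s\<close> with
  \<open>e s = s\<close> the products of \<open>e\<close> and \<open>s\<close> are \<open>e\<close>,
  \<open>s ^ k\<close> and \<open>s ^ k e\<close>. Merging all of them except \<open>e\<close> and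
  \<open>s\<close> to zero gives \<open>PP\<close>, or \<open>CC\<close> if also
  \<open>s e = s\<close>. An identity failing there forces a coincidence between products that the
  merging keeps apart. Each property is stated over a carrier type of its own. Finitely generated
  semigroups are countable and can be copied into any infinite type, which carries the hypotheses
  from one type to another.\<close>

fun sval :: "'a sgrp \<Rightarrow> 'a list \<Rightarrow> 'a" where
  "sval S [] = undefined"
| "sval S [x] = x"
| "sval S (x # y # xs) = x \<cdot>\<^bsub>S\<^esub> sval S (y # xs)"

definition spow :: "'a sgrp \<Rightarrow> 'a \<Rightarrow> nat \<Rightarrow> 'a"
  where "spow S x n = sval S (replicate n x)"

text \<open>The relation \<open>x \<in> y S\<^sup>1\<close> without an adjoined element: the
  equality disjunct plays the part of the identity.\<close>

definition rle :: "'a sgrp \<Rightarrow> 'a \<Rightarrow> 'a \<Rightarrow> bool"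
  where "rle S x y \<longleftrightarrow> x = y \<or> (\<exists>s \<in> carrier S. x = y \<cdot>\<^bsub>S\<^esub> s)"

definition req :: "'a sgrp \<Rightarrow> 'a \<Rightarrow> 'a \<Rightarrow> bool"
  where "req S x y \<longleftrightarrow> rle S x y \<and> rle S y x"

definition Rcl :: "'a sgrp \<Rightarrow> 'a \<Rightarrow> 'a set"
  where "Rcl S x = {y \<in> carrier S. req S x y}"

lemma word_value_sval: "word_value S \<phi> w = sval S (map \<phi> w)"
  by (induction S \<phi> w rule: word_value.induct) auto

lemma sval_Cons: "xs \<noteq> [] \<Longrightarrow> sval S (x # xs) = x \<cdot>\<^bsub>S\<^esub> sval S xs"
  by (cases xs) auto

text \<open>Products are bracketed to the right, so splitting off a prefix as iterated left
  multiplication needs no associativity, and the prefix may be empty.\<close>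

lemma sval_append_foldr:
  "ys \<noteq> [] \<Longrightarrow> sval S (xs @ ys) = foldr (sprod S) xs (sval S ys)"
  by (induction xs) (auto simp: sval_Cons)

lemma sval_sub [simp]: "sval (sub S T) xs = sval S xs"
  by (induction S xs rule: sval.induct) auto

lemma sgenerate_sub [simp]: "sgenerate (sub S T) A = sgenerate S A"
proof -
  have "x \<in> sgenerate (sub S T) A \<Longrightarrow> x \<in> sgenerate S A" for x
    by (induction rule: sgenerate.induct) (auto intro: sgenerate.intros)
  moreover have "x \<in> sgenerate S A \<Longrightarrow> x \<in> sgenerate (sub S T) A" for x
  proof (induction rule: sgenerate.induct)
    case (prod x y)
    then show ?case using sgenerate.prod[of x "sub S T" A y] by simp
  qed (auto intro: sgenerate.intros)
  ultimately show ?thesis by blast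
qed

lemma sval_in_sgenerate: "\<lbrakk>xs \<noteq> []; set xs \<subseteq> A\<rbrakk> \<Longrightarrow> sval S xs \<in> sgenerate S A"
  by (induction xs) (auto simp: sval_Cons intro: sgenerate.intros, metis sgenerate.intros sval.simps(2) sval_Cons)

lemma sgenerate_mono:
  assumes "A \<subseteq> B" shows "sgenerate S A \<subseteq> sgenerate S B"
proof
  show "x \<in> sgenerate S B" if "x \<in> sgenerate S A" for x
    using that by induction (use assms in \<open>auto intro: sgenerate.intros\<close>)
qed

context sgrp
begin

lemma sval_closed: "\<lbrakk>xs \<noteq> []; set xs \<subseteq> carrier S\<rbrakk> \<Longrightarrow> sval S xs \<in> carrier S"
  by (induction xs) (auto simp: sval_Cons closed, metis sval.simps(2) sval_Cons closed)

lemma foldr_closed: "\<lbrakk>set xs \<subseteq> carrier S; y \<in> carrier S\<rbrakk> \<Longrightarrow> foldr (sprod S) xs y \<in> carrier S"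
  by (induction xs) (auto intro: closed)

lemma foldr_assoc:
  "\<lbrakk>set xs \<subseteq> carrier S; x \<in> carrier S; y \<in> carrier S\<rbrakk>
    \<Longrightarrow> foldr (sprod S) xs (x \<cdot> y) = foldr (sprod S) xs x \<cdot> y"
  by (induction xs) (auto simp: assoc foldr_closed)

lemma foldr_sval:
  "\<lbrakk>xs \<noteq> []; set xs \<subseteq> carrier S; y \<in> carrier S\<rbrakk> \<Longrightarrow> foldr (sprod S) xs y = sval S xs \<cdot> y"
proof (induction xs)
  case (Cons x xs)
  then show ?case by (cases "xs = []") (auto simp: sval_Cons assoc sval_closed)
qed simp

lemma sval_append:
  "\<lbrakk>xs \<noteq> []; ys \<noteq> []; set xs \<subseteq> carrier S; set ys \<subseteq> carrier S\<rbrakk>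
    \<Longrightarrow> sval S (xs @ ys) = sval S xs \<cdot> sval S ys"
  by (simp add: sval_append_foldr foldr_sval sval_closed)

lemma sgenerate_closed: "A \<subseteq> carrier S \<Longrightarrow> sgenerate S A \<subseteq> carrier S"
proof
  show "x \<in> carrier S" if "A \<subseteq> carrier S" "x \<in> sgenerate S A" for x
    using that(2,1) by induction (auto intro: closed)
qed

lemma sgenerate_sval:
  assumes "A \<subseteq> carrier S" "x \<in> sgenerate S A"
  shows "\<exists>xs. xs \<noteq> [] \<and> set xs \<subseteq> A \<and> x = sval S xs"
  using assms(2)
proof induction
  case (incl a)
  then show ?case by (intro exI[of _ "[a]"]) auto
next
  case (prod x y)
  then obtain xs ys where "xs \<noteq> []" "set xs \<subseteq> A" "x = sval S xs"
    "ys \<noteq> []" "set ys \<subseteq> A" "y = sval S ys" by blast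
  then show ?case using assms(1) sval_append[of xs ys]
    by (intro exI[of _ "xs @ ys"]) auto
qed

lemma sgenerate_image:
  assumes "A \<subseteq> carrier S"
  shows "sgenerate S A = sval S ` {xs. xs \<noteq> [] \<and> set xs \<subseteq> A}"
  using sgenerate_sval[OF assms] sval_in_sgenerate[of _ A S] by auto

lemma countable_sgenerate:
  assumes "A \<subseteq> carrier S" "finite A" shows "countable (sgenerate S A)"
proof -
  have "countable (lists A)" using assms(2) by (simp add: countable_finite countable_lists)
  then have "countable {xs. xs \<noteq> [] \<and> set xs \<subseteq> A}"
    by (rule countable_subset[rotated]) auto
  then show ?thesis using sgenerate_image[OF assms(1)] by simp
qed

lemma sub_sgrp:
  assumes "T \<noteq> {}" "T \<subseteq> carrier S" "\<And>x y. \<lbrakk>x \<in> T; y \<in> T\<rbrakk> \<Longrightarrow> x \<cdot> y \<in> T"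
  shows "sgrp (sub S T)"
  using assms by unfold_locales (auto intro!: assoc)

lemma spow_1 [simp]: "spow S x (Suc 0) = x"
  by (simp add: spow_def)

lemma spow_Suc: "n > 0 \<Longrightarrow> spow S x (Suc n) = x \<cdot> spow S x n"
  by (simp add: spow_def sval_Cons)

lemma spow_closed: "\<lbrakk>x \<in> carrier S; n > 0\<rbrakk> \<Longrightarrow> spow S x n \<in> carrier S"
  unfolding spow_def by (rule sval_closed) auto

lemma spow_add:
  "\<lbrakk>x \<in> carrier S; m > 0; n > 0\<rbrakk> \<Longrightarrow> spow S x (m + n) = spow S x m \<cdot> spow S x n"
  unfolding spow_def replicate_add by (rule sval_append) auto

lemma spow_Suc2:
  "\<lbrakk>x \<in> carrier S; n > 0\<rbrakk> \<Longrightarrow> spow S x (Suc n) = spow S x n \<cdot> x"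
  using spow_add[of x n 1] by simp

lemma spow_idem:
  assumes "e \<cdot> e = e" "n > 0" shows "spow S e n = e"
  using assms(2) by (induction n rule: nat_induct_non_zero) (auto simp: spow_Suc assms)

lemma sgenerate_singleton:
  assumes "x \<in> carrier S" shows "sgenerate S {x} = spow S x ` {0<..}"
proof -
  have "set xs \<subseteq> {x} \<longleftrightarrow> xs = replicate (length xs) x" for xs
    by (metis (no_types, lifting) in_set_replicate replicate_eqI singletonD singletonI subset_iff)
  then have "{xs. xs \<noteq> [] \<and> set xs \<subseteq> {x}} = (\<lambda>n. replicate n x) ` {0<..}"
    by (auto simp: image_iff)
  then show ?thesis using sgenerate_image[of "{x}"] assms by (auto simp: spow_def image_image)
qed

section \<open>Green's preorder and representatives of R-classes\<close>

lemma rle_refl [simp]: "rle S x x" by (simp add: rle_def)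

lemma rle_trans:
  assumes "rle S x y" "rle S y z" "z \<in> carrier S" shows "rle S x z"
proof -
  have "rle S ((z \<cdot> s) \<cdot> t) z" if "s \<in> carrier S" "t \<in> carrier S" for s t
    using that assms(3) by (auto simp: rle_def assoc intro!: closed bexI[of _ "s \<cdot> t"])
  then show ?thesis using assms by (auto simp: rle_def)
qed

lemma rle_mult: "\<lbrakk>x \<in> carrier S; s \<in> carrier S\<rbrakk> \<Longrightarrow> rle S (x \<cdot> s) x"
  by (auto simp: rle_def)

lemma rle_left:
  assumes "rle S x y" "y \<in> carrier S" "z \<in> carrier S" shows "rle S (z \<cdot> x) (z \<cdot> y)"
  using assms by (auto simp: rle_def assoc[symmetric])

lemma req_refl [simp]: "req S x x" by (simp add: req_def)

lemma req_sym: "req S x y \<Longrightarrow> req S y x" by (simp add: req_def)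

lemma req_trans:
  "\<lbrakk>req S x y; req S y z; x \<in> carrier S; z \<in> carrier S\<rbrakk> \<Longrightarrow> req S x z"
  using rle_trans unfolding req_def by blast

lemma req_left:
  "\<lbrakk>req S x y; x \<in> carrier S; y \<in> carrier S; z \<in> carrier S\<rbrakk> \<Longrightarrow> req S (z \<cdot> x) (z \<cdot> y)"
  using rle_left unfolding req_def by blast

lemma Rcl_eq_iff:
  assumes "x \<in> carrier S" "y \<in> carrier S"
  shows "Rcl S x = Rcl S y \<longleftrightarrow> req S x y"
proof
  assume "Rcl S x = Rcl S y"
  moreover have "y \<in> Rcl S y" using assms by (simp add: Rcl_def)
  ultimately have "y \<in> Rcl S x" by simp
  then show "req S x y" by (simp add: Rcl_def)
next
  assume xy: "req S x y"
  have "req S x z \<longleftrightarrow> req S y z" if "z \<in> carrier S" for z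
    using req_trans[OF xy, of z] req_trans[OF req_sym[OF xy], of z] assms that by blast
  then show "Rcl S x = Rcl S y" by (auto simp: Rcl_def)
qed

lemma Rcl_finite_reps:
  assumes "finite (Rcl S ` X)" "X \<subseteq> carrier S"
  obtains F where "finite F" "F \<subseteq> X" "\<And>x. x \<in> X \<Longrightarrow> \<exists>y \<in> F. req S y x"
proof -
  obtain F where F: "F \<subseteq> X" "finite F" "Rcl S ` X = Rcl S ` F"
    using finite_subset_image[OF assms(1) order_refl] by metis
  have "\<exists>y \<in> F. req S y x" if "x \<in> X" for x
  proof -
    have "Rcl S x \<in> Rcl S ` F" unfolding F(3)[symmetric] using that by (rule imageI)
    then obtain y where "y \<in> F" "Rcl S x = Rcl S y" by (rule imageE)
    moreover have "y \<in> carrier S" "x \<in> carrier S" using calculation(1) that assms(2) F(1) by auto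
    ultimately show ?thesis using Rcl_eq_iff[of y x] by metis
  qed
  then show ?thesis by (rule that[OF F(2,1)])
qed

lemma finite_Rcl_image:
  assumes "finite F" "F \<subseteq> carrier S" "X \<subseteq> carrier S" "\<And>x. x \<in> X \<Longrightarrow> \<exists>y \<in> F. req S y x"
  shows "finite (Rcl S ` X)"
proof (rule finite_subset)
  show "Rcl S ` X \<subseteq> Rcl S ` F"
  proof
    fix c assume "c \<in> Rcl S ` X"
    then obtain x where "x \<in> X" "c = Rcl S x" by blast
    moreover from this obtain y where "y \<in> F" "req S y x" using assms(4) by blast
    ultimately have "c = Rcl S y" using Rcl_eq_iff[of y x] assms(2,3) by auto
    then show "c \<in> Rcl S ` F" using \<open>y \<in> F\<close> by blast
  qed
qed (use assms(1) in auto)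

text \<open>R is a left congruence, so representatives are carried to representatives.\<close>

lemma finite_Rcl_left:
  assumes "finite (Rcl S ` X)" "X \<subseteq> carrier S" "z \<in> carrier S"
  shows "finite (Rcl S ` (\<lambda>x. z \<cdot> x) ` X)"
proof -
  obtain F where F: "finite F" "F \<subseteq> X" "\<And>x. x \<in> X \<Longrightarrow> \<exists>y \<in> F. req S y x"
    using Rcl_finite_reps[OF assms(1,2)] by blast
  show ?thesis
  proof (rule finite_Rcl_image[of "(\<lambda>x. z \<cdot> x) ` F"])
    show "(\<lambda>x. z \<cdot> x) ` F \<subseteq> carrier S" "(\<lambda>x. z \<cdot> x) ` X \<subseteq> carrier S"
      using F(2) assms(2,3) closed by auto
    fix w assume "w \<in> (\<lambda>x. z \<cdot> x) ` X"
    then obtain x where x: "x \<in> X" "w = z \<cdot> x" by blast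
    then obtain y where y: "y \<in> F" "req S y x" using F(3) by blast
    then have "req S (z \<cdot> y) w"
      using req_left[of y x z] x assms(2,3) F(2) by blast
    then show "\<exists>y \<in> (\<lambda>x. z \<cdot> x) ` F. req S y w" using y(1) by blast
  qed (use F(1) in simp)
qed

lemma principal_right_eq:
  assumes "x \<in> carrier S" shows "principal_right S x = Some ` {z. rle S z x}"
proof -
  have im: "principal_right S x =
      (\<lambda>t. case t of None \<Rightarrow> Some x | Some y \<Rightarrow> Some (x \<cdot> y)) ` carrier (adjoin_identity S)"
    by (simp add: principal_right_def adjoin_identity_def Setcompr_eq_image)
  have rle: "{z. rle S z x} = insert x ((\<lambda>s. x \<cdot> s) ` carrier S)"
    by (auto simp: rle_def)
  show ?thesis
  proof (cases "has_identity S")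
    case True
    then obtain e where e: "e \<in> carrier S" "x \<cdot> e = x"
      using assms unfolding has_identity_def by blast
    \<comment> \<open>If \<open>S\<close> has an identity, \<open>None\<close> is missing from the
      carrier, but then \<open>x\<close> itself is of the form \<open>x e\<close>.\<close>
    then have "x \<in> (\<lambda>s. x \<cdot> s) ` carrier S" by (metis imageI)
    then show ?thesis
      unfolding im rle using True by (simp add: adjoin_identity_def image_image insert_absorb)
  qed (unfold im rle, simp add: adjoin_identity_def image_image)
qed

lemma R_rel_iff: "(x, y) \<in> R_rel S \<longleftrightarrow> x \<in> carrier S \<and> y \<in> carrier S \<and> req S x y"
proof -
  have "{z. rle S z x} = {z. rle S z y} \<longleftrightarrow> req S x y" if "x \<in> carrier S" "y \<in> carrier S"
  proof
    assume "{z. rle S z x} = {z. rle S z y}"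
    then show "req S x y" using rle_refl unfolding req_def by blast
  next
    assume "req S x y"
    then show "{z. rle S z x} = {z. rle S z y}"
      using rle_trans[of _ x y] rle_trans[of _ y x] that unfolding req_def by blast
  qed
  then show ?thesis by (auto simp: R_rel_def principal_right_eq inj_image_eq_iff)
qed

lemma R_finite_iff: "R_finite S \<longleftrightarrow> finite (Rcl S ` carrier S)"
proof -
  have "carrier S // R_rel S = Rcl S ` carrier S"
    by (auto simp: quotient_def Rcl_def R_rel_iff image_iff)
  then show ?thesis by (simp add: R_finite_def)
qed

lemma R_trivial_finite:
  assumes "R_finite S" "Y \<subseteq> carrier S" "\<And>x y. \<lbrakk>x \<in> Y; y \<in> Y; req S x y\<rbrakk> \<Longrightarrow> x = y"
  shows "finite Y"
proof -
  have "inj_on (Rcl S) Y"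
  proof (rule inj_onI)
    fix x y assume xy: "x \<in> Y" "y \<in> Y" "Rcl S x = Rcl S y"
    then have "req S x y" using Rcl_eq_iff[of x y] assms(2) by auto
    then show "x = y" using assms(3) xy by metis
  qed
  moreover have "finite (Rcl S ` Y)"
    by (rule finite_subset[OF image_mono[OF assms(2)]]) (use assms(1) R_finite_iff in simp)
  ultimately show ?thesis by (simp add: finite_image_iff)
qed

end

section \<open>Surjective homomorphisms, products and varieties\<close>

definition smap :: "('a \<Rightarrow> 'b) \<Rightarrow> 'a sgrp \<Rightarrow> 'b sgrp \<Rightarrow> bool"
  where "smap f S T \<longleftrightarrow> f ` carrier S = carrier T \<and>
    (\<forall>x \<in> carrier S. \<forall>y \<in> carrier S. f (x \<cdot>\<^bsub>S\<^esub> y) = f x \<cdot>\<^bsub>T\<^esub> f y)"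

lemma smap_image: "smap f S T \<Longrightarrow> f ` carrier S = carrier T"
  by (simp add: smap_def)

lemma smap_mult:
  "\<lbrakk>smap f S T; x \<in> carrier S; y \<in> carrier S\<rbrakk> \<Longrightarrow> f (x \<cdot>\<^bsub>S\<^esub> y) = f x \<cdot>\<^bsub>T\<^esub> f y"
  by (simp add: smap_def)

lemma smap_sgrp:
  assumes "smap f S T" "sgrp S" shows "sgrp T"
proof -
  interpret sgrp S by fact
  have ex: "\<exists>x' \<in> carrier S. x = f x'" if "x \<in> carrier T" for x
    using smap_image[OF assms(1)] that by blast
  show ?thesis
  proof
    show "carrier T \<noteq> {}" unfolding smap_image[OF assms(1), symmetric] using nonempty by simp
  next
    fix x y assume "x \<in> carrier T" "y \<in> carrier T"
    then obtain x' y' where "x' \<in> carrier S" "x = f x'" "y' \<in> carrier S" "y = f y'"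
      using ex by metis
    then show "x \<cdot>\<^bsub>T\<^esub> y \<in> carrier T"
      unfolding smap_image[OF assms(1), symmetric] by (simp add: smap_mult[OF assms(1), symmetric] closed)
  next
    fix x y z assume "x \<in> carrier T" "y \<in> carrier T" "z \<in> carrier T"
    then obtain x' y' z' where "x' \<in> carrier S" "x = f x'" "y' \<in> carrier S" "y = f y'"
      "z' \<in> carrier S" "z = f z'"
      using ex by metis
    then show "x \<cdot>\<^bsub>T\<^esub> y \<cdot>\<^bsub>T\<^esub> z = x \<cdot>\<^bsub>T\<^esub> (y \<cdot>\<^bsub>T\<^esub> z)"
      by (simp add: smap_mult[OF assms(1), symmetric] closed assoc)
  qed
qed

lemma smap_sval:
  assumes "smap f S T" "sgrp S" "xs \<noteq> []" "set xs \<subseteq> carrier S"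
  shows "sval T (map f xs) = f (sval S xs)"
proof -
  interpret sgrp S by fact
  show ?thesis using assms(3,4)
  proof (induction xs)
    case (Cons x xs)
    then show ?case using sval_closed[of xs]
      by (cases "xs = []") (simp_all add: sval_Cons smap_mult[OF assms(1)])
  qed simp
qed

lemma smap_satisfies:
  assumes "smap f S T" "sgrp S" "satisfies S p" "is_identity p"
  shows "satisfies T p"
  unfolding satisfies_def
proof (intro allI impI)
  fix \<phi> :: "nat \<Rightarrow> 'b" assume \<phi>: "range \<phi> \<subseteq> carrier T"
  define \<psi> where "\<psi> = inv_into (carrier S) f \<circ> \<phi>"
  have im: "f ` carrier S = carrier T" using assms(1) by (auto simp: smap_def)
  have \<psi>: "range \<psi> \<subseteq> carrier S" "f \<circ> \<psi> = \<phi>"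
    using \<phi> im by (auto simp: \<psi>_def fun_eq_iff inv_into_into f_inv_into_f image_subset_iff)
  have "word_value T \<phi> w = f (word_value S \<psi> w)" if "w \<noteq> []" for w
    using smap_sval[OF assms(1,2), of "map \<psi> w"] that \<psi> by (auto simp: word_value_sval)
  then show "word_value T \<phi> (fst p) = word_value T \<phi> (snd p)"
    using assms(3,4) \<psi>(1) by (simp add: is_identity_def satisfies_def)
qed

lemma smap_variety:
  assumes "smap f S T" "S \<in> variety E" "\<forall>p \<in> E. is_identity p"
  shows "T \<in> variety E"
proof -
  have "sgrp S" "\<forall>p \<in> E. satisfies S p" using assms(2) by (auto simp: variety_def)
  then show ?thesis using smap_sgrp[OF assms(1)] smap_satisfies[OF assms(1)] assms(3)
    by (simp add: variety_def)
qed

lemma smap_req: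
  assumes "smap f S T" "sgrp S" "req S x y" "x \<in> carrier S" "y \<in> carrier S"
  shows "req T (f x) (f y)"
proof -
  have "rle T (f x) (f y)" if "rle S x y" "y \<in> carrier S" for x y
  proof -
    have "f s \<in> carrier T \<and> f (y \<cdot>\<^bsub>S\<^esub> s) = f y \<cdot>\<^bsub>T\<^esub> f s" if "s \<in> carrier S" for s
      using assms(1) that \<open>y \<in> carrier S\<close> by (auto simp: smap_def)
    then show ?thesis using that(1) unfolding rle_def by metis
  qed
  then show ?thesis using assms by (simp add: req_def)
qed

lemma smap_sgenerate:
  assumes "smap f S T" "sgrp S" "A \<subseteq> carrier S"
  shows "sgenerate T (f ` A) = f ` sgenerate S A"
proof -
  interpret sgrp S by fact
  interpret T: sgrp T using smap_sgrp assms by blast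
  have "f ` A \<subseteq> carrier T" using assms by (auto simp: smap_def)
  moreover have "{ys. ys \<noteq> [] \<and> set ys \<subseteq> f ` A} = map f ` {xs. xs \<noteq> [] \<and> set xs \<subseteq> A}"
    using lists_image[of f A] by (auto simp: lists_eq_set)
  ultimately have "sgenerate T (f ` A) = (\<lambda>xs. sval T (map f xs)) ` {xs. xs \<noteq> [] \<and> set xs \<subseteq> A}"
    by (simp add: T.sgenerate_image image_image)
  also have "\<dots> = (\<lambda>xs. f (sval S xs)) ` {xs. xs \<noteq> [] \<and> set xs \<subseteq> A}"
    using smap_sval[OF assms(1,2)] assms(3) by (intro image_cong) auto
  finally show ?thesis by (simp add: sgenerate_image[OF assms(3)] image_image)
qed

lemma smap_R_finite:
  assumes "smap f S T" "sgrp S" "R_finite S" shows "R_finite T"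
proof -
  interpret sgrp S by fact
  interpret T: sgrp T using smap_sgrp assms by blast
  obtain F where F: "finite F" "F \<subseteq> carrier S" "\<And>x. x \<in> carrier S \<Longrightarrow> \<exists>y \<in> F. req S y x"
    using Rcl_finite_reps[OF assms(3)[unfolded R_finite_iff] order_refl] by metis
  have "finite (Rcl T ` carrier T)"
  proof (rule T.finite_Rcl_image)
    show "finite (f ` F)" using F(1) by simp
    show "f ` F \<subseteq> carrier T" using F(2) smap_image[OF assms(1)] by (metis image_mono)
    fix x assume "x \<in> carrier T"
    then obtain x' where x': "x' \<in> carrier S" "x = f x'"
      using smap_image[OF assms(1)] by (metis imageE)
    then obtain y where y: "y \<in> F" "req S y x'" using F(3) by metis
    then have "req T (f y) x"
      using smap_req[OF assms(1,2) y(2)] x' F(2) by auto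
    then show "\<exists>y \<in> f ` F. req T y x" using y(1) by (rule_tac bexI[of _ "f y"]) auto
  qed auto
  then show ?thesis by (simp add: T.R_finite_iff)
qed

section \<open>Passing to another carrier type\<close>

definition copy :: "('a \<Rightarrow> 'b) \<Rightarrow> 'a sgrp \<Rightarrow> 'b sgrp"
  where "copy f S = \<lparr>carrier = f ` carrier S,
    sprod = (\<lambda>a b. f (inv_into (carrier S) f a \<cdot>\<^bsub>S\<^esub> inv_into (carrier S) f b))\<rparr>"

lemma smap_copy:
  assumes "inj_on f (carrier S)" "sgrp S"
  shows "smap f S (copy f S)" "smap (inv_into (carrier S) f) (copy f S) S"
  using assms sgrp.closed[OF assms(2)] by (auto simp: smap_def copy_def image_image)

lemma sub_variety:
  assumes "S \<in> variety E" "\<forall>p \<in> E. is_identity p" "T \<noteq> {}" "T \<subseteq> carrier S"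
    "\<And>x y. \<lbrakk>x \<in> T; y \<in> T\<rbrakk> \<Longrightarrow> x \<cdot>\<^bsub>S\<^esub> y \<in> T"
  shows "sub S T \<in> variety E"
proof -
  interpret sgrp S using assms(1) by (simp add: variety_def)
  have "satisfies (sub S T) p" if "p \<in> E" for p
  proof -
    have "satisfies S p" using that assms(1) by (simp add: variety_def)
    moreover have "range \<phi> \<subseteq> carrier S" if "range \<phi> \<subseteq> T" for \<phi> :: "nat \<Rightarrow> 'a"
      using that assms(4) by (rule order_trans)
    ultimately show ?thesis by (simp add: satisfies_def word_value_sval)
  qed
  then show ?thesis using sub_sgrp[OF assms(3-5)] by (simp add: variety_def)
qed

lemma sgenerate_variety:
  assumes "S \<in> variety E" "\<forall>p \<in> E. is_identity p" "A \<noteq> {}" "A \<subseteq> carrier S"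
  shows "sub S (sgenerate S A) \<in> variety E"
proof (rule sub_variety[OF assms(1,2)])
  interpret sgrp S using assms(1) by (simp add: variety_def)
  show "sgenerate S A \<subseteq> carrier S" using sgenerate_closed assms(4) .
  show "sgenerate S A \<noteq> {}" using assms(3) sgenerate.incl by fastforce
qed (auto intro: sgenerate.prod)

lemma inj_infinite:
  assumes "countable X" "infinite (UNIV :: 'b set)"
  shows "\<exists>f :: 'a \<Rightarrow> 'b. inj_on f X"
proof -
  obtain g :: "nat \<Rightarrow> 'b" where "inj g" using infinite_countable_subset[OF assms(2)] by blast
  moreover obtain h :: "'a \<Rightarrow> nat" where "inj_on h X" using countableE[OF assms(1)] by blast
  ultimately show ?thesis by (intro exI[of _ "g \<circ> h"] comp_inj_on) (auto intro: inj_on_subset)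
qed

text \<open>The hypothesis concerns the single type \<open>'a\<close>, while \<open>S\<close> lives
  over an arbitrary one. A finitely generated subsemigroup is countable, so it has an isomorphic
  copy inside the infinite type \<open>'a\<close>, and R-finiteness comes back along the inverse
  map.\<close>

lemma locally_R_finite_sgenerate:
  fixes S :: "'x sgrp"
  assumes inf: "infinite (UNIV :: 'a set)"
    and lR: "locally_R_finite_variety (variety E :: 'a sgrp set)"
    and E: "\<forall>p \<in> E. is_identity p"
    and S: "S \<in> variety E" "finite A" "A \<subseteq> carrier S" "A \<noteq> {}"
  shows "R_finite (sub S (sgenerate S A))"
proof -
  interpret sgrp S using S(1) by (simp add: variety_def)
  define T where "T = sub S (sgenerate S A)"
  have T: "T \<in> variety E" using sgenerate_variety S E T_def by blast
  interpret T: sgrp T using T by (simp add: variety_def)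
  obtain f :: "'x \<Rightarrow> 'a" where f: "inj_on f (carrier T)"
    using inj_infinite[OF countable_sgenerate[OF S(3,2)] inf] by (auto simp: T_def)
  note c = smap_copy[OF f T.sgrp_axioms]
  have AT: "A \<subseteq> carrier T" by (auto simp: T_def intro: sgenerate.incl)
  have "sgenerate (copy f T) (f ` A) = f ` carrier T"
    using smap_sgenerate[OF c(1) T.sgrp_axioms AT] by (simp add: T_def)
  then have "finitely_generated (copy f T)"
    unfolding finitely_generated_def using S(2) AT
    by (intro exI[of _ "f ` A"]) (auto simp: copy_def)
  moreover have "copy f T \<in> variety E" using smap_variety[OF c(1) T E] .
  ultimately have "R_finite (copy f T)" using lR by (auto simp: locally_R_finite_variety_def)
  then show ?thesis using smap_R_finite[OF c(2)] smap_sgrp[OF c(1) T.sgrp_axioms] T_def by blast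
qed

section \<open>Direct products and powers\<close>

definition prodS :: "'a sgrp \<Rightarrow> 'b sgrp \<Rightarrow> ('a \<times> 'b) sgrp"
  where "prodS S T = \<lparr>carrier = carrier S \<times> carrier T,
    sprod = (\<lambda>x y. (fst x \<cdot>\<^bsub>S\<^esub> fst y, snd x \<cdot>\<^bsub>T\<^esub> snd y))\<rparr>"

lemma prodS_sval:
  "xs \<noteq> [] \<Longrightarrow> sval (prodS S T) xs = (sval S (map fst xs), sval T (map snd xs))"
proof (induction xs)
  case (Cons x xs)
  then show ?case by (cases "xs = []") (simp_all add: sval_Cons, simp add: prodS_def)
qed simp

lemma prodS_variety:
  assumes "S \<in> variety E" "T \<in> variety E" "\<forall>p \<in> E. is_identity p"
  shows "prodS S T \<in> variety E"
proof -
  interpret S: sgrp S using assms(1) by (simp add: variety_def)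
  interpret T: sgrp T using assms(2) by (simp add: variety_def)
  have "sgrp (prodS S T)"
    using S.nonempty T.nonempty
    by unfold_locales (auto simp: prodS_def S.closed T.closed S.assoc T.assoc)
  moreover have "satisfies (prodS S T) p" if "p \<in> E" for p
  proof -
    have "range (fst \<circ> \<phi>) \<subseteq> carrier S \<and> range (snd \<circ> \<phi>) \<subseteq> carrier T"
      if "range \<phi> \<subseteq> carrier (prodS S T)" for \<phi> :: "nat \<Rightarrow> 'a \<times> 'b"
      using that by (auto simp: prodS_def image_subset_iff mem_Times_iff)
    moreover have "satisfies S p" "satisfies T p" "is_identity p"
      using that assms by (auto simp: variety_def)
    ultimately show ?thesis
      by (auto simp: satisfies_def word_value_sval prodS_sval is_identity_def)
  qed
  ultimately show ?thesis by (simp add: variety_def)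
qed

text \<open>Elements are functions of a variable, so one equation in the power is an equation in
  \<open>S\<close> valid for all values of that variable. This turns R-equivalence into identities
  later on.\<close>

definition powS :: "'a sgrp \<Rightarrow> ('i \<Rightarrow> 'a) sgrp"
  where "powS S = \<lparr>carrier = {f. range f \<subseteq> carrier S}, sprod = (\<lambda>f g i. f i \<cdot>\<^bsub>S\<^esub> g i)\<rparr>"

lemma powS_sval: "xs \<noteq> [] \<Longrightarrow> sval (powS S) xs i = sval S (map (\<lambda>f. f i) xs)"
proof (induction xs)
  case (Cons x xs)
  then show ?case by (cases "xs = []") (simp_all add: sval_Cons, simp add: powS_def)
qed simp

lemma powS_variety:
  assumes "S \<in> variety E" "\<forall>p \<in> E. is_identity p"
  shows "(powS S :: ('i \<Rightarrow> 'a) sgrp) \<in> variety E"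
proof -
  interpret sgrp S using assms(1) by (simp add: variety_def)
  obtain c where "c \<in> carrier S" using nonempty by blast
  then have "(\<lambda>_. c) \<in> carrier (powS S)" by (simp add: powS_def)
  then have "sgrp (powS S :: ('i \<Rightarrow> 'a) sgrp)"
    by unfold_locales (blast, simp_all add: powS_def assoc closed image_subset_iff)
  moreover have "satisfies (powS S :: ('i \<Rightarrow> 'a) sgrp) p" if "p \<in> E" for p
    unfolding satisfies_def
  proof (intro allI impI ext)
    fix \<phi> :: "nat \<Rightarrow> 'i \<Rightarrow> 'a" and i assume "range \<phi> \<subseteq> carrier (powS S)"
    then have "range (\<lambda>n. \<phi> n i) \<subseteq> carrier S" by (auto simp: powS_def) 
    moreover have "satisfies S p" "is_identity p" using that assms by (auto simp: variety_def)
    ultimately show "word_value (powS S) \<phi> (fst p) i = word_value (powS S) \<phi> (snd p) i"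
      by (auto simp: satisfies_def word_value_sval powS_sval is_identity_def comp_def)
  qed
  ultimately show ?thesis by (simp add: variety_def)
qed

section \<open>Finitely generated completely regular semigroups\<close>

context sgrp
begin

lemma sval_concat_replicate:
  assumes "m \<noteq> []" "set m \<subseteq> carrier S" "n > 0"
  shows "sval S (concat (replicate n m)) = spow S (sval S m) n"
  using assms(3)
proof (induction n rule: nat_induct_non_zero)
  case (Suc n)
  then show ?case
    using sval_append[of m "concat (replicate n m)"] assms by (auto simp: spow_Suc)
qed simp

lemma sval_append_cong:
  assumes "sval S X = sval S Y" "X \<noteq> []" "Y \<noteq> []"
    "set X \<subseteq> carrier S" "set Y \<subseteq> carrier S" "set Z \<subseteq> carrier S"
  shows "sval S (X @ Z) = sval S (Y @ Z)"
  using assms sval_append[of X Z] sval_append[of Y Z] by (cases "Z = []") auto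

end

text \<open>Periodicity and complete regularity are merged into one exponent,
  \<open>x ^ (p + 1) = x\<close>. The generating set is fixed because the later inductions run over
  sets of generators.\<close>

locale cr_sgrp = sgrp S for S :: "'a sgrp" (structure) +
  fixes A :: "'a set" and p :: nat
  assumes fin: "finite A" and gen: "carrier S = sgenerate S A" and p_pos: "p > 0"
    and cr: "x \<in> carrier S \<Longrightarrow> spow S x (Suc p) = x"
begin

lemma A_sub: "A \<subseteq> carrier S"
  using gen sgenerate.incl by fastforce

lemma spow_p_mult:
  assumes "x \<in> carrier S" "n > 0" shows "spow S x p \<cdot> spow S x n = spow S x n"
  using assms(2)
proof (induction n rule: nat_induct_non_zero)
  case 1
  then show ?case using cr[OF assms(1)] spow_Suc2[OF assms(1) p_pos] by simp
next
  case (Suc n)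
  have "spow S x p \<cdot> (x \<cdot> spow S x n) = (spow S x p \<cdot> x) \<cdot> spow S x n"
    using assms(1) Suc.hyps p_pos by (simp add: assoc spow_closed)
  also have "spow S x p \<cdot> x = x" using cr[OF assms(1)] spow_Suc2[OF assms(1) p_pos] by simp
  finally show ?case using Suc.hyps by (simp add: spow_Suc)
qed

text \<open>Write \<open>w = x a y\<close> and \<open>m = a y\<close>. Then
  \<open>m = m ^ (p + 1)\<close>, so \<open>w\<close> equals \<open>x m m ^ p\<close>, and
  \<open>m ^ p\<close> is a word that begins with \<open>a\<close>.\<close>

lemma absorb_letter_right:
  assumes "set w \<subseteq> A" "a \<in> set w"
  shows "\<exists>vs. set vs \<subseteq> set w \<and> sval S (w @ a # vs) = sval S w"
proof -
  obtain x y where w: "w = x @ a # y" using split_list[OF assms(2)] by blast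
  obtain p' where p': "p = Suc p'" using p_pos gr0_conv_Suc by blast
  define m where "m = a # y"
  have m: "m \<noteq> []" "set m \<subseteq> carrier S" using assms A_sub w by (auto simp: m_def)
  have "sval S (w @ a # y @ concat (replicate p' m)) = sval S (x @ concat (replicate (Suc p) m))"
    by (simp add: w m_def p')
  also have "\<dots> = foldr (sprod S) x (sval S (concat (replicate (Suc p) m)))"
    using m(1) by (intro sval_append_foldr) simp
  also have "sval S (concat (replicate (Suc p) m)) = sval S m"
    using sval_concat_replicate[OF m, of "Suc p"] cr sval_closed[OF m] by simp
  also have "foldr (sprod S) x (sval S m) = sval S w"
    using sval_append_foldr[OF m(1), of S x] by (simp add: w m_def)
  finally show ?thesis
    by (intro exI[of _ "y @ concat (replicate p' m)"]) (auto simp: w m_def)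
qed

text \<open>The dual choice \<open>m = x a\<close> gives \<open>w = m ^ p w\<close>, where the word
  \<open>m ^ p\<close> ends in \<open>a\<close>.\<close>

lemma absorb_letter_left:
  assumes "set w \<subseteq> A" "a \<in> set w"
  shows "\<exists>us. set us \<subseteq> set w \<and> sval S (us @ a # w) = sval S w"
proof -
  obtain x y where w: "w = x @ a # y" using split_list[OF assms(2)] by blast
  obtain p' where p': "p = Suc p'" using p_pos gr0_conv_Suc by blast
  define m where "m = x @ [a]"
  have m: "m \<noteq> []" "set m \<subseteq> carrier S" using assms A_sub w by (auto simp: m_def)
  have "concat (replicate (p' + 2) m) = concat (replicate p' m) @ m @ m"
    by (simp only: replicate_add concat_append) (simp add: numeral_2_eq_2)
  then have c: "concat (replicate p' m) @ m @ m = concat (replicate (Suc p) m)"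
    by (simp add: p')
  have "sval S ((concat (replicate p' m) @ x) @ a # w) = sval S ((concat (replicate p' m) @ m @ m) @ y)"
    by (simp add: w m_def)
  also have "\<dots> = sval S (m @ y)"
  proof (rule sval_append_cong)
    show "sval S (concat (replicate p' m) @ m @ m) = sval S m"
      unfolding c using sval_concat_replicate[OF m, of "Suc p"] cr sval_closed[OF m] by simp
    show "set y \<subseteq> carrier S" using assms(1) A_sub w by auto
    show "set (concat (replicate p' m) @ m @ m) \<subseteq> carrier S" using m(2) by auto
  qed (use m in auto)
  finally show ?thesis
    by (intro exI[of _ "concat (replicate p' m) @ x"]) (auto simp: w m_def)
qed

text \<open>Appending a letter of \<open>w\<close> leaves the set of letters unchanged, so the
  induction hypothesis applies to \<open>w @ [a]\<close>; afterwards \<open>a\<close> itself is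
  absorbed.\<close>

lemma absorb_word_right:
  assumes "set w \<subseteq> A" "set v \<subseteq> set w"
  shows "\<exists>vs. set vs \<subseteq> set w \<and> sval S (w @ v @ vs) = sval S w"
  using assms
proof (induction v arbitrary: w)
  case Nil
  then show ?case by (intro exI[of _ "[]"]) simp
next
  case (Cons a v)
  have set: "set (w @ [a]) = set w" using Cons.prems by auto
  obtain vs where vs: "set vs \<subseteq> set w" "sval S ((w @ [a]) @ v @ vs) = sval S (w @ [a])"
    using Cons.IH[of "w @ [a]"] Cons.prems unfolding set by auto
  obtain us where us: "set us \<subseteq> set w" "sval S (w @ a # us) = sval S w"
    using absorb_letter_right[of w a] Cons.prems by auto
  have "sval S (((w @ [a]) @ v @ vs) @ us) = sval S ((w @ [a]) @ us)"
    using vs us Cons.prems A_sub by (intro sval_append_cong) auto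
  then have "sval S (w @ (a # v) @ vs @ us) = sval S w" using us(2) by simp
  then show ?case using vs(1) us(1) by (intro exI[of _ "vs @ us"]) simp
qed

lemma absorb_word_left:
  assumes "set w \<subseteq> A" "w \<noteq> []" "set v \<subseteq> set w"
  shows "\<exists>us. set us \<subseteq> set w \<and> sval S (us @ v @ w) = sval S w"
  using assms
proof (induction v arbitrary: w rule: rev_induct)
  case Nil
  then show ?case by (intro exI[of _ "[]"]) simp
next
  case (snoc a v)
  have set: "set (a # w) = set w" using snoc.prems by auto
  obtain us where us: "set us \<subseteq> set w" "sval S (us @ v @ a # w) = sval S (a # w)"
    using snoc.IH[of "a # w"] snoc.prems unfolding set by auto
  obtain vs where vs: "set vs \<subseteq> set w" "sval S (vs @ a # w) = sval S w"
    using absorb_letter_left[of w a] snoc.prems by auto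
  have "sval S ((vs @ us) @ (v @ [a]) @ w) = foldr (sprod S) vs (sval S (us @ v @ a # w))"
    using sval_append_foldr[of "us @ v @ a # w" S vs] by simp
  also have "\<dots> = sval S w"
    using us(2) vs(2) sval_append_foldr[of "a # w" S vs] by simp
  finally show ?case using us(1) vs(1) by (intro exI[of _ "vs @ us"]) simp
qed

text \<open>Content belongs to words, not to elements: one element may lie in
  \<open>content E\<close> for several \<open>E\<close>.\<close>

definition content :: "'a set \<Rightarrow> 'a set"
  where "content E = sval S ` {w. w \<noteq> [] \<and> set w = E}"

lemma content_closed: "E \<subseteq> A \<Longrightarrow> content E \<subseteq> carrier S"
  unfolding content_def using sval_closed A_sub by fastforce

lemma contentI: "\<lbrakk>w \<noteq> []; set w = E\<rbrakk> \<Longrightarrow> sval S w \<in> content E"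
  by (auto simp: content_def)

lemma contentE:
  assumes "x \<in> content E" obtains w where "w \<noteq> []" "set w = E" "x = sval S w"
  using assms by (auto simp: content_def)

lemma content_sgenerate: "content E \<subseteq> sgenerate S E"
  by (auto simp: content_def intro: sval_in_sgenerate)

lemma content_mult:
  assumes "x \<in> content E" "y \<in> content F" "E \<subseteq> A" "F \<subseteq> A"
  shows "x \<cdot> y \<in> content (E \<union> F)"
proof -
  obtain w where w: "w \<noteq> []" "set w = E" "x = sval S w" using contentE assms(1) .
  obtain v where v: "v \<noteq> []" "set v = F" "y = sval S v" using contentE assms(2) .
  have "x \<cdot> y = sval S (w @ v)" using sval_append[of w v] w v assms A_sub by auto
  then show ?thesis using w v contentI[of "w @ v"] by simp
qed

lemma content_foldr:
  assumes "x \<in> content E" "set t \<subseteq> A"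
  shows "foldr (sprod S) t x \<in> content (set t \<union> E)"
proof -
  obtain w where w: "w \<noteq> []" "set w = E" "x = sval S w" using contentE assms(1) .
  then show ?thesis using sval_append_foldr[of w S t] contentI[of "t @ w"] by simp
qed

lemma absorb_right:
  assumes "x \<in> content E" "E \<subseteq> A" "z \<in> sgenerate S E"
  shows "\<exists>v \<in> content E. x \<cdot> z \<cdot> v = x"
proof -
  have EC: "E \<subseteq> carrier S" using assms(2) A_sub by auto
  obtain w where w: "w \<noteq> []" "set w = E" "x = sval S w" using contentE assms(1) .
  obtain zs where zs: "zs \<noteq> []" "set zs \<subseteq> E" "z = sval S zs"
    using sgenerate_sval[OF EC assms(3)] by blast
  \<comment> \<open>\<open>w\<close> is appended to \<open>zs\<close> so that the cancelling factor
    \<open>w @ vs\<close> uses all letters of \<open>E\<close>.\<close>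
  obtain vs where vs: "set vs \<subseteq> E" "sval S (w @ (zs @ w) @ vs) = sval S w"
    using absorb_word_right[of w "zs @ w"] w zs assms(2) by auto
  have "x \<cdot> z \<cdot> sval S (w @ vs) = sval S ((w @ zs) @ w @ vs)"
    using w zs vs(1) EC sval_append[of w zs] sval_append[of "w @ zs" "w @ vs"] by auto
  then have "x \<cdot> z \<cdot> sval S (w @ vs) = x" using vs(2) w(3) by simp
  moreover have "sval S (w @ vs) \<in> content E" using w vs(1) by (intro contentI) auto
  ultimately show ?thesis by blast
qed

lemma absorb_left:
  assumes "x \<in> content E" "E \<subseteq> A" "z \<in> sgenerate S E"
  shows "\<exists>v \<in> content E. v \<cdot> z \<cdot> x = x"
proof -
  have EC: "E \<subseteq> carrier S" using assms(2) A_sub by auto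
  obtain w where w: "w \<noteq> []" "set w = E" "x = sval S w" using contentE assms(1) .
  obtain zs where zs: "zs \<noteq> []" "set zs \<subseteq> E" "z = sval S zs"
    using sgenerate_sval[OF EC assms(3)] by blast
  obtain us where us: "set us \<subseteq> E" "sval S (us @ (w @ zs) @ w) = sval S w"
    using absorb_word_left[of w "w @ zs"] w zs assms(2) by auto
  have "set us \<subseteq> carrier S" "set zs \<subseteq> carrier S" using us(1) zs(2) EC by auto
  then have "sval S (us @ w) \<cdot> z \<cdot> x = sval S (((us @ w) @ zs) @ w)"
    using w zs EC sval_append[of "us @ w" zs] sval_append[of "(us @ w) @ zs" w] by auto
  then have "sval S (us @ w) \<cdot> z \<cdot> x = x" using us(2) w(3) by simp
  moreover have "sval S (us @ w) \<in> content E" using w us(1) by (intro contentI) auto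
  ultimately show ?thesis by blast
qed

text \<open>Once every letter of \<open>E\<close> has occurred, whatever is multiplied on the right
  by letters of \<open>E\<close> can be undone. The R-class of a word is thus settled by its first
  prefix of full content.\<close>

lemma content_req:
  assumes "x \<in> content E" "E \<subseteq> A" "z \<in> sgenerate S E"
  shows "req S (x \<cdot> z) x"
proof -
  obtain v where "v \<in> content E" "x \<cdot> z \<cdot> v = x" using absorb_right[OF assms] by blast
  then show ?thesis
    using rle_mult[of x z] assms content_closed sgenerate_closed[of E] A_sub
    unfolding req_def rle_def by (metis subset_iff)
qed

lemma content_spow:
  assumes "x \<in> content E" "E \<subseteq> A" "n > 0" shows "spow S x n \<in> content E"
  using assms(3)
proof (induction n rule: nat_induct_non_zero)
  case (Suc n)
  then show ?case using content_mult[OF assms(1) Suc.IH assms(2,2)] by (simp add: spow_Suc)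
qed (use assms in simp)

end

section \<open>Groups inside a content\<close>

context cr_sgrp
begin

text \<open>For an idempotent \<open>f\<close> of \<open>content E\<close> this is the local
  submonoid \<open>f (content E) f\<close>, and it turns out to be a group.\<close>

definition Gset :: "'a set \<Rightarrow> 'a \<Rightarrow> 'a set"
  where "Gset E f = {g \<in> content E. f \<cdot> g = g \<and> g \<cdot> f = g}"

definition Gm :: "'a set \<Rightarrow> 'a \<Rightarrow> 'a monoid"
  where "Gm E f = \<lparr>carrier = Gset E f, monoid.mult = sprod S, one = f\<rparr>"

lemma Gset_mult:
  assumes "E \<subseteq> A" "f \<in> content E" "g \<in> Gset E f" "h \<in> Gset E f"
  shows "g \<cdot> h \<in> Gset E f"
proof -
  have "g \<in> carrier S" "h \<in> carrier S" "f \<in> carrier S"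
    using assms content_closed[OF assms(1)] by (auto simp: Gset_def)
  then show ?thesis
    using assms(3,4) content_mult[of g E h E] assms(1)
    by (auto simp: Gset_def assoc) (simp add: assoc[symmetric])
qed

text \<open>Provides the finite exponent demanded of a Novikov-Adian group. Absorption gives
  \<open>f = g v\<close>, and \<open>g ^ p\<close> is a left identity of \<open>g\<close>, hence of
  \<open>f\<close>.\<close>

lemma Gset_spow_p:
  assumes "E \<subseteq> A" "f \<in> content E" "g \<in> Gset E f"
  shows "spow S g p = f"
proof -
  have c: "g \<in> carrier S" "f \<in> carrier S" and gE: "g \<in> content E" and gf: "f \<cdot> g = g" "g \<cdot> f = g"
    using assms content_closed[OF assms(1)] by (auto simp: Gset_def)
  obtain v where v: "v \<in> content E" "f \<cdot> g \<cdot> v = f"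
    using absorb_right[OF assms(2,1), of g] gE content_sgenerate by blast
  have vc: "v \<in> carrier S" using v(1) content_closed[OF assms(1)] by auto
  have pc: "spow S g p \<in> carrier S" using c p_pos by (simp add: spow_closed)
  have "spow S g p \<cdot> g = g" using cr[OF c(1)] spow_Suc2[OF c(1) p_pos] by simp
  then have "spow S g p \<cdot> (g \<cdot> v) = g \<cdot> v" using c vc pc by (simp add: assoc[symmetric])
  then have "spow S g p \<cdot> f = f" using v(2) gf by simp
  moreover have "spow S g p \<cdot> f = spow S g p"
    using gf(2) c p_pos
    by (cases p) (auto simp: spow_Suc2 assoc spow_closed, metis assoc gr0I spow_1 spow_Suc2 spow_closed)
  ultimately show ?thesis by simp
qed

lemma Gset_f: "\<lbrakk>f \<in> content E; f \<cdot> f = f\<rbrakk> \<Longrightarrow> f \<in> Gset E f"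
  by (simp add: Gset_def)

lemma Gset_inv:
  assumes "E \<subseteq> A" "f \<in> content E" "f \<cdot> f = f" "g \<in> Gset E f"
  shows "\<exists>h \<in> Gset E f. h \<cdot> g = f"
proof -
  have c: "g \<in> carrier S" "f \<in> carrier S" and gE: "g \<in> content E" and gf: "f \<cdot> g = g" "g \<cdot> f = g"
    using assms content_closed[OF assms(1)] by (auto simp: Gset_def)
  obtain v where v: "v \<in> content E" "v \<cdot> g \<cdot> f = f"
    using absorb_left[OF assms(2,1), of g] gE content_sgenerate by blast
  have vc: "v \<in> carrier S" using v(1) content_closed[OF assms(1)] by auto
  \<comment> \<open>The left inverse \<open>v\<close> found by absorption need not lie in the group,
    but \<open>f v f\<close> does.\<close>
  have "f \<cdot> (v \<cdot> f) \<cdot> g = f \<cdot> (v \<cdot> g \<cdot> f)"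
    using c vc gf by (simp add: assoc closed)
  then have "f \<cdot> (v \<cdot> f) \<cdot> g = f" using v(2) assms(3) by simp
  moreover have "f \<cdot> (f \<cdot> (v \<cdot> f)) = f \<cdot> (v \<cdot> f)" "f \<cdot> (v \<cdot> f) \<cdot> f = f \<cdot> (v \<cdot> f)"
    using c vc assms(3) by (simp_all add: assoc closed assoc[of f f, symmetric])
  moreover have "f \<cdot> (v \<cdot> f) \<in> content E"
    using content_mult[OF assms(2) content_mult[OF v(1) assms(2)]] assms(1) by simp
  ultimately show ?thesis by (auto simp: Gset_def)
qed

lemma Gm_group:
  assumes "E \<subseteq> A" "f \<in> content E" "f \<cdot> f = f"
  shows "group (Gm E f)"
proof (rule groupI)
  have G: "g \<in> carrier S" if "g \<in> Gset E f" for g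
    using that content_closed[OF assms(1)] by (auto simp: Gset_def)
  show "x \<otimes>\<^bsub>Gm E f\<^esub> y \<otimes>\<^bsub>Gm E f\<^esub> z = x \<otimes>\<^bsub>Gm E f\<^esub> (y \<otimes>\<^bsub>Gm E f\<^esub> z)"
    if "x \<in> carrier (Gm E f)" "y \<in> carrier (Gm E f)" "z \<in> carrier (Gm E f)" for x y z
    using that by (simp add: Gm_def G assoc)
  show "x \<otimes>\<^bsub>Gm E f\<^esub> y \<in> carrier (Gm E f)"
    if "x \<in> carrier (Gm E f)" "y \<in> carrier (Gm E f)" for x y
    using that Gset_mult[OF assms(1,2)] by (simp add: Gm_def)
qed (use Gset_f assms Gset_inv[OF assms] in \<open>auto simp: Gm_def Gset_def\<close>)

text \<open>Inside a fixed content, all elements are related by J; a transversal \<open>Q\<close> of the R-classes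
  of \<open>content E \<cdot> f\<close> thus coordinatizes it by \<open>Q\<close> and the group of \<open>f\<close>.\<close>

lemma transversal:
  assumes "E \<subseteq> A" "f \<in> content E" "f \<cdot> f = f" "finite (Rcl S ` content E)"
  obtains Q z where "finite Q" "f \<in> Q" "\<And>q. q \<in> Q \<Longrightarrow> q \<in> content E \<and> q \<cdot> f = q \<and> z q \<in> content E"
    "\<And>q x. \<lbrakk>q \<in> Q; x \<in> content E; x \<cdot> f = x\<rbrakk> \<Longrightarrow> z q \<cdot> x \<in> Gset E f"
    "\<And>x. \<lbrakk>x \<in> content E; x \<cdot> f = x\<rbrakk> \<Longrightarrow> \<exists>q \<in> Q. x = q \<cdot> (z q \<cdot> x)"
proof -
  note cE = content_closed[OF assms(1)]
  have fc: "f \<in> carrier S" using assms(2) cE by auto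
  define D where "D = {x \<in> content E. x \<cdot> f = x}"
  have DE: "D \<subseteq> content E" by (auto simp: D_def)
  have "finite (Rcl S ` D)"
    by (rule finite_subset[OF image_mono[OF DE] assms(4)])
  then obtain F where F: "finite F" "F \<subseteq> D" "\<And>x. x \<in> D \<Longrightarrow> \<exists>y \<in> F. req S y x"
    using Rcl_finite_reps[of D] DE cE by (metis order_trans)
  define Q where "Q = insert f F"
  have fD: "f \<in> D" using assms by (simp add: D_def)
  have Q: "finite Q" "Q \<subseteq> D" using F fD by (auto simp: Q_def)
  \<comment> \<open>This \<open>v\<close> will be \<open>z q\<close>, which undoes \<open>q\<close>
    on the left: \<open>z q q = f\<close>. Hence \<open>q (z q (q s)) = q f s = q s\<close>, so
    multiplication by \<open>q z q\<close> fixes everything R-below \<open>q\<close>.\<close>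
  have "\<exists>v. v \<in> content E \<and> f \<cdot> v = v \<and> v \<cdot> q = f" if "q \<in> D" for q
  proof -
    have q: "q \<in> content E" "q \<cdot> f = q" using that by (auto simp: D_def)
    have qc: "q \<in> carrier S" using q(1) cE by auto
    obtain v where v: "v \<in> content E" "v \<cdot> q \<cdot> f = f"
      using absorb_left[OF assms(2,1), of q] q(1) content_sgenerate by blast
    have vc: "v \<in> carrier S" using v(1) cE by auto
    have "v \<cdot> q = f" using v(2) q(2) qc vc fc by (simp add: assoc)
    then have "f \<cdot> v \<cdot> q = f" "f \<cdot> (f \<cdot> v) = f \<cdot> v"
      using qc vc fc assms(3) by (simp_all add: assoc) (simp add: assoc[symmetric])
    moreover have "f \<cdot> v \<in> content E" using content_mult[OF assms(2) v(1) assms(1,1)] by simp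
    ultimately show ?thesis by blast
  qed
  then obtain z where z: "\<And>q. q \<in> D \<Longrightarrow> z q \<in> content E \<and> f \<cdot> z q = z q \<and> z q \<cdot> q = f"
    by metis
  show ?thesis
  proof (rule that[of Q z])
    show "finite Q" "f \<in> Q" using Q by (auto simp: Q_def)
    show "q \<in> content E \<and> q \<cdot> f = q \<and> z q \<in> content E" if "q \<in> Q" for q
      using that Q(2) z[of q] by (auto simp: D_def)
    show "z q \<cdot> x \<in> Gset E f" if "q \<in> Q" "x \<in> content E" "x \<cdot> f = x" for q x
    proof -
      have zq: "z q \<in> content E" "f \<cdot> z q = z q" using z[of q] that(1) Q(2) by auto
      have c: "z q \<in> carrier S" "x \<in> carrier S" using zq(1) that(2) cE by auto
      have "f \<cdot> (z q \<cdot> x) = z q \<cdot> x" using zq(2) c fc by (simp add: assoc[symmetric])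
      moreover have "z q \<cdot> x \<cdot> f = z q \<cdot> x" using that(3) c fc by (simp add: assoc)
      ultimately show ?thesis
        using content_mult[OF zq(1) that(2) assms(1,1)] by (simp add: Gset_def)
    qed
    show "\<exists>q \<in> Q. x = q \<cdot> (z q \<cdot> x)" if "x \<in> content E" "x \<cdot> f = x" for x
    proof -
      have xD: "x \<in> D" using that by (simp add: D_def)
      obtain q where q: "q \<in> F" "req S q x" using F(3)[OF xD] by blast
      have qD: "q \<in> D" using q(1) F(2) by auto
      have zq: "z q \<in> carrier S" "z q \<cdot> q = f" using z[OF qD] cE by auto
      have qc: "q \<in> carrier S" "q \<cdot> f = q" using qD DE cE by (auto simp: D_def)
      have "q \<cdot> (z q \<cdot> (q \<cdot> s)) = q \<cdot> s" if "s \<in> carrier S" for s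
        using that zq qc fc assoc[of "z q" q s] assoc[of q f s] by simp
      moreover have "q \<cdot> (z q \<cdot> q) = q" using zq qc by simp
      moreover have "rle S x q" using q(2) by (simp add: req_def)
      ultimately have "x = q \<cdot> (z q \<cdot> x)" unfolding rle_def by metis
      then show ?thesis using q(1) by (auto simp: Q_def)
    qed
  qed
qed

text \<open>Schreier's argument with \<open>Q\<close> as the coset representatives, and without
  inverses: moving a letter \<open>a\<close> past a representative \<open>q'\<close> leaves a new
  representative \<open>q''\<close> and the generator \<open>z q'' (a q')\<close>. A final
  multiplication by \<open>f\<close> turns the leftover representative \<open>q\<close> into the
  group element \<open>f q\<close>.\<close>

lemma Gset_finitely_generated:
  assumes "E \<subseteq> A" "f \<in> content E" "f \<cdot> f = f" "finite (Rcl S ` content E)"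
  shows "\<exists>\<Gamma>. finite \<Gamma> \<and> \<Gamma> \<subseteq> Gset E f \<and> Gset E f \<subseteq> sgenerate S \<Gamma>"
proof -
  note cE = content_closed[OF assms(1)]
  have fc: "f \<in> carrier S" using assms(2) cE by auto
  have finE: "finite E" using assms(1) fin finite_subset by blast
  obtain Q z where Q: "finite Q" "f \<in> Q"
    "\<And>q. q \<in> Q \<Longrightarrow> q \<in> content E \<and> q \<cdot> f = q \<and> z q \<in> content E"
    "\<And>q x. \<lbrakk>q \<in> Q; x \<in> content E; x \<cdot> f = x\<rbrakk> \<Longrightarrow> z q \<cdot> x \<in> Gset E f"
    "\<And>x. \<lbrakk>x \<in> content E; x \<cdot> f = x\<rbrakk> \<Longrightarrow> \<exists>q \<in> Q. x = q \<cdot> (z q \<cdot> x)"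
    using transversal[OF assms] by metis
  define \<Gamma> where "\<Gamma> = (\<lambda>q. f \<cdot> q) ` Q \<union> (\<lambda>(q, a, q'). z q \<cdot> (a \<cdot> q')) ` (Q \<times> E \<times> Q)"
  have aq: "a \<cdot> q \<in> content E \<and> a \<cdot> q \<cdot> f = a \<cdot> q" if "a \<in> E" "q \<in> Q" for a q
  proof -
    have "a \<in> carrier S" using that(1) assms(1) A_sub by auto
    moreover have "q \<in> carrier S" using Q(3)[OF that(2)] cE by auto
    moreover have "a \<cdot> q \<in> content ({a} \<union> E)"
      using content_foldr[of q E "[a]"] Q(3)[OF that(2)] that(1) assms(1) by auto
    ultimately show ?thesis
      using Q(3)[OF that(2)] that(1) fc by (simp add: assoc insert_absorb)
  qed
  have fq: "f \<cdot> q \<in> Gset E f" if "q \<in> Q" for q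
  proof -
    have "q \<in> carrier S" using Q(3)[OF that] cE by auto
    then show ?thesis
      using Q(3)[OF that] content_mult[OF assms(2), of q E] assms(1,3) fc
      by (simp add: Gset_def assoc) (simp add: assoc[symmetric])
  qed
  have \<Gamma>G: "\<Gamma> \<subseteq> Gset E f" using fq Q(4) aq by (auto simp: \<Gamma>_def)
  have \<Gamma>S: "\<Gamma> \<subseteq> carrier S" using \<Gamma>G cE by (auto simp: Gset_def)
  have fin\<Gamma>: "finite \<Gamma>" using Q(1) finE by (simp add: \<Gamma>_def)
  have step: "\<exists>q' \<in> Q. \<exists>h \<in> sgenerate S \<Gamma>. foldr (sprod S) t q = q' \<cdot> h"
    if "set t \<subseteq> E" "q \<in> Q" for t q
    using that
  proof (induction t)
    case Nil
    have "f \<in> \<Gamma>" unfolding \<Gamma>_def using Q(2) assms(3) by force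
    then have "f \<in> sgenerate S \<Gamma>" by (rule sgenerate.incl)
    moreover have "foldr (sprod S) [] q = q \<cdot> f" using Q(3)[OF Nil(2)] by simp
    ultimately show ?case using Nil(2) by blast
  next
    case (Cons a t)
    then obtain q' h where q': "q' \<in> Q" "h \<in> sgenerate S \<Gamma>" "foldr (sprod S) t q = q' \<cdot> h"
      by auto
    have aE: "a \<in> E" using Cons.prems by simp
    obtain q'' where q'': "q'' \<in> Q" "a \<cdot> q' = q'' \<cdot> (z q'' \<cdot> (a \<cdot> q'))"
      using Q(5) aq[OF aE q'(1)] by blast
    have g: "z q'' \<cdot> (a \<cdot> q') \<in> \<Gamma>" using q'(1) q''(1) aE by (force simp: \<Gamma>_def)
    have c: "a \<in> carrier S" "q' \<in> carrier S" "q'' \<in> carrier S" "h \<in> carrier S"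
      "z q'' \<cdot> (a \<cdot> q') \<in> carrier S"
      using aE assms(1) A_sub Q(3)[OF q'(1)] Q(3)[OF q''(1)] cE q'(2) sgenerate_closed[OF \<Gamma>S] g \<Gamma>S
      by auto
    have "foldr (sprod S) (a # t) q = (a \<cdot> q') \<cdot> h" using q'(3) c by (simp add: assoc)
    also have "\<dots> = q'' \<cdot> (z q'' \<cdot> (a \<cdot> q') \<cdot> h)" using c assoc q''(2) by metis
    finally show ?case using q''(1) q'(2) g by (blast intro: sgenerate.intros)
  qed
  have "g \<in> sgenerate S \<Gamma>" if "g \<in> Gset E f" for g
  proof -
    have "g \<in> content E" using that by (simp add: Gset_def)
    then obtain w where w: "w \<noteq> []" "set w = E" "g = sval S w" by (rule contentE)
    \<comment> \<open>Since \<open>g = g f\<close>, the letters of \<open>g\<close> can act on the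
      representative \<open>f\<close>.\<close>
    have "g = foldr (sprod S) w f"
      using that foldr_sval[OF w(1), of f] w assms(1) A_sub fc by (auto simp: Gset_def)
    then obtain q h where q: "q \<in> Q" "h \<in> sgenerate S \<Gamma>" "g = q \<cdot> h"
      using step[of w f] w(2) Q(2) by auto
    have "g = f \<cdot> (q \<cdot> h)" using that q(3) by (simp add: Gset_def)
    also have "\<dots> = (f \<cdot> q) \<cdot> h"
      using q Q(3)[OF q(1)] cE sgenerate_closed[OF \<Gamma>S] fc by (intro assoc[symmetric]) auto
    finally have "g = (f \<cdot> q) \<cdot> h" .
    moreover have "f \<cdot> q \<in> sgenerate S \<Gamma>"
      using q(1) by (intro sgenerate.incl) (simp add: \<Gamma>_def)
    ultimately show ?thesis using sgenerate.prod[of "f \<cdot> q" S \<Gamma> h] q(2) by simp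
  qed
  then show ?thesis using fin\<Gamma> \<Gamma>G by blast
qed

end

section \<open>The semigroups \<open>L G\<close> and infinite orbits of a group\<close>

lemma sval_sgenerate:
  "\<lbrakk>xs \<noteq> []; set xs \<subseteq> sgenerate S M\<rbrakk> \<Longrightarrow> sval S xs \<in> sgenerate S M"
proof (induction xs)
  case (Cons x xs)
  then show ?case by (cases "xs = []") (simp_all add: sval_Cons sgenerate.prod)
qed simp

lemma L_simps:
  "sprod (L G) (Inl g) (Inl h) = Inl (g \<otimes>\<^bsub>G\<^esub> h)"
  "sprod (L G) (Inl g) (Inr h) = Inr (g \<otimes>\<^bsub>G\<^esub> h)"
  "sprod (L G) (Inr g) b = Inr g"
  "carrier (L G) = carrier G <+> carrier G"
  by (auto simp: L_def split: sum.split)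

lemma L_sgrp:
  assumes "group G" shows "sgrp (L G)"
proof -
  interpret group G by fact
  show ?thesis
  proof
    show "carrier (L G) \<noteq> {}" using one_closed by (auto simp: L_simps)
  qed (auto simp: L_simps m_assoc)
qed

context cr_sgrp
begin

text \<open>The elements acting trivially on all R-classes \<open>h y\<close> form the kernel of \<open>\<pi>\<close> below.
  An identity of \<open>S\<close> is transferred to \<open>L G\<close> by replacing \<open>Inr (\<pi> g)\<close> by \<open>g h y\<close> for all \<open>h\<close>
  simultaneously: the letters after the first such factor do not change the R-class.\<close>

lemma orbit_finite:
  assumes E: "E \<subseteq> A" "f \<in> content E" "f \<cdot> f = f" "finite (Rcl S ` content E)"
    and M: "E \<subseteq> M" "M \<subseteq> A" "y \<in> content M"
    and inf: "infinite (UNIV :: 'd set)"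
    and S: "S \<in> variety I" "\<forall>p \<in> I. is_identity p"
    and noL: "\<And>G :: 'd monoid. novikov_adian G \<Longrightarrow> L G \<notin> variety I"
  shows "finite (Rcl S ` (\<lambda>g. g \<cdot> y) ` Gset E f)"
proof (rule ccontr)
  assume orb: "infinite (Rcl S ` (\<lambda>g. g \<cdot> y) ` Gset E f)"
  define G where "G = Gset E f"
  note cE = content_closed[OF E(1)]
  have Gc: "g \<in> carrier S" "g \<in> content E" if "g \<in> G" for g
    using that cE by (auto simp: G_def Gset_def)
  have Gf: "f \<cdot> g = g" "g \<cdot> f = g" if "g \<in> G" for g
    using that by (auto simp: G_def Gset_def)
  have yc: "y \<in> carrier S" using M content_closed by blast
  have Gm: "g \<cdot> h \<in> G" if "g \<in> G" "h \<in> G" for g h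
    using Gset_mult[OF E(1,2)] that by (simp add: G_def)
  have fG: "f \<in> G" using Gset_f[OF E(2,3)] by (simp add: G_def)
  have gy: "g \<cdot> y \<in> content M" if "g \<in> G" for g
    using content_mult[OF Gc(2)[OF that] M(3)] E(1) M(1,2) by (simp add: Un_absorb1)
  have ghy: "g \<cdot> (h \<cdot> y) \<in> content M" if "g \<in> G" "h \<in> G" for g h
    using content_mult[OF Gc(2)[OF that(1)] gy[OF that(2)]] E(1) M(1,2) by (simp add: Un_absorb1)
  have gyc: "g \<cdot> y \<in> carrier S" if "g \<in> G" for g
    using gy[OF that] content_closed[OF M(2)] by auto
  have ghyc: "g \<cdot> (h \<cdot> y) \<in> carrier S" if "g \<in> G" "h \<in> G" for g h
    using ghy[OF that] content_closed[OF M(2)] by auto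
  interpret Gg: group "Gm E f" using Gm_group[OF E(1-3)] .
  have Gmc: "carrier (Gm E f) = G" by (simp add: Gm_def G_def)

  \<comment> \<open>Comparing all translates \<open>h y\<close>, and not \<open>y\<close> alone,
    makes this relation compatible with multiplication on both sides.\<close>
  define eqv where "eqv g g' \<longleftrightarrow> (\<forall>h \<in> G. req S (g \<cdot> (h \<cdot> y)) (g' \<cdot> (h \<cdot> y)))" for g g'
  define cls where "cls g = {g' \<in> G. eqv g g'}" for g
  have cls_eq: "cls g = cls g' \<longleftrightarrow> eqv g g'" if "g \<in> G" "g' \<in> G" for g g'
  proof
    assume "cls g = cls g'"
    moreover have "g' \<in> cls g'" using that by (simp add: cls_def eqv_def)
    ultimately show "eqv g g'" by (auto simp: cls_def)
  next
    assume e: "eqv g g'"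
    have "eqv g k \<longleftrightarrow> eqv g' k" if "k \<in> G" for k
      using e req_trans req_sym ghyc \<open>g \<in> G\<close> \<open>g' \<in> G\<close> that unfolding eqv_def by meson
    then show "cls g = cls g'" by (auto simp: cls_def)
  qed
  have "countable G"
  proof (rule countable_subset)
    show "G \<subseteq> sgenerate S A" using Gc(1) gen by auto
    show "countable (sgenerate S A)" using countable_sgenerate A_sub fin by blast
  qed
  then have "countable (cls ` G)" by (rule countable_image)
  \<comment> \<open>The quotient group has to live over the type \<open>'d\<close>, the only one
    that \<open>noL\<close> speaks about; countability of \<open>G\<close> provides names for its
    elements there.\<close>
  then obtain \<iota> :: "'a set \<Rightarrow> 'd" where \<iota>: "inj_on \<iota> (cls ` G)"
    using inj_infinite[OF _ inf] by blast
  define \<pi> where "\<pi> g = \<iota> (cls g)" for g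
  have \<pi>: "\<pi> g = \<pi> g' \<longleftrightarrow> eqv g g'" if "g \<in> G" "g' \<in> G" for g g'
    using that cls_eq[OF that] inj_on_eq_iff[OF \<iota>, of "cls g" "cls g'"] by (simp add: \<pi>_def)
  define \<sigma> where "\<sigma> = inv_into G \<pi>"
  have \<sigma>: "\<sigma> b \<in> G" "\<pi> (\<sigma> b) = b" if "b \<in> \<pi> ` G" for b
    using that by (auto simp: \<sigma>_def inv_into_into f_inv_into_f)
  define Gd :: "'d monoid" where
    "Gd = \<lparr>carrier = \<pi> ` G, monoid.mult = (\<lambda>a b. \<pi> (\<sigma> a \<cdot> \<sigma> b)), one = \<pi> f\<rparr>"
  have Gdc: "carrier Gd = \<pi> ` G" "\<one>\<^bsub>Gd\<^esub> = \<pi> f" by (simp_all add: Gd_def)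
  have mult: "\<pi> g \<otimes>\<^bsub>Gd\<^esub> \<pi> k = \<pi> (g \<cdot> k)" if "g \<in> G" "k \<in> G" for g k
  proof -
    define g' k' where "g' = \<sigma> (\<pi> g)" and "k' = \<sigma> (\<pi> k)"
    have g': "g' \<in> G" "k' \<in> G" "eqv g' g" "eqv k' k"
      using \<sigma>[of "\<pi> g"] \<sigma>[of "\<pi> k"] that \<pi> by (auto simp: g'_def k'_def)
    \<comment> \<open>First \<open>k' h\<close> serves as another translate, which exchanges
      \<open>g'\<close> for \<open>g\<close>; then the left congruence property exchanges
      \<open>k'\<close> for \<open>k\<close>.\<close>
    have "req S (g' \<cdot> k' \<cdot> (h \<cdot> y)) (g \<cdot> k \<cdot> (h \<cdot> y))" if h: "h \<in> G" for h
    proof -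
      have "req S (g' \<cdot> ((k' \<cdot> h) \<cdot> y)) (g \<cdot> ((k' \<cdot> h) \<cdot> y))"
        using g' h Gm by (simp add: eqv_def)
      moreover have "req S (g \<cdot> (k' \<cdot> (h \<cdot> y))) (g \<cdot> (k \<cdot> (h \<cdot> y)))"
        using g' h ghyc \<open>g \<in> G\<close> \<open>k \<in> G\<close> Gc by (intro req_left) (auto simp: eqv_def)
      ultimately show ?thesis
        using g'(1,2) h \<open>g \<in> G\<close> \<open>k \<in> G\<close> Gc yc
        by (auto simp: assoc closed intro: req_trans)
    qed
    then have "\<pi> (g' \<cdot> k') = \<pi> (g \<cdot> k)" using \<pi> Gm g'(1,2) that by (simp add: eqv_def)
    then show ?thesis by (simp add: Gd_def g'_def k'_def)
  qed
  have hom: "\<pi> \<in> hom (Gm E f) Gd"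
    using mult by (auto simp: hom_def Gmc Gd_def) (simp add: Gm_def)
  have "Gd\<lparr>carrier := \<pi> ` carrier (Gm E f), one := \<pi> \<one>\<^bsub>Gm E f\<^esub>\<rparr> = Gd"
    by (simp add: Gd_def Gmc) (simp add: Gm_def)
  then have Gd: "group Gd" using Gg.hom_imp_img_group[OF hom] by simp
  interpret Gd: group Gd by fact
  \<comment> \<open>The translate by \<open>f\<close> shows that \<open>\<pi> g\<close> determines
    the R-class of \<open>g y\<close>.\<close>
  have "infinite (\<pi> ` G)"
  proof
    assume fp: "finite (\<pi> ` G)"
    have "Rcl S (g \<cdot> y) = Rcl S (\<sigma> (\<pi> g) \<cdot> y)" if "g \<in> G" for g
    proof -
      have s: "\<sigma> (\<pi> g) \<in> G" "\<pi> (\<sigma> (\<pi> g)) = \<pi> g" using \<sigma>[of "\<pi> g"] that by auto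
      then have "eqv g (\<sigma> (\<pi> g))" using \<pi> that by metis
      then have "req S (g \<cdot> (f \<cdot> y)) (\<sigma> (\<pi> g) \<cdot> (f \<cdot> y))" using fG by (simp add: eqv_def)
      moreover have "k \<cdot> (f \<cdot> y) = k \<cdot> y" if "k \<in> G" for k
        using Gf(2)[OF that] Gc(1)[OF that] Gc(1)[OF fG] yc by (simp add: assoc[symmetric])
      ultimately show ?thesis using Rcl_eq_iff gyc s(1) that by simp
    qed
    then have "Rcl S ` (\<lambda>g. g \<cdot> y) ` G \<subseteq> (\<lambda>b. Rcl S (\<sigma> b \<cdot> y)) ` \<pi> ` G" by auto
    then have "finite (Rcl S ` (\<lambda>g. g \<cdot> y) ` G)" using fp finite_surj finite_subset by blast
    then show False using orb by (simp add: G_def)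
  qed
  moreover have "\<exists>B. finite B \<and> B \<subseteq> carrier Gd \<and> generate Gd B = carrier Gd"
  proof -
    obtain \<Gamma> where \<Gamma>: "finite \<Gamma>" "\<Gamma> \<subseteq> G" "G \<subseteq> sgenerate S \<Gamma>"
      using Gset_finitely_generated[OF E] unfolding G_def by blast
    have "g \<in> G \<and> \<pi> g \<in> generate Gd (\<pi> ` \<Gamma>)" if "g \<in> sgenerate S \<Gamma>" for g
      using that
    proof induction
      case (incl g)
      then show ?case using \<Gamma>(2) generate.incl[of "\<pi> g" "\<pi> ` \<Gamma>"] by auto
    next
      case (prod g h)
      then show ?case using Gm generate.eng mult by metis
    qed
    then have "carrier Gd \<subseteq> generate Gd (\<pi> ` \<Gamma>)" using \<Gamma>(3) by (auto simp: Gdc)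
    moreover have "\<pi> ` \<Gamma> \<subseteq> carrier Gd" using \<Gamma>(2) by (auto simp: Gd_def)
    ultimately show ?thesis
      using \<Gamma>(1) Gd.generate_incl[of "\<pi> ` \<Gamma>"]
      by (intro exI[of _ "\<pi> ` \<Gamma>"]) (simp add: subset_antisym)
  qed
  moreover have "x [^]\<^bsub>Gd\<^esub> p = \<one>\<^bsub>Gd\<^esub>" if x: "x \<in> carrier Gd" for x
  proof -
    obtain g where g: "g \<in> G" "x = \<pi> g" using x unfolding Gdc by blast
    have "spow S g n \<in> G \<and> \<pi> g [^]\<^bsub>Gd\<^esub> n = \<pi> (spow S g n)" if "n > 0" for n
      using that
    proof (induction n rule: nat_induct_non_zero)
      case 1
      then show ?case using g mult[OF fG g(1)] Gf(1)[OF g(1)] by (simp add: Gdc)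
    next
      case (Suc n)
      then show ?case using g mult[of "spow S g n" g] Gm Gc(1)[OF g(1)] spow_Suc2[of g n] by simp
    qed
    from this[OF p_pos] show ?thesis
      using g Gset_spow_p[OF E(1,2), of g] by (simp add: G_def Gdc)
  qed
  ultimately have "novikov_adian Gd"
    unfolding novikov_adian_def using p_pos Gd by (auto simp: Gdc)
  moreover have "L Gd \<in> variety I"
  proof -
    define \<psi> where "\<psi> h x = (case x of Inl a \<Rightarrow> \<sigma> a | Inr a \<Rightarrow> \<sigma> a \<cdot> (h \<cdot> y))" for h x
    have LC: "carrier (L Gd) = \<pi> ` G <+> \<pi> ` G" by (simp add: L_simps Gdc)
    have \<psi>M: "\<psi> h x \<in> sgenerate S M" if "h \<in> G" "x \<in> carrier (L Gd)" for h x
    proof -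
      have "content E \<subseteq> sgenerate S M" "content M \<subseteq> sgenerate S M"
        using content_sgenerate sgenerate_mono[OF M(1)] by (metis order_trans, metis)
      then show ?thesis using that \<sigma>(1) Gc(2) ghy by (auto simp: LC \<psi>_def)
    qed
    have Mc: "sgenerate S M \<subseteq> carrier S" using sgenerate_closed M(2) A_sub by (metis order_trans)
    \<comment> \<open>Without a barred factor the value in \<open>S\<close> lies in \<open>G\<close>
      and is the same for every \<open>h\<close>. With one it is controlled only up to R, which is
      exactly the information that \<open>\<pi>\<close> retains.\<close>
    have key: "(\<exists>g \<in> G. sval (L Gd) xs = Inl (\<pi> g) \<and> (\<forall>h \<in> G. sval S (map (\<psi> h) xs) = g)) \<or>
        (\<exists>g \<in> G. sval (L Gd) xs = Inr (\<pi> g) \<and>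
          (\<forall>h \<in> G. req S (sval S (map (\<psi> h) xs)) (g \<cdot> (h \<cdot> y))))"
      if "xs \<noteq> []" "set xs \<subseteq> carrier (L Gd)" for xs
      using that
    proof (induction xs)
      case (Cons x xs)
      have x: "x \<in> carrier (L Gd)" and xs: "set xs \<subseteq> carrier (L Gd)" using Cons.prems by auto
      show ?case
      proof (cases x)
        case (Inr a)
        then have a: "\<sigma> a \<in> G" "\<pi> (\<sigma> a) = a" using x \<sigma> by (auto simp: LC)
        have "sval (L Gd) (x # xs) = Inr (\<pi> (\<sigma> a))"
          using a Inr by (cases "xs = []") (simp_all add: sval_Cons L_simps)
        moreover have "req S (sval S (map (\<psi> h) (x # xs))) (\<sigma> a \<cdot> (h \<cdot> y))" if "h \<in> G" for h
        proof (cases "xs = []")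
          case False
          have "sval S (map (\<psi> h) xs) \<in> sgenerate S M"
            using False xs \<psi>M[OF that] by (intro sval_sgenerate) auto
          then show ?thesis
            using content_req[OF ghy[OF a(1) that] M(2)] False Inr
            by (simp add: sval_Cons \<psi>_def)
        qed (simp add: Inr \<psi>_def)
        ultimately show ?thesis using a(1) by blast
      next
        case (Inl a)
        then have a: "\<sigma> a \<in> G" "\<pi> (\<sigma> a) = a" using x \<sigma> by (auto simp: LC)
        show ?thesis
        proof (cases "xs = []")
          case True
          then have "sval (L Gd) (x # xs) = Inl (\<pi> (\<sigma> a))"
            "\<forall>h \<in> G. sval S (map (\<psi> h) (x # xs)) = \<sigma> a"
            using a Inl by (auto simp: \<psi>_def)
          then show ?thesis using a(1) by blast
        next
          case False
          consider g where "g \<in> G" "sval (L Gd) xs = Inl (\<pi> g)"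
              "\<forall>h \<in> G. sval S (map (\<psi> h) xs) = g"
            | g where "g \<in> G" "sval (L Gd) xs = Inr (\<pi> g)"
              "\<forall>h \<in> G. req S (sval S (map (\<psi> h) xs)) (g \<cdot> (h \<cdot> y))"
            using Cons.IH[OF False xs] by blast
          then show ?thesis
          proof cases
            case 1
            then have "sval (L Gd) (x # xs) = Inl (\<pi> (\<sigma> a \<cdot> g))"
              using False Inl a mult[of "\<sigma> a" g] by (simp add: sval_Cons L_simps)
            moreover have "sval S (map (\<psi> h) (x # xs)) = \<sigma> a \<cdot> g" if "h \<in> G" for h
              using 1 that False Inl by (simp add: sval_Cons \<psi>_def)
            ultimately show ?thesis using Gm[OF a(1) 1(1)] by blast
          next
            case 2
            then have "sval (L Gd) (x # xs) = Inr (\<pi> (\<sigma> a \<cdot> g))"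
              using False Inl a mult[of "\<sigma> a" g] by (simp add: sval_Cons L_simps)
            moreover have "req S (sval S (map (\<psi> h) (x # xs))) (\<sigma> a \<cdot> g \<cdot> (h \<cdot> y))"
              if h: "h \<in> G" for h
            proof -
              have "sval S (map (\<psi> h) xs) \<in> carrier S"
                using False xs \<psi>M[OF h] Mc by (intro sval_closed) auto
              then have "req S (\<sigma> a \<cdot> sval S (map (\<psi> h) xs)) (\<sigma> a \<cdot> (g \<cdot> (h \<cdot> y)))"
                using 2 h a(1) Gc(1) ghyc by (intro req_left) auto
              then show ?thesis
                using False Inl 2(1) h a(1) Gc(1) gyc by (simp add: sval_Cons \<psi>_def assoc)
            qed
            ultimately show ?thesis using Gm[OF a(1) 2(1)] by blast
          qed
        qed
      qed
    qed simp
    \<comment> \<open>If only one side of an identity had a barred value, \<open>g\<close> would be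
      R-equivalent to all \<open>g' (h y)\<close>. As \<open>g' h\<close> runs through the whole
      group, the orbit would collapse to a single R-class.\<close>
    have mixed: False
      if g: "g \<in> G" "g' \<in> G" and r: "\<And>h. h \<in> G \<Longrightarrow> req S g (g' \<cdot> (h \<cdot> y))" for g g'
    proof -
      have "Rcl S (k \<cdot> y) = Rcl S g" if k: "k \<in> G" for k
      proof -
        obtain i where i: "i \<in> G" "g' \<cdot> i = f"
          using Gg.r_inv[of g'] Gg.inv_closed[of g'] g(2) unfolding Gmc by (auto simp: Gm_def)
        have "req S g (g' \<cdot> ((i \<cdot> k) \<cdot> y))" using r Gm i(1) k by blast
        moreover have "g' \<cdot> ((i \<cdot> k) \<cdot> y) = k \<cdot> y"
        proof -
          have "g' \<cdot> ((i \<cdot> k) \<cdot> y) = ((g' \<cdot> i) \<cdot> k) \<cdot> y"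
            using Gc(1) g(2) i(1) k yc by (simp add: assoc closed)
          then show ?thesis using i(2) Gf(1)[OF k] by simp
        qed
        ultimately show ?thesis using Rcl_eq_iff[of "k \<cdot> y" g] gyc k g(1) Gc(1) req_sym by auto
      qed
      then have "Rcl S ` (\<lambda>g. g \<cdot> y) ` G \<subseteq> {Rcl S g}" by auto
      then have "finite (Rcl S ` (\<lambda>g. g \<cdot> y) ` G)" by (rule finite_subset) simp
      then show False using orb by (simp add: G_def)
    qed
    have "satisfies (L Gd) q" if q: "q \<in> I" for q
      unfolding satisfies_def
    proof (intro allI impI)
      fix \<phi> :: "nat \<Rightarrow> 'd + 'd" assume \<phi>: "range \<phi> \<subseteq> carrier (L Gd)"
      have ne: "map \<phi> (fst q) \<noteq> []" "map \<phi> (snd q) \<noteq> []"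
        using S(2) q by (auto simp: is_identity_def)
      have sub: "set (map \<phi> w) \<subseteq> carrier (L Gd)" for w using \<phi> by auto
      have eq: "sval S (map (\<psi> h) (map \<phi> (fst q))) = sval S (map (\<psi> h) (map \<phi> (snd q)))"
        if "h \<in> G" for h
      proof -
        have "satisfies S q" using S(1) q by (simp add: variety_def)
        moreover have "range (\<lambda>n. \<psi> h (\<phi> n)) \<subseteq> carrier S" using \<psi>M[OF that] \<phi> Mc by blast
        ultimately show ?thesis by (simp add: satisfies_def word_value_sval comp_def)
      qed
      define valI where "valI w g \<longleftrightarrow> sval (L Gd) (map \<phi> w) = Inl (\<pi> g) \<and>
        (\<forall>h \<in> G. sval S (map (\<psi> h) (map \<phi> w)) = g)" for w g
      define valR where "valR w g \<longleftrightarrow> sval (L Gd) (map \<phi> w) = Inr (\<pi> g) \<and>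
        (\<forall>h \<in> G. req S (sval S (map (\<psi> h) (map \<phi> w))) (g \<cdot> (h \<cdot> y)))" for w g
      have k1: "(\<exists>g \<in> G. valI (fst q) g) \<or> (\<exists>g \<in> G. valR (fst q) g)"
        unfolding valI_def valR_def by (rule key[OF ne(1) sub])
      have k2: "(\<exists>g \<in> G. valI (snd q) g) \<or> (\<exists>g \<in> G. valR (snd q) g)"
        unfolding valI_def valR_def by (rule key[OF ne(2) sub])
      consider g g' where "g \<in> G" "g' \<in> G" "valI (fst q) g" "valI (snd q) g'"
        | g g' where "g \<in> G" "g' \<in> G" "valR (fst q) g" "valR (snd q) g'"
        | g g' where "g \<in> G" "g' \<in> G" "valI (fst q) g" "valR (snd q) g'"
        | g g' where "g \<in> G" "g' \<in> G" "valI (snd q) g" "valR (fst q) g'"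
        using k1 k2 by blast
      then have "sval (L Gd) (map \<phi> (fst q)) = sval (L Gd) (map \<phi> (snd q))"
      proof cases
        case 1
        then have "g = g'" using eq[OF fG] fG unfolding valI_def by metis
        then show ?thesis using 1 by (simp add: valI_def)
      next
        case 2
        have "req S (g \<cdot> (h \<cdot> y)) (g' \<cdot> (h \<cdot> y))" if h: "h \<in> G" for h
        proof -
          let ?v = "sval S (map (\<psi> h) (map \<phi> (fst q)))"
          have "req S ?v (g \<cdot> (h \<cdot> y))" using 2(3) h unfolding valR_def by blast
          moreover have "req S ?v (g' \<cdot> (h \<cdot> y))"
            unfolding eq[OF h] using 2(4) h unfolding valR_def by blast
          ultimately show ?thesis using req_sym req_trans ghyc[OF 2(1) h] ghyc[OF 2(2) h] by blast
        qed
        then have "\<pi> g = \<pi> g'" using \<pi>[OF 2(1,2)] by (simp add: eqv_def)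
        then show ?thesis using 2(3,4) by (simp add: valR_def)
      next
        case 3
        have "req S g (g' \<cdot> (h \<cdot> y))" if h: "h \<in> G" for h
        proof -
          have "sval S (map (\<psi> h) (map \<phi> (fst q))) = g" using 3(3) h unfolding valI_def by blast
          moreover have "req S (sval S (map (\<psi> h) (map \<phi> (snd q)))) (g' \<cdot> (h \<cdot> y))"
            using 3(4) h unfolding valR_def by blast
          ultimately show ?thesis using eq[OF h] by metis
        qed
        then show ?thesis using mixed[OF 3(1,2)] by blast
      next
        case 4
        have "req S g (g' \<cdot> (h \<cdot> y))" if h: "h \<in> G" for h
        proof -
          have "sval S (map (\<psi> h) (map \<phi> (snd q))) = g" using 4(3) h unfolding valI_def by blast
          moreover have "req S (sval S (map (\<psi> h) (map \<phi> (fst q)))) (g' \<cdot> (h \<cdot> y))"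
            using 4(4) h unfolding valR_def by blast
          ultimately show ?thesis using eq[OF h] by metis
        qed
        then show ?thesis using mixed[OF 4(1,2)] by blast
      qed
      then show "word_value (L Gd) \<phi> (fst q) = word_value (L Gd) \<phi> (snd q)"
        by (simp add: word_value_sval)
    qed
    then show ?thesis using L_sgrp[OF Gd] by (simp add: variety_def)
  qed
  ultimately show False using noL by blast
qed

end

section \<open>Finiteness by induction on the set of letters\<close>

lemma split_last_new_letter:
  "t \<noteq> [] \<Longrightarrow> \<exists>t' b u. t = t' @ b # u \<and> b \<notin> set u \<and> insert b (set u) = set t"
proof (induction t)
  case (Cons x t)
  show ?case
  proof (cases "x \<in> set t")
    case True
    then have "t \<noteq> []" by auto
    then obtain t' b u where "t = t' @ b # u" "b \<notin> set u" "insert b (set u) = set t"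
      using Cons.IH by blast
    then show ?thesis using True by (intro exI[of _ "x # t'"] exI[of _ b] exI[of _ u]) auto
  next
    case False
    then show ?thesis by (intro exI[of _ "[]"] exI[of _ x] exI[of _ t]) auto
  qed
qed simp

text \<open>The mirror image of the previous cut, now at the shortest prefix that contains every
  letter.\<close>

lemma split_first_full_prefix:
  assumes "w \<noteq> []" shows "\<exists>v a r. w = v @ a # r \<and> a \<notin> set v \<and> insert a (set v) = set w"
proof -
  have "rev w \<noteq> []" using assms by simp
  from split_last_new_letter[OF this]
  obtain t' b u where "rev w = t' @ b # u" "b \<notin> set u" "insert b (set u) = set (rev w)"
    by blast
  have "w = rev (rev w)" by simp
  also have "\<dots> = rev u @ b # rev t'" unfolding \<open>rev w = t' @ b # u\<close> by simp
  finally show ?thesis using \<open>b \<notin> set u\<close> \<open>insert b (set u) = set (rev w)\<close>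
    by (intro exI[of _ "rev u"] exI[of _ b] exI[of _ "rev t'"]) auto
qed

context cr_sgrp
begin

context
  fixes I :: "identity set"
  assumes inf: "infinite (UNIV :: 'd set)"
    and SI: "S \<in> variety I" "\<forall>p \<in> I. is_identity p"
    and noL: "\<And>G :: 'd monoid. novikov_adian G \<Longrightarrow> L G \<notin> variety I"
begin

text \<open>Cut \<open>t\<close> at its shortest suffix \<open>b u'\<close> with all letters of
  \<open>E\<close>. By induction \<open>b u' y0\<close> is, up to R, one of finitely many
  \<open>y\<close>, since \<open>u'\<close> omits \<open>b\<close>. An idempotent \<open>f\<close>
  of content \<open>E\<close> that fixes \<open>b u' y0\<close> can be inserted after the rest of
  \<open>t\<close>, so that \<open>t y0\<close> becomes R-equivalent to \<open>q g y\<close> with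
  \<open>q\<close> from a finite transversal and \<open>g\<close> in the group of \<open>f\<close>.
  Only the orbit of \<open>y\<close> under this group could be infinite, which
  \<open>orbit_finite\<close> excludes.\<close>

lemma finite_left_translates:
  assumes "finite E0" "E0 \<subseteq> A" "\<And>F. F \<subseteq> E0 \<Longrightarrow> finite (Rcl S ` content F)" "y0 \<in> carrier S"
  shows "E0 \<subseteq> A \<Longrightarrow> finite (Rcl S ` {foldr (sprod S) t y0 | t. set t = E0})"
  using assms(1,3)
proof (induction E0 rule: finite_psubset_induct)
  case (psubset E)
  define T where "T E = {foldr (sprod S) t y0 | t. set t = E}" for E
  have Tc: "T F \<subseteq> carrier S" if "F \<subseteq> A" for F
    using that A_sub foldr_closed assms(4) by (auto simp: T_def)
  have EA: "E \<subseteq> A" by fact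
  have IH: "finite (Rcl S ` T F)" if "F \<subset> E" for F
    unfolding T_def
  proof (rule psubset.IH[OF that])
    show "F \<subseteq> A" using that EA by blast
    show "finite (Rcl S ` content G)" if "G \<subseteq> F" for G
      using psubset.prems(2)[of G] that \<open>F \<subset> E\<close> by blast
  qed
  have "finite (Rcl S ` T E)"
  proof (cases "E = {}")
    case True
    then have "T E \<subseteq> {y0}" by (auto simp: T_def)
    then have "finite (T E)" by (rule finite_subset) simp
    then show ?thesis by simp
  next
    case False
    \<comment> \<open>\<open>orbit_finite\<close> asks for a content of \<open>y\<close> that
      includes \<open>E\<close>, so the letters of \<open>y0\<close> are added to
      \<open>E\<close>.\<close>
    obtain wy where wy: "wy \<noteq> []" "set wy \<subseteq> A" "y0 = sval S wy"
      using sgenerate_sval[OF A_sub] assms(4) gen by metis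
    define M where "M = E \<union> set wy"
    have M: "E \<subseteq> M" "M \<subseteq> A" using EA wy(2) by (auto simp: M_def)
    define Y where "Y = (\<Union>b \<in> E. (\<lambda>x. b \<cdot> x) ` T (E - {b}))"
    have Y: "y \<in> content M" if y: "y \<in> Y" for y
    proof -
      obtain b u where bu: "b \<in> E" "set u = E - {b}" "y = foldr (sprod S) (b # u) y0"
        using y by (auto simp: Y_def T_def)
      have "y0 \<in> content (set wy)" using wy contentI by simp
      then have "y \<in> content (set (b # u) \<union> set wy)"
        unfolding bu(3) using bu(1,2) EA by (intro content_foldr) auto
      then show ?thesis using bu(1,2) by (simp add: M_def insert_absorb)
    qed
    have Yc: "Y \<subseteq> carrier S" using Y content_closed[OF M(2)] by auto
    have "finite (Rcl S ` Y)"
    proof -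
      have "finite (Rcl S ` (\<lambda>x. b \<cdot> x) ` T (E - {b}))" if "b \<in> E" for b
        using that EA A_sub by (intro finite_Rcl_left IH Tc) auto
      then show ?thesis using psubset.hyps unfolding Y_def image_UN by (intro finite_UN_I) auto
    qed
    from Rcl_finite_reps[OF this Yc] obtain FY
      where FY: "finite FY" "FY \<subseteq> Y" "\<And>x. x \<in> Y \<Longrightarrow> \<exists>y \<in> FY. req S y x"
      by metis
    have cE: "finite (Rcl S ` content E)" using psubset.prems by simp
    from Rcl_finite_reps[OF this content_closed[OF EA]] obtain F0
      where F0: "finite F0" "F0 \<subseteq> content E" "\<And>x. x \<in> content E \<Longrightarrow> \<exists>y \<in> F0. req S y x"
      by metis
    \<comment> \<open>The \<open>p\<close>-th power of a representative is an idempotent that fixes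
      from the left everything R-below the representative, so finitely many idempotents serve all
      suffixes.\<close>
    define Id where "Id = (\<lambda>x. spow S x p) ` F0"
    have Id: "finite Id" "\<And>f. f \<in> Id \<Longrightarrow> f \<in> content E \<and> f \<cdot> f = f"
      using F0(1,2) content_spow[OF _ EA p_pos] spow_p_mult[OF _ p_pos] content_closed[OF EA]
      by (auto simp: Id_def)
    have "\<exists>Q. finite Q \<and> Q \<subseteq> content E \<and>
        (\<forall>x \<in> content E. x \<cdot> f = x \<longrightarrow> (\<exists>q \<in> Q. \<exists>g \<in> Gset E f. x = q \<cdot> g))"
      if f: "f \<in> Id" for f
    proof -
      have fE: "f \<in> content E" "f \<cdot> f = f" using Id(2)[OF f] by auto
      obtain Q z where Q: "finite Q" "\<And>q. q \<in> Q \<Longrightarrow> q \<in> content E \<and> q \<cdot> f = q \<and> z q \<in> content E"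
        "\<And>q x. \<lbrakk>q \<in> Q; x \<in> content E; x \<cdot> f = x\<rbrakk> \<Longrightarrow> z q \<cdot> x \<in> Gset E f"
        "\<And>x. \<lbrakk>x \<in> content E; x \<cdot> f = x\<rbrakk> \<Longrightarrow> \<exists>q \<in> Q. x = q \<cdot> (z q \<cdot> x)"
        using transversal[OF EA fE cE] by metis
      show ?thesis
      proof (intro exI[of _ Q] conjI ballI impI)
        show "finite Q" by fact
        show "Q \<subseteq> content E" using Q(2) by blast
        fix x assume x: "x \<in> content E" "x \<cdot> f = x"
        then obtain q where "q \<in> Q" "x = q \<cdot> (z q \<cdot> x)" using Q(4) by blast
        then show "\<exists>q \<in> Q. \<exists>g \<in> Gset E f. x = q \<cdot> g" using Q(3)[OF _ x] by blast
      qed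
    qed
    then obtain Q where Q: "\<And>f. f \<in> Id \<Longrightarrow> finite (Q f) \<and> Q f \<subseteq> content E \<and>
        (\<forall>x \<in> content E. x \<cdot> f = x \<longrightarrow> (\<exists>q \<in> Q f. \<exists>g \<in> Gset E f. x = q \<cdot> g))"
      by metis
    define Z where "Z = (\<Union>f \<in> Id. \<Union>q \<in> Q f. \<Union>y \<in> FY. Rcl S ` (\<lambda>x. q \<cdot> x) ` (\<lambda>g. g \<cdot> y) ` Gset E f)"
    have "finite (Rcl S ` (\<lambda>x. q \<cdot> x) ` (\<lambda>g. g \<cdot> y) ` Gset E f)"
      if fqy: "f \<in> Id" "q \<in> Q f" "y \<in> FY" for f q y
    proof (rule finite_Rcl_left)
      have y: "y \<in> content M" using fqy(3) FY(2) Y by blast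
      have fE: "f \<in> content E" "f \<cdot> f = f" using Id(2)[OF fqy(1)] by auto
      show "finite (Rcl S ` (\<lambda>g. g \<cdot> y) ` Gset E f)"
        by (rule orbit_finite[OF EA fE cE M y inf SI noL])
      show "(\<lambda>g. g \<cdot> y) ` Gset E f \<subseteq> carrier S"
        using y content_closed[OF M(2)] content_closed[OF EA] by (auto simp: Gset_def intro!: closed)
      show "q \<in> carrier S" using Q[OF fqy(1)] fqy(2) content_closed[OF EA] by blast
    qed
    then have "finite Z" unfolding Z_def using Id(1) Q FY(1) by (intro finite_UN_I) auto
    moreover have "Rcl S ` T E \<subseteq> Z"
    proof
      fix c assume "c \<in> Rcl S ` T E"
      then obtain t where t: "set t = E" "c = Rcl S (foldr (sprod S) t y0)" by (auto simp: T_def)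
      obtain t' b u' where tu: "t = t' @ b # u'" "b \<notin> set u'" "insert b (set u') = E"
        using split_last_new_letter[of t] t(1) False by (metis list.set(1))
      define u where "u = b # u'"
      define U where "U = sval S u"
      have uE: "set u = E" using tu(3) by (simp add: u_def)
      have UE: "U \<in> content E" unfolding U_def using contentI[OF _ uE] by (simp add: u_def)
      have ES: "E \<subseteq> carrier S" using EA A_sub by auto
      have cc: "content E \<subseteq> carrier S" by (rule content_closed[OF EA])
      obtain x0 where x0: "x0 \<in> F0" "req S x0 U" using F0(3)[OF UE] by blast
      define f where "f = spow S x0 p"
      have f: "f \<in> Id" using x0(1) by (simp add: f_def Id_def)
      have fE: "f \<in> content E" "f \<cdot> f = f" using Id(2)[OF f] by auto
      have x0c: "x0 \<in> carrier S" using x0(1) F0(2) cc by auto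
      have "f \<cdot> x0 = x0" unfolding f_def using spow_p_mult[OF x0c, of 1] by simp
      moreover have "rle S U x0" using x0(2) by (simp add: req_def)
      ultimately have fU: "f \<cdot> U = U"
        using assoc[of f x0] x0c fE(1) cc unfolding rle_def by auto
      define yy where "yy = foldr (sprod S) u y0"
      have yU: "yy = U \<cdot> y0"
        unfolding yy_def U_def using uE ES assms(4) by (intro foldr_sval) (auto simp: u_def)
      have c1: "f \<in> carrier S" "U \<in> carrier S" "yy \<in> carrier S"
        using fE(1) UE cc assms(4) by (auto simp: yU intro: closed)
      have fyy: "f \<cdot> yy = yy" unfolding yU using fU assoc[OF c1(1,2) assms(4)] by simp
      have t': "set t' \<subseteq> E" using t(1) tu(1) by auto
      then have t'S: "set t' \<subseteq> carrier S" using ES by auto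
      define x where "x = foldr (sprod S) t' f"
      have "x \<in> content (set t' \<union> E)"
        unfolding x_def using t' EA by (intro content_foldr fE(1)) auto
      then have xE: "x \<in> content E" using t' by (simp add: Un_absorb1)
      have xf: "x \<cdot> f = x"
        unfolding x_def using foldr_assoc[OF t'S c1(1) c1(1)] fE(2) by simp
      obtain q g where qg: "q \<in> Q f" "g \<in> Gset E f" "x = q \<cdot> g"
        using Q[OF f] xE xf by blast
      have "b \<in> E" "set u' = E - {b}" using tu(2,3) by auto
      moreover from this have "foldr (sprod S) u' y0 \<in> T (E - {b})" by (auto simp: T_def)
      ultimately have "yy \<in> Y" unfolding Y_def yy_def u_def by (intro UN_I) auto
      then obtain y where y: "y \<in> FY" "req S y yy" using FY(3) by blast
      have "Q f \<subseteq> content E" using Q[OF f] by (elim conjE)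
      then have c2: "q \<in> carrier S" "g \<in> carrier S" "y \<in> carrier S"
        using qg(1,2) cc y(1) FY(2) Yc by (auto simp: Gset_def)
      have "foldr (sprod S) t y0 = foldr (sprod S) t' (f \<cdot> yy)"
        by (simp add: fyy) (simp add: yy_def u_def tu(1))
      also have "\<dots> = x \<cdot> yy"
        unfolding x_def by (rule foldr_assoc[OF t'S c1(1) c1(3)])
      also have "\<dots> = q \<cdot> (g \<cdot> yy)" unfolding qg(3) by (rule assoc[OF c2(1,2) c1(3)])
      finally have "c = Rcl S (q \<cdot> (g \<cdot> yy))" using t(2) by simp
      moreover have "req S (q \<cdot> (g \<cdot> yy)) (q \<cdot> (g \<cdot> y))"
        using req_left[OF req_left[OF req_sym[OF y(2)] c1(3) c2(3) c2(2)]] c1(3) c2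
        by (simp add: closed)
      ultimately have "c = Rcl S (q \<cdot> (g \<cdot> y))"
        using Rcl_eq_iff[of "q \<cdot> (g \<cdot> yy)" "q \<cdot> (g \<cdot> y)"] c1(3) c2 by (simp add: closed)
      then have "c \<in> Rcl S ` (\<lambda>x. q \<cdot> x) ` (\<lambda>g. g \<cdot> y) ` Gset E f" using qg(2) by simp
      then show "c \<in> Z" unfolding Z_def by (intro UN_I[OF f] UN_I[OF qg(1)] UN_I[OF y(1)])
    qed
    ultimately show ?thesis by (rule finite_subset[rotated])
  qed
  then show ?case by (simp add: T_def)
qed

text \<open>By \<open>content_req\<close> a word may be truncated to its shortest prefix
  \<open>v a\<close> with all letters. Here \<open>v\<close> omits \<open>a\<close>, so
  \<open>v a\<close> is a left translate of \<open>a\<close> by a word with fewer letters, and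
  \<open>finite_left_translates\<close> then needs only contents strictly below
  \<open>E\<close>.\<close>

lemma finite_content_classes:
  assumes "finite E" "E \<subseteq> A" shows "finite (Rcl S ` content E)"
  using assms
proof (induction E rule: finite_psubset_induct)
  case (psubset E)
  define T where "T a = {foldr (sprod S) t a | t. set t = E - {a}}" for a
  have EA: "E \<subseteq> A" by fact
  have ES: "E \<subseteq> carrier S" using EA A_sub by auto
  have "finite (Rcl S ` T a)" if a: "a \<in> E" for a
    unfolding T_def
  proof (rule finite_left_translates)
    show "finite (Rcl S ` content F)" if "F \<subseteq> E - {a}" for F
      using that psubset.IH[of F] EA a by blast
  qed (use psubset.hyps EA ES a in auto)
  then have "finite (\<Union>a \<in> E. Rcl S ` T a)" using psubset.hyps by blast
  moreover have "Rcl S ` content E \<subseteq> (\<Union>a \<in> E. Rcl S ` T a)"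
  proof
    fix c assume "c \<in> Rcl S ` content E"
    then obtain w where w: "w \<noteq> []" "set w = E" "c = Rcl S (sval S w)" by (auto simp: content_def)
    obtain v a r where v: "w = v @ a # r" "a \<notin> set v" "insert a (set v) = E"
      using split_first_full_prefix[OF w(1)] w(2) by auto
    have va: "sval S (v @ [a]) \<in> content E" by (rule contentI) (use v(3) in auto)
    have "c = Rcl S (sval S (v @ [a]))"
    proof (cases "r = []")
      case False
      have "set (v @ [a]) \<subseteq> carrier S" "set r \<subseteq> E" using w(2) v(1) ES by auto
      then have eq: "sval S w = sval S (v @ [a]) \<cdot> sval S r"
        using sval_append[of "v @ [a]" r] False ES v(1) by auto
      have "req S (sval S w) (sval S (v @ [a]))"
        unfolding eq using False \<open>set r \<subseteq> E\<close>
        by (intro content_req[OF va EA] sval_in_sgenerate)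
      then show ?thesis
        using Rcl_eq_iff sval_closed[OF w(1)] w(2,3) ES va content_closed[OF EA] by auto
    qed (use w v in simp)
    also have "sval S (v @ [a]) = foldr (sprod S) v a" by (simp add: sval_append_foldr)
    finally show "c \<in> (\<Union>a \<in> E. Rcl S ` T a)" using v(2,3) by (auto simp: T_def)
  qed
  ultimately show ?case by (rule finite_subset[rotated])
qed

lemma cr_R_finite: "R_finite S"
proof -
  have "carrier S \<subseteq> (\<Union>E \<in> Pow A. content E)"
  proof
    fix x assume "x \<in> carrier S"
    then have "x \<in> sgenerate S A" using gen by simp
    from sgenerate_sval[OF A_sub this]
    obtain w where w: "w \<noteq> []" "set w \<subseteq> A" "x = sval S w" by blast
    then have "x \<in> content (set w)" using contentI by simp
    then show "x \<in> (\<Union>E \<in> Pow A. content E)" using w(2) by blast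
  qed
  then have "Rcl S ` carrier S \<subseteq> (\<Union>E \<in> Pow A. Rcl S ` content E)"
    unfolding image_UN[symmetric] by (rule image_mono)
  moreover have "finite (\<Union>E \<in> Pow A. Rcl S ` content E)"
  proof (rule finite_UN_I)
    show "finite (Rcl S ` content E)" if "E \<in> Pow A" for E
      using finite_content_classes[of E] that fin finite_subset[of E A] by simp
  qed (use fin in simp)
  ultimately show ?thesis unfolding R_finite_iff by (rule finite_subset)
qed

end

end

section \<open>Periodic completely regular right ideals\<close>

lemma spow_sub [simp]: "spow (sub S T) x n = spow S x n"
  by (simp add: spow_def)

text \<open>Just before the product enters \<open>J\<close>, the prefix is empty or has a value
  outside \<open>J\<close>. The entering value is therefore a generator, or an element outside
  \<open>J\<close> times a generator, which leaves finitely many values if \<open>A\<close> and the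
  complement of \<open>J\<close> are finite.\<close>

lemma split_at_minimal_prefix:
  fixes S :: "'a sgrp" (structure)
  assumes "sgrp S" "A \<subseteq> carrier S" "w \<noteq> []" "set w \<subseteq> A" "sval S w \<in> J"
  shows "\<exists>u v. w = u @ v \<and> u \<noteq> [] \<and>
    sval S u \<in> (A \<union> (\<lambda>(n, a). n \<cdot>\<^bsub>S\<^esub> a) ` ((carrier S - J) \<times> A)) \<inter> J"
  using assms(3-5)
proof (induction w rule: rev_induct)
  case (snoc a w)
  interpret sgrp S by fact
  show ?case
  proof (cases "w = []")
    case True
    then show ?thesis using snoc.prems by (intro exI[of _ "[a]"] exI[of _ "[]"]) auto
  next
    case False
    have w: "set w \<subseteq> A" "a \<in> A" using snoc.prems by auto
    have wc: "sval S w \<in> carrier S" using False w assms(2) by (intro sval_closed) auto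
    have eq: "sval S (w @ [a]) = sval S w \<cdot> a"
      using False w assms(2) by (subst sval_append) auto
    show ?thesis
    proof (cases "sval S w \<in> J")
      case True
      from snoc.IH[OF False w(1) True] obtain u v where "w = u @ v" "u \<noteq> []"
        "sval S u \<in> (A \<union> (\<lambda>(n, a). n \<cdot> a) ` ((carrier S - J) \<times> A)) \<inter> J" by blast
      then show ?thesis by (intro exI[of _ u] exI[of _ "v @ [a]"]) simp
    next
      case nJ: False
      have "sval S w \<cdot> a \<in> (\<lambda>(n, a). n \<cdot> a) ` ((carrier S - J) \<times> A)"
        using nJ wc w(2) by (intro image_eqI[of _ _ "(sval S w, a)"]) auto
      then show ?thesis using snoc.prems(3) unfolding eq
        by (intro exI[of _ "w @ [a]"] exI[of _ "[]"]) (simp add: eq)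
    qed
  qed
qed simp

text \<open>Writing each minimal prefix \<open>b \<in> J = S R\<close> as \<open>s b \<cdot> r b\<close> and regrouping
  \<open>r\<^sub>0 (s\<^sub>1 r\<^sub>1) (s\<^sub>2 r\<^sub>2) \<dots> = (r\<^sub>0 s\<^sub>1) (r\<^sub>1 s\<^sub>2) \<dots>\<close> places every \<open>r\<^sub>0 t\<close> in a finitely generated
  subsemigroup of \<open>R\<close>.\<close>

lemma R_finite_of_right_ideal:
  fixes S :: "'a sgrp" (structure)
  assumes inf: "infinite (UNIV :: 'd set)"
    and SI: "S \<in> variety I" "\<forall>p \<in> I. is_identity p"
    and noL: "\<And>G :: 'd monoid. novikov_adian G \<Longrightarrow> L G \<notin> variety I"
    and A: "finite A" "A \<subseteq> carrier S" "sgenerate S A = carrier S"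
    and R: "right_ideal S R" "p > 0" "\<And>x. x \<in> R \<Longrightarrow> spow S x (Suc p) = x"
    and N: "finite (carrier S - left_multiples S R)"
  shows "R_finite S"
proof -
  interpret sgrp S using SI(1) by (simp add: variety_def)
  define J where "J = left_multiples S R"
  define N where "N = carrier S - J"
  have finN: "finite N" using N by (simp add: N_def J_def)
  have Rc: "R \<subseteq> carrier S" "R \<noteq> {}" and Rm: "\<And>r s. \<lbrakk>r \<in> R; s \<in> carrier S\<rbrakk> \<Longrightarrow> r \<cdot> s \<in> R"
    using R(1) by (auto simp: right_ideal_def)
  have Jc: "J \<subseteq> carrier S" using Rc(1) closed by (auto simp: J_def left_multiples_def)
  define B where "B = (A \<union> (\<lambda>(n, a). n \<cdot> a) ` (N \<times> A)) \<inter> J"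
  have finB: "finite B" using A(1) finN by (simp add: B_def)
  have split: "\<exists>u v. w = u @ v \<and> u \<noteq> [] \<and> sval S u \<in> B"
    if "w \<noteq> []" "set w \<subseteq> A" "sval S w \<in> J" for w
    using split_at_minimal_prefix[OF sgrp_axioms A(2) that] by (simp add: B_def N_def)
  have "\<exists>s r. s \<in> carrier S \<and> r \<in> R \<and> b = s \<cdot> r" if "b \<in> B" for b
    using that by (auto simp: B_def J_def left_multiples_def)
  then obtain s r where sr: "\<And>b. b \<in> B \<Longrightarrow> s b \<in> carrier S \<and> r b \<in> R \<and> b = s b \<cdot> r b" by metis
  have word: "\<exists>w. w \<noteq> [] \<and> set w \<subseteq> A \<and> x = sval S w" if "x \<in> carrier S" for x
    using sgenerate_sval[OF A(2)] that A(3) by simp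
  \<comment> \<open>A factor \<open>r b\<close> continues in three ways: the word ends, the
    remaining tail has a value outside \<open>J\<close>, or the tail enters \<open>J\<close> again
    with some \<open>b'\<close> and \<open>r b\<close> takes over its left part
    \<open>s b'\<close>.\<close>
  define C where "C = r ` B \<union> (\<lambda>(b, n). r b \<cdot> n) ` (B \<times> N) \<union> (\<lambda>(b, b'). r b \<cdot> s b') ` (B \<times> B)"
  have finC: "finite C" using finB finN by (simp add: C_def)
  have CR: "C \<subseteq> R" using sr Rm by (auto simp: C_def N_def)
  have CC: "C \<subseteq> carrier S" using CR Rc(1) by simp
  define U where "U = sub S (sgenerate S C)"
  have UR: "sgenerate S C \<subseteq> R"
  proof
    show "x \<in> R" if "x \<in> sgenerate S C" for x
      using that by induction (use CR Rm Rc(1) in auto)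
  qed
  have inU: "r b \<cdot> sval S t \<in> sgenerate S C" if "b \<in> B" "t \<noteq> []" "set t \<subseteq> A" for b t
    using that
  proof (induction t arbitrary: b rule: length_induct)
    case (1 t)
    have tc: "set t \<subseteq> carrier S" using 1(4) A(2) by auto
    have rb: "r b \<in> carrier S" using sr[OF 1(2)] Rc(1) by auto
    show ?case
    proof (cases "sval S t \<in> J")
      case False
      then have "sval S t \<in> N" using sval_closed[OF 1(3) tc] by (simp add: N_def)
      then have "r b \<cdot> sval S t \<in> C"
        unfolding C_def using 1(2) by (intro UnI1 UnI2 image_eqI[of _ _ "(b, sval S t)"]) auto
      then show ?thesis by (rule sgenerate.incl)
    next
      case True
      from split[OF 1(3,4) True] obtain u v
        where uv: "t = u @ v" "u \<noteq> []" "sval S u \<in> B" by blast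
      define b' where "b' = sval S u"
      have b': "s b' \<in> carrier S" "r b' \<in> carrier S" "r b' \<in> R" "b' = s b' \<cdot> r b'" "b' \<in> B"
        using sr[of b'] uv(3) Rc(1) by (auto simp: b'_def)
      have g1: "r b \<cdot> s b' \<in> sgenerate S C"
        unfolding C_def using 1(2) b'(5)
        by (intro sgenerate.incl UnI2 image_eqI[of _ _ "(b, b')"]) auto
      show ?thesis
      proof (cases "v = []")
        case True
        have "r b' \<in> sgenerate S C" using b'(5) by (intro sgenerate.incl) (simp add: C_def)
        from sgenerate.prod[OF g1 this]
        have "r b \<cdot> (s b' \<cdot> r b') \<in> sgenerate S C" using rb b'(1,2) by (simp add: assoc)
        then show ?thesis using True uv(1) b'(4) by (simp add: b'_def)
      next
        case False
        have v: "set v \<subseteq> A" "set v \<subseteq> carrier S" "set u \<subseteq> carrier S" using 1(4) uv(1) A(2) by auto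
        have vc: "sval S v \<in> carrier S" using sval_closed False v(2) by simp
        have "r b' \<cdot> sval S v \<in> sgenerate S C"
          using 1(1) False v(1) uv(1,2) b'(5) by simp
        from sgenerate.prod[OF g1 this]
        have "r b \<cdot> ((s b' \<cdot> r b') \<cdot> sval S v) \<in> sgenerate S C"
          using rb b'(1,2) vc by (simp add: assoc closed)
        moreover have "sval S t = b' \<cdot> sval S v"
          unfolding uv(1) b'_def by (rule sval_append[OF uv(2) False v(3,2)])
        ultimately show ?thesis using b'(4) by simp
      qed
    qed
  qed
  \<comment> \<open>Subsemigroups are nonempty, so \<open>C\<close> must be. For
    \<open>x \<in> R\<close> the square \<open>x x\<close> lies in \<open>J\<close>, so some word
    does enter \<open>J\<close>.\<close>
  have "B \<noteq> {}"
  proof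
    assume "B = {}"
    obtain x where "x \<in> R" using Rc(2) by blast
    then have "x \<cdot> x \<in> J" "x \<cdot> x \<in> carrier S"
      using Rc(1) closed by (auto simp: J_def left_multiples_def)
    then show False using word[of "x \<cdot> x"] split \<open>B = {}\<close> by auto
  qed
  then have "C \<noteq> {}" by (auto simp: C_def)
  have UV: "U \<in> variety I"
    unfolding U_def by (rule sgenerate_variety[OF SI \<open>C \<noteq> {}\<close> CC])
  then interpret U: sgrp U by (simp add: variety_def)
  interpret U: cr_sgrp U C p
  proof
    show "finite C" by fact
    show "carrier U = sgenerate U C" by (simp add: U_def)
    show "p > 0" by fact
    show "spow U x (Suc p) = x" if "x \<in> carrier U" for x
      using that UR R(3) by (auto simp: U_def)
  qed
  have "R_finite U" by (rule U.cr_R_finite[OF inf UV SI(2) noL])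
  then have "finite (Rcl U ` carrier U)" by (simp add: U.R_finite_iff)
  from U.Rcl_finite_reps[OF this order_refl] obtain F
    where F: "finite F" "F \<subseteq> carrier U" "\<And>x. x \<in> carrier U \<Longrightarrow> \<exists>y \<in> F. req U y x"
    by metis
  have Uc: "carrier U \<subseteq> carrier S" using UR Rc(1) by (simp add: U_def)
  have reqU: "req S x y" if "req U x y" for x y
  proof -
    have "rle S a b" if "rle U a b" for a b
      using that Uc by (auto simp: rle_def U_def)
    then show ?thesis using that by (simp add: req_def)
  qed
  have "finite (Rcl S ` carrier S)"
  proof (rule finite_Rcl_image)
    \<comment> \<open>Representatives for three kinds of elements: those outside \<open>J\<close>,
      those entering \<open>J\<close> only with their last letter, and those of the form
      \<open>s b z\<close> with \<open>z\<close> in the subsemigroup of \<open>R\<close>.\<close>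
    let ?X = "N \<union> B \<union> (\<lambda>(b, x). s b \<cdot> x) ` (B \<times> F)"
    show "finite ?X" using finN finB F(1) by simp
    have "s b \<cdot> x \<in> carrier S" if "b \<in> B" "x \<in> F" for b x
      using sr[OF that(1)] that(2) F(2) Uc by (intro closed) auto
    then show "?X \<subseteq> carrier S" using Jc by (auto simp: N_def B_def)
    fix x assume x: "x \<in> carrier S"
    show "\<exists>y \<in> ?X. req S y x"
    proof (cases "x \<in> J")
      case False
      then have "x \<in> ?X" using x by (simp add: N_def)
      then show ?thesis using req_refl by (rule bexI[rotated])
    next
      case True
      from word[OF x] obtain w where w: "w \<noteq> []" "set w \<subseteq> A" "x = sval S w" by blast
      from split[OF w(1,2)] True w(3) obtain u v
        where uv: "w = u @ v" "u \<noteq> []" "sval S u \<in> B" by blast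
      show ?thesis
      proof (cases "v = []")
        case True
        then have "x \<in> ?X" using uv w(3) by simp
        then show ?thesis using req_refl by (rule bexI[rotated])
      next
        case False
        define b where "b = sval S u"
        have b: "b \<in> B" "s b \<in> carrier S" "r b \<in> carrier S" "b = s b \<cdot> r b"
          using uv(3) sr[of b] Rc(1) by (auto simp: b_def)
        have v: "set v \<subseteq> A" "set v \<subseteq> carrier S" "set u \<subseteq> carrier S" using w(2) uv(1) A(2) by auto
        have vc: "sval S v \<in> carrier S" using sval_closed False v(2) by simp
        define z where "z = r b \<cdot> sval S v"
        have "z \<in> carrier U" using inU[OF b(1) False v(1)] by (simp add: z_def U_def)
        then obtain y where y: "y \<in> F" "req U y z" using F(3) by blast
        have zc: "z \<in> carrier S" using \<open>z \<in> carrier U\<close> Uc by auto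
        have yc: "y \<in> carrier S" using y(1) F(2) Uc by auto
        have "x = (s b \<cdot> r b) \<cdot> sval S v"
          unfolding w(3) uv(1) sval_append[OF uv(2) False v(3,2)] b_def[symmetric]
          by (subst b(4)) simp
        also have "\<dots> = s b \<cdot> z" unfolding z_def using b(2,3) vc by (rule assoc)
        finally have "req S (s b \<cdot> y) x"
          using req_left[OF reqU[OF y(2)] yc zc b(2)] by simp
        moreover have "s b \<cdot> y \<in> ?X"
          using b(1) y(1) by (intro UnI2 image_eqI[of _ _ "(b, y)"]) auto
        ultimately show ?thesis by (rule bexI)
      qed
    qed
  qed simp
  then show ?thesis by (simp add: R_finite_iff)
qed

section \<open>Exponents and Rees quotients\<close>

text \<open>The free monogenic semigroup, written additively.\<close>

definition NN :: "nat sgrp"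
  where "NN = \<lparr>carrier = {0<..}, sprod = (+)\<rparr>"

lemma NN_sgrp: "sgrp NN"
  by unfold_locales (auto simp: NN_def)

text \<open>When letter \<open>i\<close> is replaced by \<open>x ^ \<phi> i\<close>, an identity
  failing in \<open>NN\<close> under \<open>\<phi>\<close> becomes an equation
  \<open>x ^ (j + d) = x ^ j\<close> with \<open>d > 0\<close> in every member. From
  \<open>j\<close> on the powers have period \<open>d\<close>. The exponent \<open>j d\<close> is a
  multiple of \<open>d\<close> and at least \<open>j\<close>, so doubling it changes
  nothing.\<close>

lemma uniform_idempotent_power:
  assumes "NN \<notin> variety E" "\<forall>q \<in> E. is_identity q"
  shows "\<exists>p > 0. \<forall>S \<in> (variety E :: 'x sgrp set). \<forall>x \<in> carrier S.
    spow S x p \<cdot>\<^bsub>S\<^esub> spow S x p = spow S x p"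
proof -
  obtain q where q: "q \<in> E" "\<not> satisfies NN q"
    using assms(1) NN_sgrp by (auto simp: variety_def)
  then obtain \<phi> where \<phi>: "range \<phi> \<subseteq> carrier NN"
    "word_value NN \<phi> (fst q) \<noteq> word_value NN \<phi> (snd q)"
    unfolding satisfies_def by blast
  have pos: "\<phi> i > 0" for i using \<phi>(1) by (auto simp: NN_def)
  define val where "val w = sval NN (map \<phi> w)" for w
  have ne: "fst q \<noteq> []" "snd q \<noteq> []" using assms(2) q(1) by (auto simp: is_identity_def)
  have val_pos: "val w > 0" if "w \<noteq> []" for w
    using sgrp.sval_closed[OF NN_sgrp, of "map \<phi> w"] that pos by (auto simp: val_def NN_def)
  have val_eq: "sval S (map (\<lambda>i. spow S x (\<phi> i)) w) = spow S x (val w)"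
    if "sgrp S" "x \<in> carrier S" "w \<noteq> []" for S :: "'x sgrp" and x w
    using that(3)
  proof (induction w)
    case (Cons i w)
    interpret sgrp S by fact
    show ?case
    proof (cases "w = []")
      case False
      then have "val (i # w) = \<phi> i + val w" by (simp add: val_def sval_Cons) (simp add: NN_def)
      then show ?thesis
        using False Cons.IH spow_add[OF that(2) pos[of i] val_pos[OF False]] by (simp add: sval_Cons)
    qed (simp add: val_def)
  qed simp
  define j where "j = min (val (fst q)) (val (snd q))"
  define d where "d = max (val (fst q)) (val (snd q)) - j"
  have jd: "j > 0" "d > 0"
    using val_pos[OF ne(1)] val_pos[OF ne(2)] \<phi>(2) by (auto simp: j_def d_def val_def word_value_sval)
  have "spow S x (j * d) \<cdot>\<^bsub>S\<^esub> spow S x (j * d) = spow S x (j * d)"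
    if S: "S \<in> variety E" and x: "x \<in> carrier S" for S :: "'x sgrp" and x
  proof -
    interpret sgrp S using S by (simp add: variety_def)
    have "range (\<lambda>i. spow S x (\<phi> i)) \<subseteq> carrier S" using spow_closed[OF x pos] by auto
    then have "spow S x (val (fst q)) = spow S x (val (snd q))"
      using S q(1) val_eq[OF sgrp_axioms x ne(1)] val_eq[OF sgrp_axioms x ne(2)]
      by (simp add: variety_def satisfies_def word_value_sval)
    then have base: "spow S x (j + d) = spow S x j"
      by (cases "val (fst q) \<le> val (snd q)") (auto simp: j_def d_def)
    have step: "spow S x (n + d) = spow S x n" if "j \<le> n" for n
    proof (cases "n = j")
      case False
      then have "n - j > 0" using that by simp
      have "spow S x ((j + d) + (n - j)) = spow S x (j + (n - j))"
        using spow_add[OF x _ \<open>n - j > 0\<close>, of "j + d"] spow_add[OF x jd(1) \<open>n - j > 0\<close>] jd base by simp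
      then show ?thesis using that by (simp add: add.commute add.left_commute)
    qed (simp add: base)
    have steps: "spow S x (n + i * d) = spow S x n" if "j \<le> n" for n i
    proof (induction i)
      case (Suc i)
      have "spow S x ((n + i * d) + d) = spow S x (n + i * d)" using that by (intro step) simp
      then show ?case using Suc by (simp add: ac_simps)
    qed simp
    have "j \<le> j * d" using jd by simp
    from steps[OF this, of j] show ?thesis using spow_add[OF x, of "j * d" "j * d"] jd by simp
  qed
  then show ?thesis using jd by (intro exI[of _ "j * d"]) auto
qed

definition rees_class :: "'a sgrp \<Rightarrow> 'a set \<Rightarrow> 'a \<Rightarrow> 'a set"
  where "rees_class S J x = (if x \<in> J then J else {x})"

lemma rees_class_smap:
  fixes S :: "'a sgrp" (structure)
  assumes "sgrp S" "semigroup_ideal S J"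
  shows "smap (rees_class S J) S (rees_quotient S J)"
proof -
  interpret sgrp S by fact
  have J: "J \<noteq> {}" "J \<subseteq> carrier S" "\<And>j s. \<lbrakk>j \<in> J; s \<in> carrier S\<rbrakk> \<Longrightarrow> j \<cdot> s \<in> J"
    "\<And>j s. \<lbrakk>j \<in> J; s \<in> carrier S\<rbrakk> \<Longrightarrow> s \<cdot> j \<in> J"
    using assms(2) by (auto simp: semigroup_ideal_def)
  have cls: "rees_congruence S J `` {x} = rees_class S J x" if "x \<in> carrier S" for x
    using that by (auto simp: rees_congruence_def rees_class_def)
  have "carrier (rees_quotient S J) = rees_class S J ` carrier S"
    using cls by (auto simp: rees_quotient_def quotient_def)
  moreover have "rees_class S J (x \<cdot> y) =
      sprod (rees_quotient S J) (rees_class S J x) (rees_class S J y)"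
    if xy: "x \<in> carrier S" "y \<in> carrier S" for x y
  proof -
    \<comment> \<open>The setwise product of two classes may be a proper part of \<open>J\<close>;
      the image under the congruence fills it up.\<close>
    let ?P = "{a \<cdot> b | a b. a \<in> rees_class S J x \<and> b \<in> rees_class S J y}"
    have "rees_congruence S J `` ?P = rees_class S J (x \<cdot> y)"
    proof (cases "x \<in> J \<or> y \<in> J")
      case True
      have m: "x \<in> rees_class S J x" "y \<in> rees_class S J y" by (auto simp: rees_class_def)
      have "?P \<subseteq> J" using True J xy by (auto simp: rees_class_def split: if_splits)
      moreover have "x \<cdot> y \<in> ?P" using m by blast
      moreover from this and calculation have "x \<cdot> y \<in> J" by blast
      ultimately have "rees_congruence S J `` ?P = J"
        using J(2) by (auto simp: rees_congruence_def)
      then show ?thesis using \<open>x \<cdot> y \<in> J\<close> by (simp add: rees_class_def)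
    next
      case False
      then have "?P = {x \<cdot> y}" by (auto simp: rees_class_def)
      then show ?thesis using cls closed[OF xy] by simp
    qed
    then show ?thesis by (simp add: rees_quotient_def)
  qed
  ultimately show ?thesis by (simp add: smap_def)
qed

text \<open>The Rees quotient is finitely generated along with \<open>S\<close>, hence finite, and
  it identifies no two elements outside \<open>J\<close>.\<close>

lemma finite_complement_of_ideal:
  assumes "sgrp S" "locally_finite_extension S J" "finite A" "A \<subseteq> carrier S"
    "sgenerate S A = carrier S"
  shows "finite (carrier S - J)"
proof -
  have J: "semigroup_ideal S J" "locally_finite (rees_quotient S J)"
    using assms(2) by (auto simp: locally_finite_extension_def)
  note m = rees_class_smap[OF assms(1) J(1)]
  have "sgenerate (rees_quotient S J) (rees_class S J ` A) = rees_class S J ` carrier S"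
    using smap_sgenerate[OF m assms(1,4)] assms(5) by simp
  moreover have "rees_class S J ` A \<subseteq> carrier (rees_quotient S J)"
    using smap_image[OF m] assms(4) by (metis image_mono)
  ultimately have "finite (rees_class S J ` carrier S)"
    using J(2) assms(3) unfolding locally_finite_def by (metis finite_imageI)
  then have "finite (rees_class S J ` (carrier S - J))"
    by (rule finite_subset[rotated]) auto
  moreover have "inj_on (rees_class S J) (carrier S - J)"
    by (auto simp: inj_on_def rees_class_def)
  ultimately show ?thesis by (simp add: finite_image_iff)
qed

section \<open>Sufficiency of the two conditions\<close>

lemma group_power_idem:
  assumes "group \<lparr>carrier = H, monoid.mult = sprod S, one = e\<rparr>" "x \<in> H" "p > 0"
    "spow S x p \<cdot>\<^bsub>S\<^esub> spow S x p = spow S x p"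
  shows "x \<cdot>\<^bsub>S\<^esub> spow S x p = x"
proof -
  interpret H: group "\<lparr>carrier = H, monoid.mult = sprod S, one = e\<rparr>" by fact
  have H: "x \<cdot>\<^bsub>S\<^esub> y \<in> H" if "y \<in> H" for y using H.m_closed[of x y] assms(2) that by simp
  have "spow S x n \<in> H" if "n > 0" for n
    using that
  proof (induction n rule: nat_induct_non_zero)
    case (Suc n)
    then show ?case using H by (simp add: spow_def sval_Cons)
  qed (use assms(2) in \<open>simp add: spow_def\<close>)
  \<comment> \<open>A group has only one idempotent.\<close>
  then have "spow S x p = e"
    using assms(3,4) H.r_one[of "spow S x p"] H.one_closed
      H.inv_closed[of "spow S x p"] H.m_assoc[of "inv\<^bsub>\<lparr>carrier = H, monoid.mult = sprod S, one = e\<rparr>\<^esub> spow S x p" "spow S x p" "spow S x p"]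
      H.l_inv[of "spow S x p"] H.l_one[of "spow S x p"] by simp
  then show ?thesis using H.r_one[of x] assms(2) by simp
qed

lemma locally_finite_imp_locally_R_finite:
  assumes "infinite (UNIV :: 'b set)" "\<forall>p \<in> E. is_identity p"
    "locally_finite_variety (variety E :: 'b sgrp set)"
  shows "locally_R_finite_variety (variety E :: 'a sgrp set)"
  unfolding locally_R_finite_variety_def
proof (intro ballI impI)
  fix S :: "'a sgrp" assume S: "S \<in> variety E" "finitely_generated S"
  interpret sgrp S using S(1) by (simp add: variety_def)
  obtain A where A: "finite A" "A \<subseteq> carrier S" "sgenerate S A = carrier S"
    using S(2) by (auto simp: finitely_generated_def)
  obtain f :: "'a \<Rightarrow> 'b" where f: "inj_on f (carrier S)"
    using inj_infinite[OF countable_sgenerate[OF A(2,1)] assms(1)] A(3) by auto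
  note c = smap_copy(1)[OF f sgrp_axioms]
  have "locally_finite (copy f S)"
    using assms(3) smap_variety[OF c S(1) assms(2)] by (simp add: locally_finite_variety_def)
  moreover have "f ` A \<subseteq> carrier (copy f S)" using smap_image[OF c] A(2) by (metis image_mono)
  ultimately have "finite (sgenerate (copy f S) (f ` A))"
    using A(1) by (simp add: locally_finite_def)
  then have "finite (f ` carrier S)"
    using smap_sgenerate[OF c sgrp_axioms A(2)] A(3) by simp
  then have "finite (carrier S)" using f by (simp add: finite_image_iff)
  then show "R_finite S" by (simp add: R_finite_iff)
qed

lemma right_ideal_condition_imp_locally_R_finite:
  assumes inf: "infinite (UNIV :: 'c set)" "infinite (UNIV :: 'd set)"
    and E: "\<forall>p \<in> E. is_identity p"
    and H: "\<forall>S \<in> (variety E :: 'c sgrp set). \<exists>R. right_ideal S R \<and>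
            periodic (sub S R) \<and> completely_regular (sub S R) \<and>
            locally_finite_extension S (left_multiples S R)"
    and noL: "\<And>G :: 'd monoid. novikov_adian G \<Longrightarrow> L G \<notin> variety E"
  shows "locally_R_finite_variety (variety E :: 'a sgrp set)"
  unfolding locally_R_finite_variety_def
proof (intro ballI impI)
  \<comment> \<open>\<open>NN\<close> has no idempotent, while a completely regular right ideal
    contains one. So the condition on right ideals already forces a uniform exponent.\<close>
  have "NN \<notin> variety E"
  proof
    assume N: "NN \<in> variety E"
    obtain f :: "nat \<Rightarrow> 'c" where f: "inj_on f (carrier NN)"
      using inj_infinite[OF _ inf(1), of "carrier NN"] by auto
    define T where "T = copy f NN"
    have T: "T \<in> variety E"
      unfolding T_def by (rule smap_variety[OF smap_copy(1)[OF f NN_sgrp] N E])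
    from bspec[OF H T]
    obtain R where R: "right_ideal T R" "completely_regular (sub T R)" by blast
    then obtain x where x: "x \<in> R" "R \<subseteq> carrier T" by (auto simp: right_ideal_def)
    then have "x \<in> carrier (sub T R)" by simp
    from bspec[OF R(2)[unfolded completely_regular_def] this]
    obtain K e where K: "K \<subseteq> R" "group \<lparr>carrier = K, monoid.mult = sprod (sub T R), one = e\<rparr>"
      by auto
    interpret K: group "\<lparr>carrier = K, monoid.mult = sprod (sub T R), one = e\<rparr>" by (rule K(2))
    have e: "e \<in> carrier T" "e \<cdot>\<^bsub>T\<^esub> e = e" using K.one_closed K.r_one[of e] K(1) x(2) by auto
    then obtain n where n: "n \<in> carrier NN" "e = f n" by (auto simp: T_def copy_def)
    then have "f (n + n) = f n" using e(2) f by (simp add: T_def copy_def) (simp add: NN_def)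
    then have "n + n = n" using n(1) by (intro inj_onD[OF f]) (simp_all add: NN_def)
    then show False using n(1) by (simp add: NN_def)
  qed
  from uniform_idempotent_power[OF this E] obtain p where p: "p > 0"
    "\<forall>S \<in> (variety E :: 'c sgrp set). \<forall>x \<in> carrier S.
      spow S x p \<cdot>\<^bsub>S\<^esub> spow S x p = spow S x p" by (elim exE conjE)
  fix S :: "'a sgrp" assume S: "S \<in> variety E" "finitely_generated S"
  interpret sgrp S using S(1) by (simp add: variety_def)
  obtain A where A: "finite A" "A \<subseteq> carrier S" "sgenerate S A = carrier S"
    using S(2) by (auto simp: finitely_generated_def)
  obtain f :: "'a \<Rightarrow> 'c" where f: "inj_on f (carrier S)"
    using inj_infinite[OF countable_sgenerate[OF A(2,1)] inf(1)] A(3) by auto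
  note c = smap_copy[OF f sgrp_axioms]
  define T where "T = copy f S"
  have T: "T \<in> variety E" unfolding T_def by (rule smap_variety[OF c(1) S(1) E])
  interpret T: sgrp T using T by (simp add: variety_def)
  have im: "f ` carrier S = carrier T" using smap_image[OF c(1)] by (simp add: T_def)
  have B: "finite (f ` A)" "f ` A \<subseteq> carrier T" "sgenerate T (f ` A) = carrier T"
    using A(1) image_mono[OF A(2), of f] smap_sgenerate[OF c(1) sgrp_axioms A(2)] A(3) im
    by (simp_all add: T_def)
  from bspec[OF H T] obtain R where R: "right_ideal T R" "completely_regular (sub T R)"
    "locally_finite_extension T (left_multiples T R)" by blast
  have "spow T x (Suc p) = x" if x: "x \<in> R" for x
  proof -
    have xT: "x \<in> carrier T" using R(1) x by (auto simp: right_ideal_def)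
    have "x \<in> carrier (sub T R)" using x by simp
    from bspec[OF R(2)[unfolded completely_regular_def] this]
    obtain K e where K: "x \<in> K" "group \<lparr>carrier = K, monoid.mult = sprod (sub T R), one = e\<rparr>"
      by blast
    then have "group \<lparr>carrier = K, monoid.mult = sprod T, one = e\<rparr>" by simp
    from group_power_idem[OF this K(1) p(1) bspec[OF bspec[OF p(2) T] xT]]
    show ?thesis using T.spow_Suc p(1) by simp
  qed
  from R_finite_of_right_ideal[OF inf(2) T E noL B R(1) p(1) this]
  have "R_finite T" using finite_complement_of_ideal[OF T.sgrp_axioms R(3) B] by simp
  then show "R_finite S" using smap_R_finite[OF c(2)] T.sgrp_axioms by (simp add: T_def)
qed

section \<open>Consequences of local R-finiteness\<close>

text \<open>In both semigroups \<open>1\<close> encodes the idempotent \<open>e\<close> (the identity of \<open>CC\<close>) and \<open>2\<close> the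
  nilpotent element \<open>a\<close>.\<close>

definition PP :: "nat sgrp"
  where "PP = \<lparr>carrier = {0, 1, 2}, sprod = (\<lambda>x y. if x = 1 then y else 0)\<rparr>"

definition CC :: "nat sgrp"
  where "CC = \<lparr>carrier = {0, 1, 2},
    sprod = (\<lambda>x y. if x = 1 then y else if y = 1 then x else 0)\<rparr>"

section \<open>Coincidences forced by the absence of \<open>PP\<close> and \<open>CC\<close>\<close>

lemma PP_sgrp: "sgrp PP" by unfold_locales (auto simp: PP_def)

lemma CC_sgrp: "sgrp CC" by unfold_locales (auto simp: CC_def)

text \<open>A relation replaces a homomorphism because the zero of \<open>PP\<close> or
  \<open>CC\<close> corresponds to many elements of \<open>S\<close>.\<close>

lemma word_value_rel:
  assumes "\<And>c d x y. \<lbrakk>rel c x; rel d y\<rbrakk> \<Longrightarrow> rel (c \<cdot>\<^bsub>P\<^esub> d) (x \<cdot>\<^bsub>S\<^esub> y)"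
    "\<And>i. rel (\<phi> i) (\<psi> i)" "w \<noteq> []"
  shows "rel (word_value P \<phi> w) (word_value S \<psi> w)"
  using assms(3)
proof (induction w)
  case (Cons i w)
  show ?case
  proof (cases w)
    case Nil
    then show ?thesis using assms(2) by simp
  next
    case (Cons j v)
    then show ?thesis using assms(1)[OF assms(2) Cons.IH] by simp
  qed
qed simp

text \<open>\<open>el k b\<close> is \<open>s ^ k\<close> or \<open>s ^ k e\<close>, and
  \<open>0\<close> is related to all of these forms except \<open>s\<close> itself. The failing
  identity yields one element related to two members of \<open>PP\<close>. The pair
  \<open>0, 1\<close> means \<open>e = el k b\<close>, whence \<open>s = e s = s ^ (k + 1)\<close>;
  the pair \<open>0, 2\<close> makes \<open>s\<close> a higher power of itself or fixed by
  \<open>e\<close> on the right; the pair \<open>1, 2\<close> gives \<open>s = e\<close>.\<close>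

lemma PP_excluded:
  fixes S :: "'a sgrp" (structure)
  assumes "PP \<notin> variety E" "\<forall>q \<in> E. is_identity q" "S \<in> variety E"
    and e: "e \<in> carrier S" "e \<cdot> e = e" and s: "s \<in> carrier S" "e \<cdot> s = s"
  shows "(\<exists>k \<ge> 2. spow S s k = s) \<or> s \<cdot> e = s"
proof -
  interpret sgrp S using assms(3) by (simp add: variety_def)
  obtain q where q: "q \<in> E" "\<not> satisfies PP q"
    using assms(1) PP_sgrp by (auto simp: variety_def)
  then obtain \<phi> where \<phi>: "range \<phi> \<subseteq> carrier PP"
    "word_value PP \<phi> (fst q) \<noteq> word_value PP \<phi> (snd q)"
    unfolding satisfies_def by blast
  define el where "el k b = (if b then spow S s k \<cdot> e else spow S s k)" for k b
  have pc: "spow S s k \<in> carrier S" if "k > 0" for k using spow_closed[OF s(1) that] .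
  have elc: "el k b \<in> carrier S" if "k > 0" for k b using pc[OF that] e(1) by (simp add: el_def closed)
  have es: "e \<cdot> spow S s k = spow S s k" if "k > 0" for k
    using that
  proof (induction k rule: nat_induct_non_zero)
    case (Suc n)
    then show ?case using pc[OF Suc.hyps] e(1) s by (simp add: spow_Suc assoc[symmetric])
  qed (simp add: s)
  have e_el: "e \<cdot> el k b = el k b" if "k > 0" for k b
    using es[OF that] pc[OF that] e(1) by (simp add: el_def assoc[symmetric])
  have el_e: "el k b \<cdot> e = el k True" if "k > 0" for k b
    using pc[OF that] e by (simp add: el_def assoc)
  have el_el: "el k b \<cdot> el l c = el (k + l) c" if kl: "k > 0" "l > 0" for k l b c
  proof -
    have "el k b \<cdot> el l c = spow S s k \<cdot> el l c"
      using e_el[OF kl(2)] pc[OF kl(1)] elc[OF kl(2)] e(1) by (simp add: el_def[of k] assoc)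
    then show ?thesis
      using pc[OF kl(1)] pc[OF kl(2)] e(1) spow_add[OF s(1) kl] by (simp add: el_def assoc[symmetric])
  qed
  define rel where "rel c x \<longleftrightarrow> (if c = (1::nat) then x = e else if c = 2 then x = el 1 False
    else \<exists>k b. k > 0 \<and> (k \<ge> 2 \<or> b) \<and> x = el k b)" for c x
  have prod: "rel (c \<cdot>\<^bsub>PP\<^esub> d) (x \<cdot> y)" if c: "rel c x" and d: "rel d y" for c d x y
  proof (cases "c = 1")
    case True
    then have "x \<cdot> y = y" using c d e_el e(2) by (auto simp: rel_def split: if_splits)
    then show ?thesis using True d by (simp add: PP_def)
  next
    case False
    have pow: "\<exists>k a. k > 0 \<and> z = el k a" if z: "rel b z" "b \<noteq> 1" for b z
    proof (cases "b = 2")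
      case True
      then show ?thesis using z by (intro exI[of _ 1] exI[of _ False]) (simp add: rel_def)
    next
      case False
      then obtain k a where "k > 0" "z = el k a" using z by (auto simp: rel_def)
      then show ?thesis by (intro exI[of _ k] exI[of _ a]) simp
    qed
    from pow[OF c False] obtain k b where k: "k > 0" "x = el k b" by (elim exE conjE)
    have "\<exists>k b. k > 0 \<and> (k \<ge> 2 \<or> b) \<and> x \<cdot> y = el k b"
    proof (cases "d = 1")
      case True
      then have "y = e" using d by (simp add: rel_def)
      then have "x \<cdot> y = el k True" using k(2) el_e[OF k(1)] by simp
      then show ?thesis using k(1) by (intro exI[of _ k] exI[of _ True]) simp
    next
      case False
      from pow[OF d False] obtain l b' where l: "l > 0" "y = el l b'" by (elim exE conjE)
      have "x \<cdot> y = el (k + l) b'" using el_el[OF k(1) l(1)] k(2) l(2) by simp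
      then show ?thesis using k(1) l(1) by (intro exI[of _ "k + l"] exI[of _ b']) simp
    qed
    then show ?thesis using False by (simp add: rel_def PP_def)
  qed
  \<comment> \<open>Letters with value \<open>0\<close> may be sent to any element related to
    \<open>0\<close>; \<open>s ^ 2\<close> is the simplest.\<close>
  define \<psi> where "\<psi> i = (if \<phi> i = 1 then e else if \<phi> i = 2 then s else spow S s 2)" for i
  have \<psi>: "rel (\<phi> i) (\<psi> i)" for i
  proof -
    have "\<exists>k b. k > 0 \<and> (k \<ge> 2 \<or> b) \<and> spow S s 2 = el k b"
      by (intro exI[of _ 2] exI[of _ False]) (simp add: el_def)
    then show ?thesis by (simp add: rel_def \<psi>_def el_def[of "Suc 0"])
  qed
  have "\<psi> i \<in> carrier S" for i using e(1) s(1) pc by (simp add: \<psi>_def)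
  then have eq: "word_value S \<psi> (fst q) = word_value S \<psi> (snd q)"
    using assms(3) q(1) by (auto simp: variety_def satisfies_def)
  have ne: "fst q \<noteq> []" "snd q \<noteq> []" using assms(2) q(1) by (auto simp: is_identity_def)
  have main: ?thesis if r: "rel c x" "rel d x" and cd: "c < d" "d \<in> {0, 1, 2}" for c d x
  proof -
    consider "c = 0" "d = 1" | "c = 0" "d = 2" | "c = 1" "d = 2"
      using cd by (auto simp: less_Suc_eq numeral_2_eq_2)
    then show ?thesis
    proof cases
      case 1
      obtain k b where k: "k > 0" "x = el k b" using r(1) 1 by (auto simp: rel_def)
      have "x = e" using r(2) 1 by (simp add: rel_def)
      then have "s = el k b \<cdot> el 1 False" using k(2) s(2) by (simp add: el_def)
      also have "\<dots> = el (k + 1) False" by (rule el_el[OF k(1)]) simp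
      also have "\<dots> = spow S s (k + 1)" by (simp add: el_def)
      finally show ?thesis using k(1) by (intro disjI1 exI[of _ "k + 1"]) simp
    next
      case 2
      obtain k b where k: "k > 0" "k \<ge> 2 \<or> b" "x = el k b" using r(1) 2 by (auto simp: rel_def)
      have x: "x = s" using r(2) 2 by (simp add: rel_def el_def)
      show ?thesis
      proof (cases b)
        case True
        then have "s = el k True" using k x by simp
        moreover have "el k True \<cdot> e = el k True" using el_e[OF k(1)] by simp
        ultimately show ?thesis by simp
      next
        case False
        then have "k \<ge> 2" "s = spow S s k" using k x by (simp_all add: el_def)
        then show ?thesis by (intro disjI1 exI[of _ k]) simp
      qed
    next
      case 3
      then have "s = e" using r by (simp add: rel_def el_def)
      then show ?thesis using e by simp
    qed
  qed
  have r: "rel (word_value PP \<phi> (fst q)) (word_value S \<psi> (fst q))"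
    "rel (word_value PP \<phi> (snd q)) (word_value S \<psi> (fst q))"
    using word_value_rel[of rel PP S \<phi> \<psi>, OF prod \<psi> ne(1)]
      word_value_rel[of rel PP S \<phi> \<psi>, OF prod \<psi> ne(2)] eq by simp_all
  have PPc: "word_value PP \<phi> w \<in> {0, 1, 2}" if "w \<noteq> []" for w
  proof -
    have "set (map \<phi> w) \<subseteq> carrier PP" using \<phi>(1) by auto
    then have "sval PP (map \<phi> w) \<in> carrier PP" using that by (intro sgrp.sval_closed[OF PP_sgrp]) simp_all
    moreover have "carrier PP = {0, 1, 2}" by (simp add: PP_def)
    ultimately show ?thesis by (simp only: word_value_sval)
  qed
  from \<phi>(2) show ?thesis
  proof (rule linorder_neqE_nat)
    assume "word_value PP \<phi> (fst q) < word_value PP \<phi> (snd q)"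
    from main[OF r this PPc[OF ne(2)]] show ?thesis .
  next
    assume "word_value PP \<phi> (snd q) < word_value PP \<phi> (fst q)"
    from main[OF r(2,1) this PPc[OF ne(1)]] show ?thesis .
  qed
qed

text \<open>Now \<open>e\<close> is a two-sided identity for \<open>s\<close>, so only
  \<open>e\<close> and the powers of \<open>s\<close> occur, and every coincidence makes
  \<open>s\<close> a higher power of itself.\<close>

lemma CC_excluded:
  fixes S :: "'a sgrp" (structure)
  assumes "CC \<notin> variety E" "\<forall>q \<in> E. is_identity q" "S \<in> variety E"
    and e: "e \<in> carrier S" "e \<cdot> e = e" and s: "s \<in> carrier S" "e \<cdot> s = s" "s \<cdot> e = s"
  shows "\<exists>k \<ge> 2. spow S s k = s"
proof -
  interpret sgrp S using assms(3) by (simp add: variety_def)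
  obtain q where q: "q \<in> E" "\<not> satisfies CC q"
    using assms(1) CC_sgrp by (auto simp: variety_def)
  then obtain \<phi> where \<phi>: "range \<phi> \<subseteq> carrier CC"
    "word_value CC \<phi> (fst q) \<noteq> word_value CC \<phi> (snd q)"
    unfolding satisfies_def by blast
  have pc: "spow S s k \<in> carrier S" if "k > 0" for k using spow_closed[OF s(1) that] .
  have es: "e \<cdot> spow S s k = spow S s k \<and> spow S s k \<cdot> e = spow S s k" if "k > 0" for k
    using that
  proof (induction k rule: nat_induct_non_zero)
    case (Suc n)
    have "e \<cdot> (s \<cdot> spow S s n) = s \<cdot> spow S s n"
      using pc[OF Suc.hyps] e(1) s by (simp add: assoc[symmetric])
    moreover have "s \<cdot> spow S s n \<cdot> e = s \<cdot> spow S s n"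
      using pc[OF Suc.hyps] e(1) s Suc.IH by (simp add: assoc)
    ultimately show ?case using Suc.hyps by (simp add: spow_Suc)
  qed (simp add: s)
  define rel where "rel c x \<longleftrightarrow> (if c = (1::nat) then x = e else if c = 2 then x = spow S s 1
    else \<exists>k \<ge> 2. x = spow S s k)" for c x
  have prod: "rel (c \<cdot>\<^bsub>CC\<^esub> d) (x \<cdot> y)" if c: "rel c x" and d: "rel d y" for c d x y
  proof (cases "c = 1 \<or> d = 1")
    case True
    have "e \<cdot> z = z \<and> z \<cdot> e = z" if "rel b z" for b z
      using that es e(2) s by (auto simp: rel_def split: if_splits)
    note idz = this
    show ?thesis
    proof (cases "c = 1")
      case True
      then have "x = e" "c \<cdot>\<^bsub>CC\<^esub> d = d" using c by (simp_all add: rel_def CC_def)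
      then show ?thesis using d idz[OF d] by simp
    next
      case False
      then have "d = 1" using \<open>c = 1 \<or> d = 1\<close> by simp
      then have "y = e" "c \<cdot>\<^bsub>CC\<^esub> d = c" using d by (simp_all add: rel_def CC_def)
      then show ?thesis using c idz[OF c] by simp
    qed
  next
    case False
    have pow: "\<exists>k. k > 0 \<and> z = spow S s k" if z: "rel b z" "b \<noteq> 1" for b z
    proof (cases "b = 2")
      case True
      then show ?thesis using z by (intro exI[of _ 1]) (simp add: rel_def)
    next
      case False
      then obtain k where "k \<ge> 2" "z = spow S s k" using z by (auto simp: rel_def)
      then show ?thesis by (intro exI[of _ k]) simp
    qed
    have "c \<noteq> 1" "d \<noteq> 1" using False by simp_all
    from pow[OF c this(1)] obtain k where k: "k > 0" "x = spow S s k" by (elim exE conjE)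
    from pow[OF d \<open>d \<noteq> 1\<close>] obtain l where l: "l > 0" "y = spow S s l" by (elim exE conjE)
    have "x \<cdot> y = spow S s (k + l)" using spow_add[OF s(1) k(1) l(1)] k(2) l(2) by simp
    then have "\<exists>k \<ge> 2. x \<cdot> y = spow S s k" using k(1) l(1) by (intro exI[of _ "k + l"]) simp
    then show ?thesis using False by (simp add: rel_def CC_def)
  qed
  define \<psi> where "\<psi> i = (if \<phi> i = 1 then e else if \<phi> i = 2 then s else spow S s 2)" for i
  have \<psi>: "rel (\<phi> i) (\<psi> i)" for i by (auto simp: rel_def \<psi>_def)
  have "\<psi> i \<in> carrier S" for i using e(1) s(1) pc by (simp add: \<psi>_def)
  then have eq: "word_value S \<psi> (fst q) = word_value S \<psi> (snd q)"
    using assms(3) q(1) by (auto simp: variety_def satisfies_def)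
  have ne: "fst q \<noteq> []" "snd q \<noteq> []" using assms(2) q(1) by (auto simp: is_identity_def)
  have main: ?thesis if r: "rel c x" "rel d x" and cd: "c < d" "d \<in> {0, 1, 2}" for c d x
  proof -
    consider "c = 0" "d = 1" | "c = 0" "d = 2" | "c = 1" "d = 2"
      using cd by (auto simp: less_Suc_eq numeral_2_eq_2)
    then show ?thesis
    proof cases
      case 1
      then obtain k where k: "k \<ge> 2" "e = spow S s k" using r by (auto simp: rel_def)
      have "s = spow S s k \<cdot> s" using s(2) k(2) by simp
      also have "\<dots> = spow S s (Suc k)" using spow_Suc2[OF s(1), of k] k(1) by simp
      finally show ?thesis using k(1) by (intro exI[of _ "Suc k"]) simp
    next
      case 2
      then obtain k where "k \<ge> 2" "s = spow S s k" using r by (auto simp: rel_def)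
      then show ?thesis by (intro exI[of _ k]) simp
    next
      case 3
      then have "s = e" using r by (simp add: rel_def)
      then show ?thesis using spow_idem[OF e(2), of 2] by (intro exI[of _ 2]) simp
    qed
  qed
  have r: "rel (word_value CC \<phi> (fst q)) (word_value S \<psi> (fst q))"
    "rel (word_value CC \<phi> (snd q)) (word_value S \<psi> (fst q))"
    using word_value_rel[of rel CC S \<phi> \<psi>, OF prod \<psi> ne(1)]
      word_value_rel[of rel CC S \<phi> \<psi>, OF prod \<psi> ne(2)] eq by simp_all
  have CCc: "word_value CC \<phi> w \<in> {0, 1, 2}" if "w \<noteq> []" for w
  proof -
    have "set (map \<phi> w) \<subseteq> carrier CC" using \<phi>(1) by auto
    then have "sval CC (map \<phi> w) \<in> carrier CC" using that by (intro sgrp.sval_closed[OF CC_sgrp]) simp_all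
    moreover have "carrier CC = {0, 1, 2}" by (simp add: CC_def)
    ultimately show ?thesis by (simp only: word_value_sval)
  qed
  from \<phi>(2) show ?thesis
  proof (rule linorder_neqE_nat)
    assume "word_value CC \<phi> (fst q) < word_value CC \<phi> (snd q)"
    from main[OF r this CCc[OF ne(2)]] show ?thesis .
  next
    assume "word_value CC \<phi> (snd q) < word_value CC \<phi> (fst q)"
    from main[OF r(2,1) this CCc[OF ne(1)]] show ?thesis .
  qed
qed

section \<open>Normal forms for products of commuting maps\<close>

fun bounded_products :: "nat \<Rightarrow> ('a \<Rightarrow> 'a) list \<Rightarrow> ('a \<Rightarrow> 'a) set" where
  "bounded_products p [] = {id}"
| "bounded_products p (\<rho> # rs) = (\<lambda>(m, i). m \<circ> (\<rho> ^^ i)) ` (bounded_products p rs \<times> {..<2 * p})"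

lemma finite_bounded_products: "finite (bounded_products p rs)"
  by (induction rs) auto

lemma id_bounded_products: "p > 0 \<Longrightarrow> id \<in> bounded_products p rs"
proof (induction rs)
  case (Cons \<rho> rs)
  have "id = (\<lambda>(m, i). m \<circ> (\<rho> ^^ i)) (id, 0 :: nat)" by (simp add: fun_eq_iff)
  moreover have "(id, 0) \<in> bounded_products p rs \<times> {..<2 * p}"
    by (intro SigmaI Cons.IH Cons.prems) (use Cons.prems in simp)
  ultimately show ?case unfolding bounded_products.simps by (rule image_eqI)
qed simp

text \<open>An additional \<open>\<sigma>\<close> travels to its own place in the list and raises
  the exponent there by one; an exponent that reaches \<open>2 p\<close> drops back to
  \<open>p\<close>. Commutation is asked only with \<open>\<sigma>\<close> and only on
  \<open>X\<close>, as the application provides no more.\<close>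

lemma bounded_products_absorb:
  assumes "\<sigma> \<in> set rs" "p > 0" "m \<in> bounded_products p rs"
    "\<And>\<rho> x. \<lbrakk>\<rho> \<in> set rs; x \<in> X\<rbrakk> \<Longrightarrow> \<rho> x \<in> X"
    "\<And>\<rho> x. \<lbrakk>\<rho> \<in> set rs; x \<in> X\<rbrakk> \<Longrightarrow> \<rho> (\<sigma> x) = \<sigma> (\<rho> x)"
    "\<And>x. x \<in> X \<Longrightarrow> (\<sigma> ^^ (2 * p)) x = (\<sigma> ^^ p) x"
  shows "\<exists>m' \<in> bounded_products p rs. \<forall>x \<in> X. m (\<sigma> x) = m' x"
  using assms(1,3-5)
proof (induction rs arbitrary: m)
  case (Cons \<rho> rs)
  obtain m1 i where m: "m1 \<in> bounded_products p rs" "i < 2 * p" "m = m1 \<circ> (\<rho> ^^ i)"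
    using Cons.prems(2) by auto
  have inX: "(\<rho> ^^ n) x \<in> X" if "x \<in> X" for n x
    using that Cons.prems(3)[of \<rho>] by (induction n) auto
  show ?case
  proof (cases "\<sigma> = \<rho>")
    case True
    define i' where "i' = (if Suc i < 2 * p then Suc i else p)"
    have "(\<rho> ^^ i) (\<sigma> x) = (\<rho> ^^ i') x" if "x \<in> X" for x
    proof (cases "Suc i < 2 * p")
      case False
      then have "Suc i = 2 * p" using m(2) by simp
      then have "(\<rho> ^^ Suc i) x = (\<rho> ^^ p) x" using assms(6)[OF that] True by metis
      then show ?thesis using False True by (simp add: i'_def funpow_swap1)
    qed (simp add: i'_def True funpow_swap1)
    then have "\<forall>x \<in> X. m (\<sigma> x) = (m1 \<circ> (\<rho> ^^ i')) x" by (simp add: m(3))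
    moreover have "i' < 2 * p" using assms(2) by (simp add: i'_def)
    then have "m1 \<circ> (\<rho> ^^ i') \<in> bounded_products p (\<rho> # rs)"
      using m(1) by (auto intro!: image_eqI[of _ _ "(m1, i')"])
    ultimately show ?thesis by blast
  next
    case False
    then have "\<sigma> \<in> set rs" using Cons.prems(1) by simp
    from Cons.IH[OF this m(1)] obtain m1'
      where m1': "m1' \<in> bounded_products p rs" "\<forall>x \<in> X. m1 (\<sigma> x) = m1' x"
      using Cons.prems(3,4) by auto
    have "(\<rho> ^^ n) (\<sigma> x) = \<sigma> ((\<rho> ^^ n) x)" if "x \<in> X" for n x
      using Cons.prems(4)[of \<rho>] inX[OF that] by (induction n) auto
    then have "\<forall>x \<in> X. m (\<sigma> x) = (m1' \<circ> (\<rho> ^^ i)) x" using m1'(2) inX by (simp add: m(3))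
    moreover have "m1' \<circ> (\<rho> ^^ i) \<in> bounded_products p (\<rho> # rs)"
      using m1'(1) m(2) by (auto intro!: image_eqI[of _ _ "(m1', i)"])
    ultimately show ?thesis by blast
  qed
qed simp

section \<open>Semigroups excluded by local R-finiteness\<close>

context
  fixes E :: "identity set"
  assumes inf: "infinite (UNIV :: 'a set)"
    and E: "\<forall>p \<in> E. is_identity p"
    and lR: "locally_R_finite_variety (variety E :: 'a sgrp set)"
begin

text \<open>Finitely many R-classes bound every pairwise R-inequivalent set. The multipliers
  \<open>s\<close> and \<open>t\<close> range over all of \<open>S\<close>, so that applications
  need not look inside the generated subsemigroup.\<close>

lemma R_trivial_subset_finite:
  fixes S :: "'x sgrp"
  assumes S: "S \<in> variety E" "finite A" "A \<subseteq> carrier S" "A \<noteq> {}" and Y: "Y \<subseteq> sgenerate S A"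
    and neq: "\<And>x y s t. \<lbrakk>x \<in> Y; y \<in> Y; x \<noteq> y; s \<in> carrier S; t \<in> carrier S;
      x = y \<cdot>\<^bsub>S\<^esub> s; y = x \<cdot>\<^bsub>S\<^esub> t\<rbrakk> \<Longrightarrow> False"
  shows "finite Y"
proof -
  interpret sgrp S using S(1) by (simp add: variety_def)
  let ?T = "sub S (sgenerate S A)"
  interpret T: sgrp ?T using sgenerate_variety[OF S(1) E S(4,3)] by (simp add: variety_def)
  have T: "sgenerate S A \<subseteq> carrier S" using sgenerate_closed S(3) .
  show ?thesis
  proof (rule T.R_trivial_finite)
    show "R_finite ?T" by (rule locally_R_finite_sgenerate[OF inf lR E S])
    show "Y \<subseteq> carrier ?T" using Y by simp
    fix x y assume xy: "x \<in> Y" "y \<in> Y" "req ?T x y"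
    show "x = y"
    proof (rule ccontr)
      assume ne: "x \<noteq> y"
      have "rle ?T x y" "rle ?T y x" using xy(3) by (simp_all add: req_def)
      then obtain s t where "s \<in> sgenerate S A" "t \<in> sgenerate S A" "x = y \<cdot>\<^bsub>S\<^esub> s" "y = x \<cdot>\<^bsub>S\<^esub> t"
        using ne unfolding rle_def by fastforce
      then show False using neq[OF xy(1,2) ne, of s t] T by (meson subsetD)
    qed
  qed
qed

text \<open>All left zeros \<open>Inr g\<close> are reached from the bar of the identity by left
  multiplication, so finitely many generators produce infinitely many R-classes.\<close>

lemma L_not_in_variety:
  fixes G :: "'d monoid"
  assumes "novikov_adian G" shows "L G \<notin> variety E"
proof
  assume LV: "L G \<in> variety E"
  interpret group G using assms by (simp add: novikov_adian_def)
  obtain A where A: "finite A" "A \<subseteq> carrier G" "generate G A = carrier G"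
    using assms by (auto simp: novikov_adian_def)
  \<comment> \<open>\<open>generate\<close> allows inverses and \<open>sgenerate\<close> does not,
    so the inverses of the generators are added.\<close>
  define B where "B = insert (Inr \<one>\<^bsub>G\<^esub>) (Inl ` (insert \<one>\<^bsub>G\<^esub> (A \<union> m_inv G ` A)))"
  have "Inl g \<in> sgenerate (L G) B" if "g \<in> generate G A" for g
    using that
  proof induction
    case (eng g h)
    then have "Inl g \<cdot>\<^bsub>L G\<^esub> Inl h \<in> sgenerate (L G) B" by (intro sgenerate.prod)
    then show ?case by (simp add: L_simps)
  qed (auto simp: B_def intro: sgenerate.incl)
  moreover have "Inr \<one>\<^bsub>G\<^esub> \<in> sgenerate (L G) B" by (intro sgenerate.incl) (simp add: B_def)
  ultimately have "Inl g \<cdot>\<^bsub>L G\<^esub> Inr \<one>\<^bsub>G\<^esub> \<in> sgenerate (L G) B" if "g \<in> carrier G" for g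
    using that A(3) by (intro sgenerate.prod) simp_all
  then have Y: "Inr ` carrier G \<subseteq> sgenerate (L G) B" by (auto simp: L_simps)
  have "finite (Inr ` carrier G :: ('d + 'd) set)"
  proof (rule R_trivial_subset_finite[OF LV _ _ _ Y])
    show "finite B" using A(1) by (simp add: B_def)
    show "B \<subseteq> carrier (L G)" using A(2) by (auto simp: B_def L_simps)
    show "B \<noteq> {}" by (simp add: B_def)
    fix x y s t assume y: "y \<in> (Inr ` carrier G :: ('d + 'd) set)" "x \<noteq> y" "x = y \<cdot>\<^bsub>L G\<^esub> s"
    obtain g where "y = Inr g" using y(1) by (rule imageE)
    then have "x = y" using y(3) by (simp only: L_simps)
    then show False using y(2) by simp
  qed
  then have "finite (carrier G)" by (simp add: finite_image_iff)
  then show False using assms by (simp add: novikov_adian_def)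
qed

lemma NN_not_in_variety: "NN \<notin> variety E"
proof
  assume N: "NN \<in> variety E"
  have "n > 0 \<Longrightarrow> n \<in> sgenerate NN {1}" for n
  proof (induction n rule: nat_induct_non_zero)
    case (Suc n)
    have "1 \<in> sgenerate NN {1}" by (intro sgenerate.incl) simp
    from sgenerate.prod[OF this Suc.IH] show ?case by (simp add: NN_def)
  qed (auto intro: sgenerate.incl)
  then have Y: "{0<..} \<subseteq> sgenerate NN {1}" by auto
  have "finite ({0<..} :: nat set)"
  proof (rule R_trivial_subset_finite[OF N _ _ _ Y])
    show "{1} \<subseteq> carrier NN" by (simp add: NN_def)
    fix x y s t :: nat
    assume "s \<in> carrier NN" "t \<in> carrier NN" "x = y \<cdot>\<^bsub>NN\<^esub> s" "y = x \<cdot>\<^bsub>NN\<^esub> t"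
    then have "s > 0" "x = y + s" "y = x + t" by (simp_all only: NN_def) simp_all
    then show False by simp
  qed simp_all
  then show False using infinite_Ioi by blast
qed

text \<open>In \<open>PP\<close> the coordinate \<open>2\<close> survives left multiplication by
  \<open>1\<close> but becomes \<open>0\<close> under any right multiplication. The elements
  \<open>(x, 2)\<close> are therefore pairwise R-inequivalent, although finitely many elements
  generate them all.\<close>

lemma PP_not_in_variety:
  fixes B :: "'b sgrp"
  assumes B: "B \<in> variety E" "finite A" "A \<subseteq> carrier B" "infinite (sgenerate B A)"
  shows "PP \<notin> variety E"
proof
  assume P: "PP \<in> variety E"
  interpret sgrp B using B(1) by (simp add: variety_def)
  let ?S = "prodS B PP" and ?A = "A \<times> {1, 2}"
  have S: "?S \<in> variety E" by (rule prodS_variety[OF B(1) P E])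
  have mult: "(x, c) \<cdot>\<^bsub>?S\<^esub> (y, d) = (x \<cdot>\<^bsub>B\<^esub> y, c \<cdot>\<^bsub>PP\<^esub> d)" for x y c d
    by (simp add: prodS_def)
  have "(x, 1) \<in> sgenerate ?S ?A \<and> (x, 2) \<in> sgenerate ?S ?A" if "x \<in> sgenerate B A" for x
    using that
  proof induction
    case (prod x y)
    then have "(x, 1) \<cdot>\<^bsub>?S\<^esub> (y, 1) \<in> sgenerate ?S ?A" "(x, 1) \<cdot>\<^bsub>?S\<^esub> (y, 2) \<in> sgenerate ?S ?A"
      by (auto intro!: sgenerate.prod)
    then show ?case unfolding mult by (simp add: PP_def)
  qed (auto intro!: sgenerate.incl)
  then have Y: "sgenerate B A \<times> {2} \<subseteq> sgenerate ?S ?A" by auto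
  have "A \<noteq> {}"
  proof
    assume "A = {}"
    then have "sgenerate B A = {}" using sgenerate_image[of "{}"] by simp
    then show False using B(4) by simp
  qed
  have "finite (sgenerate B A \<times> {2 :: nat})"
  proof (rule R_trivial_subset_finite[OF S _ _ _ Y])
    show "finite ?A" using B(2) by simp
    show "?A \<subseteq> carrier ?S" using B(3) by (auto simp: prodS_def PP_def)
    show "?A \<noteq> {}" using \<open>A \<noteq> {}\<close> by simp
    fix x y s t assume "x \<in> sgenerate B A \<times> {2 :: nat}" "y \<in> sgenerate B A \<times> {2 :: nat}"
      "x = y \<cdot>\<^bsub>?S\<^esub> s"
    then have "snd x = 2" "snd x = 0" by (auto simp: prodS_def PP_def)
    then show False by simp
  qed
  then have "finite (sgenerate B A)" by (auto dest: finite_cartesian_productD1)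
  then show False using B(4) by simp
qed

text \<open>Let \<open>a\<close> be the nilpotent element of \<open>CC\<close>.  The polynomial functions \<open>z \<mapsto> w z\<close>, paired with
  \<open>a\<close>, lie in finitely many R-classes, so \<open>v z = q z u\<close> identically in \<open>z\<close>, where \<open>q\<close> ranges
  over a finite set.  Substituting \<open>z y\<close> for \<open>z\<close> shows that \<open>u\<close> commutes with everything to the
  right of \<open>q z\<close>, whence \<open>w z = q z \<Prod> u\<^sub>i ^ k\<^sub>i\<close> with bounded exponents.\<close>

lemma CC_not_in_variety:
  fixes B :: "'b sgrp"
  assumes B: "B \<in> variety E" "finite A" "A \<subseteq> carrier B" "infinite (sgenerate B A)"
  shows "CC \<notin> variety E"
proof
  assume C: "CC \<in> variety E"
  interpret sgrp B using B(1) by (simp add: variety_def)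
  define D where "D = sgenerate B A"
  have Dc: "D \<subseteq> carrier B" unfolding D_def by (rule sgenerate_closed[OF B(3)])
  have AD: "A \<subseteq> D" by (auto simp: D_def intro: sgenerate.incl)
  have Dm: "x \<cdot>\<^bsub>B\<^esub> y \<in> D" if "x \<in> D" "y \<in> D" for x y
    using that unfolding D_def by (rule sgenerate.prod)
  have as: "x \<cdot>\<^bsub>B\<^esub> y \<cdot>\<^bsub>B\<^esub> z = x \<cdot>\<^bsub>B\<^esub> (y \<cdot>\<^bsub>B\<^esub> z)" if "x \<in> D" "y \<in> D" "z \<in> D" for x y z
    using that Dc by (intro assoc) auto
  have "A \<noteq> {}"
  proof
    assume "A = {}"
    then have "sgenerate B A = {}" using sgenerate_image[of "{}"] by simp
    then show False using B(4) by simp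
  qed
  then obtain a0 where a0: "a0 \<in> A" by blast
  have BD: "sub B D \<in> variety E"
    unfolding D_def by (rule sgenerate_variety[OF B(1) E \<open>A \<noteq> {}\<close> B(3)])
  define F where "F = (powS (sub B D) :: ('b \<Rightarrow> 'b) sgrp)"
  have FC: "prodS F CC \<in> variety E"
    unfolding F_def by (rule prodS_variety[OF powS_variety[OF BD E] C E])
  interpret FC: sgrp "prodS F CC" using FC by (simp add: variety_def)
  have mult: "(f, c) \<cdot>\<^bsub>prodS F CC\<^esub> (g, d) = (\<lambda>x. f x \<cdot>\<^bsub>B\<^esub> g x, c \<cdot>\<^bsub>CC\<^esub> d)" for f g c d
    by (simp add: prodS_def F_def powS_def)
  \<comment> \<open>This is the variable \<open>z\<close>. The power is indexed by a whole type, so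
    arguments outside \<open>D\<close> receive the default value \<open>a0\<close>.\<close>
  define \<iota> where "\<iota> x = (if x \<in> D then x else a0)" for x
  have \<iota>: "\<iota> x \<in> D" for x using a0 AD by (auto simp: \<iota>_def)
  \<comment> \<open>Constants carry the label \<open>1\<close> and the variable the label
    \<open>2\<close>. A product with label \<open>2\<close> thus contains the variable exactly once,
    and one with label \<open>1\<close> not at all.\<close>
  define A' where "A' = insert (\<iota>, 2 :: nat) ((\<lambda>a. (\<lambda>_. a, 1)) ` A)"
  have A': "finite A'" "A' \<noteq> {}" "A' \<subseteq> carrier (prodS F CC)"
    using B(2) \<iota> AD by (auto simp: A'_def prodS_def F_def powS_def CC_def)
  define T where "T = sgenerate (prodS F CC) A'"
  define K where "K w = (\<lambda>x. w \<cdot>\<^bsub>B\<^esub> \<iota> x, 2 :: nat)" for w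
  have "(\<lambda>_. w, 1) \<in> T" if "w \<in> D" for w
    using that unfolding D_def
  proof induction
    case (incl a)
    then show ?case by (auto simp: T_def A'_def intro!: sgenerate.incl)
  next
    case (prod x y)
    then have "(\<lambda>_. x, 1) \<cdot>\<^bsub>prodS F CC\<^esub> (\<lambda>_. y, 1) \<in> T"
      unfolding T_def by (intro sgenerate.prod)
    then show ?case unfolding mult by (simp add: CC_def)
  qed
  moreover have "(\<iota>, 2) \<in> T" by (auto simp: T_def A'_def intro: sgenerate.incl)
  ultimately have "(\<lambda>_. w, 1) \<cdot>\<^bsub>prodS F CC\<^esub> (\<iota>, 2) \<in> T" if "w \<in> D" for w
    using that unfolding T_def by (intro sgenerate.prod)
  then have KT: "K w \<in> T" if "w \<in> D" for w
    using that unfolding mult by (simp add: CC_def K_def)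
  have T1: "snd t = 1 \<longrightarrow> (\<exists>u \<in> D. fst t = (\<lambda>_. u))" if "t \<in> T" for t
    using that unfolding T_def
  proof induction
    case (incl t)
    then show ?case using AD by (auto simp: A'_def)
  next
    case (prod s t)
    show ?case
    proof
      assume one: "snd (s \<cdot>\<^bsub>prodS F CC\<^esub> t) = 1"
      have st: "s \<cdot>\<^bsub>prodS F CC\<^esub> t = (\<lambda>x. fst s x \<cdot>\<^bsub>B\<^esub> fst t x, snd s \<cdot>\<^bsub>CC\<^esub> snd t)"
        using mult[of "fst s" "snd s" "fst t" "snd t"] by simp
      have "snd s = 1 \<and> snd t = 1" using one unfolding st by (auto simp: CC_def split: if_splits)
      then obtain u v where "u \<in> D" "v \<in> D" "fst s = (\<lambda>_. u)" "fst t = (\<lambda>_. v)"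
        using prod.IH by auto
      then show "\<exists>u \<in> D. fst (s \<cdot>\<^bsub>prodS F CC\<^esub> t) = (\<lambda>_. u)" using Dm unfolding st by auto
    qed
  qed
  \<comment> \<open>\<open>id\<close> accounts for the adjoined identity in the definition of
    R.\<close>
  define Rs where "Rs = insert id ((\<lambda>u x. x \<cdot>\<^bsub>B\<^esub> u) ` D)"
  let ?T = "sub (prodS F CC) T"
  have TV: "?T \<in> variety E"
    unfolding T_def by (rule sgenerate_variety[OF FC E A'(2,3)])
  interpret T: sgrp ?T using TV by (simp add: variety_def)
  have "R_finite ?T"
    unfolding T_def by (rule locally_R_finite_sgenerate[OF inf lR E FC A'(1,3,2)])
  then have "finite (Rcl ?T ` carrier ?T)" by (simp add: T.R_finite_iff)
  moreover have "K ` D \<subseteq> carrier ?T" using KT by auto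
  ultimately have "finite (Rcl ?T ` K ` D)" using finite_subset image_mono by metis
  from T.Rcl_finite_reps[OF this \<open>K ` D \<subseteq> carrier ?T\<close>] obtain F' where
    F': "finite F'" "F' \<subseteq> K ` D" "\<And>x. x \<in> K ` D \<Longrightarrow> \<exists>y \<in> F'. req ?T y x" by metis
  from finite_subset_image[OF F'(1,2)] obtain Q where Q: "Q \<subseteq> D" "finite Q" "F' = K ` Q"
    by (elim exE conjE)
  have ex: "\<exists>q \<in> Q. \<exists>\<rho> \<in> Rs. \<forall>z \<in> D. w \<cdot>\<^bsub>B\<^esub> z = \<rho> (q \<cdot>\<^bsub>B\<^esub> z)" if w: "w \<in> D" for w
  proof -
    obtain q where q: "q \<in> Q" "req ?T (K q) (K w)" using F'(3)[of "K w"] w Q(3) by auto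
    then have "rle ?T (K w) (K q)" by (simp add: req_def)
    then consider "K w = K q" | t where "t \<in> T" "K w = K q \<cdot>\<^bsub>prodS F CC\<^esub> t"
      by (auto simp: rle_def)
    then have "\<exists>\<rho> \<in> Rs. \<forall>x. w \<cdot>\<^bsub>B\<^esub> \<iota> x = \<rho> (q \<cdot>\<^bsub>B\<^esub> \<iota> x)"
    proof cases
      case 1
      then have "\<forall>x. w \<cdot>\<^bsub>B\<^esub> \<iota> x = id (q \<cdot>\<^bsub>B\<^esub> \<iota> x)" by (simp add: K_def fun_eq_iff)
      then show ?thesis by (rule bexI[of _ id]) (simp add: Rs_def)
    next
      case 2
      have eq: "K w = (\<lambda>x. (q \<cdot>\<^bsub>B\<^esub> \<iota> x) \<cdot>\<^bsub>B\<^esub> fst t x, 2 \<cdot>\<^bsub>CC\<^esub> snd t)"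
        using 2(2) mult[of _ 2 "fst t" "snd t"] by (simp add: K_def)
      \<comment> \<open>The label shows that the right multiplier is a constant.\<close>
      then have "2 = 2 \<cdot>\<^bsub>CC\<^esub> snd t" by (simp add: K_def)
      then have "snd t = 1" by (auto simp: CC_def split: if_splits)
      then obtain u where u: "u \<in> D" "fst t = (\<lambda>_. u)" using T1[OF 2(1)] by blast
      have "(\<lambda>x. w \<cdot>\<^bsub>B\<^esub> \<iota> x) = (\<lambda>x. (q \<cdot>\<^bsub>B\<^esub> \<iota> x) \<cdot>\<^bsub>B\<^esub> u)" using eq u(2) by (simp add: K_def)
      then have "\<forall>x. w \<cdot>\<^bsub>B\<^esub> \<iota> x = (\<lambda>x. x \<cdot>\<^bsub>B\<^esub> u) (q \<cdot>\<^bsub>B\<^esub> \<iota> x)" by (simp add: fun_eq_iff)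
      moreover have "(\<lambda>x. x \<cdot>\<^bsub>B\<^esub> u) \<in> Rs" using u(1) by (simp add: Rs_def)
      ultimately show ?thesis by (rule bexI[of _ "\<lambda>x. x \<cdot>\<^bsub>B\<^esub> u"])
    qed
    then obtain \<rho> where "\<rho> \<in> Rs" "\<forall>x. w \<cdot>\<^bsub>B\<^esub> \<iota> x = \<rho> (q \<cdot>\<^bsub>B\<^esub> \<iota> x)" by blast
    then have "\<forall>z \<in> D. w \<cdot>\<^bsub>B\<^esub> z = \<rho> (q \<cdot>\<^bsub>B\<^esub> z)" by (metis \<iota>_def)
    then show ?thesis using q(1) \<open>\<rho> \<in> Rs\<close> by blast
  qed
  have "\<forall>w. \<exists>q \<rho>. w \<in> D \<longrightarrow> q \<in> Q \<and> \<rho> \<in> Rs \<and> (\<forall>z \<in> D. w \<cdot>\<^bsub>B\<^esub> z = \<rho> (q \<cdot>\<^bsub>B\<^esub> z))"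
    using ex by blast
  then obtain qq rr where "\<forall>w. w \<in> D \<longrightarrow> qq w \<in> Q \<and> rr w \<in> Rs \<and>
      (\<forall>z \<in> D. w \<cdot>\<^bsub>B\<^esub> z = rr w (qq w \<cdot>\<^bsub>B\<^esub> z))" by metis
  then have qr: "qq w \<in> Q" "rr w \<in> Rs" "\<And>z. z \<in> D \<Longrightarrow> w \<cdot>\<^bsub>B\<^esub> z = rr w (qq w \<cdot>\<^bsub>B\<^esub> z)"
    if "w \<in> D" for w using that by simp_all
  obtain p where p: "p > 0" "\<forall>S \<in> (variety E :: 'b sgrp set). \<forall>x \<in> carrier S.
      spow S x p \<cdot>\<^bsub>S\<^esub> spow S x p = spow S x p"
    using uniform_idempotent_power[OF NN_not_in_variety E] by (elim exE conjE)
  \<comment> \<open>Rewriting a word from its right end meets only a letter, or a letter times an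
    element of \<open>Q\<close>, so finitely many translations suffice.\<close>
  define V where "V = A \<union> (\<lambda>(a, q). a \<cdot>\<^bsub>B\<^esub> q) ` (A \<times> Q)"
  have "a \<cdot>\<^bsub>B\<^esub> q \<in> D" if "a \<in> A" "q \<in> Q" for a q
    using that AD Q(1) by (intro Dm) auto
  then have V: "finite V" "V \<subseteq> D" using B(2) Q(2) AD by (auto simp: V_def)
  obtain rs where rs: "set rs = rr ` V" using finite_list[OF finite_imageI[OF V(1)]] by (rule exE)
  have rsR: "\<rho> \<in> Rs" if "\<rho> \<in> set rs" for \<rho>   proof -
    from that obtain v where "v \<in> V" "\<rho> = rr v" unfolding rs by (rule imageE)
    then show ?thesis using V(2) qr(2)[of v] by auto
  qed
  have Rs_left: "\<rho> x \<in> D" "\<rho> (y \<cdot>\<^bsub>B\<^esub> x) = y \<cdot>\<^bsub>B\<^esub> \<rho> x"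
    if "\<rho> \<in> Rs" "x \<in> D" "y \<in> D" for \<rho> x y
    using that Dm as by (auto simp: Rs_def)
  have Rs_pow: "(\<rho> ^^ (2 * p)) x = (\<rho> ^^ p) x" if r: "\<rho> \<in> Rs" and x: "x \<in> D" for \<rho> x
  proof (cases "\<rho> = id")
    case False
    then obtain u where u: "u \<in> D" "\<rho> = (\<lambda>x. x \<cdot>\<^bsub>B\<^esub> u)" using r by (auto simp: Rs_def)
    have uc: "u \<in> carrier B" "x \<in> carrier B" using u(1) x Dc by auto
    have "(\<rho> ^^ n) x = x \<cdot>\<^bsub>B\<^esub> spow B u n" if "n > 0" for n
      using that
    proof (induction n rule: nat_induct_non_zero)
      case (Suc n)
      then show ?case using uc spow_closed[of u n] by (simp add: u(2) spow_Suc2 assoc)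
    qed (simp add: u(2))
    moreover have "spow B u (2 * p) = spow B u p"
      using spow_add[OF uc(1) p(1) p(1)] bspec[OF bspec[OF p(2) B(1)] uc(1)] by (simp add: mult_2)
    ultimately show ?thesis using p(1) by simp
  qed simp
  have mD: "m x \<in> D \<and> m (y \<cdot>\<^bsub>B\<^esub> x) = y \<cdot>\<^bsub>B\<^esub> m x"
    if "m \<in> bounded_products p ts" "set ts \<subseteq> Rs" "x \<in> D" "y \<in> D" for m x y ts
    using that
  proof (induction ts arbitrary: m x)
    case (Cons \<rho> ts)
    obtain m1 i where m1: "m1 \<in> bounded_products p ts" "m = m1 \<circ> (\<rho> ^^ i)"
      using Cons.prems(1) by auto
    have "(\<rho> ^^ n) x \<in> D \<and> (\<rho> ^^ n) (y \<cdot>\<^bsub>B\<^esub> x) = y \<cdot>\<^bsub>B\<^esub> (\<rho> ^^ n) x" for n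
      using Cons.prems(2-4) Rs_left[of \<rho>] by (induction n) auto
    then show ?case using Cons.IH[OF m1(1), of "(\<rho> ^^ i) x"] Cons.prems(2,4) m1(2) by simp
  qed simp
  have step: "\<exists>q \<in> Q. \<exists>m' \<in> bounded_products p rs. \<forall>z \<in> D. m (v \<cdot>\<^bsub>B\<^esub> z) = m' (q \<cdot>\<^bsub>B\<^esub> z)"
    if v: "v \<in> V" and m: "m \<in> bounded_products p rs" for v m
  proof -
    have vD: "v \<in> D" using v V(2) by auto
    \<comment> \<open>Only on these elements does the equation for \<open>v\<close> say anything
      about \<open>rr v\<close>.\<close>
    define X where "X = (\<lambda>z. qq v \<cdot>\<^bsub>B\<^esub> z) ` D"
    have qD: "qq v \<in> D" using qr(1)[OF vD] Q(1) by auto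
    have "\<exists>m' \<in> bounded_products p rs. \<forall>x \<in> X. m (rr v x) = m' x"
    proof (rule bounded_products_absorb[OF _ p(1) m])
      show "rr v \<in> set rs" using rs v by simp
      fix \<rho> x assume r: "\<rho> \<in> set rs" and x: "x \<in> X"
      then obtain z where z: "z \<in> D" "x = qq v \<cdot>\<^bsub>B\<^esub> z" by (auto simp: X_def)
      have rz: "\<rho> z \<in> D" "\<rho> (qq v \<cdot>\<^bsub>B\<^esub> z) = qq v \<cdot>\<^bsub>B\<^esub> \<rho> z" "\<rho> (v \<cdot>\<^bsub>B\<^esub> z) = v \<cdot>\<^bsub>B\<^esub> \<rho> z"
        using Rs_left[OF rsR[OF r] z(1)] qD vD by auto
      then show "\<rho> x \<in> X" using z(2) by (simp add: X_def)
      \<comment> \<open>\<open>\<rho> z\<close> is again a value of the variable, and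
        \<open>\<rho>\<close> passes through left multiplication, so the equation for
        \<open>v\<close> can be read both at \<open>z\<close> and at
        \<open>\<rho> z\<close>.\<close>
      have "\<rho> (rr v x) = v \<cdot>\<^bsub>B\<^esub> \<rho> z" using qr(3)[OF vD z(1)] z(2) rz(3) by simp
      also have "\<dots> = rr v (\<rho> x)" using qr(3)[OF vD rz(1)] z(2) rz(2) by simp
      finally show "\<rho> (rr v x) = rr v (\<rho> x)" .
    next
      fix x assume "x \<in> X"
      then have "x \<in> D" using qD Dm by (auto simp: X_def)
      then show "(rr v ^^ (2 * p)) x = (rr v ^^ p) x" using Rs_pow[OF qr(2)[OF vD]] by simp
    qed
    then obtain m' where m': "m' \<in> bounded_products p rs" "\<forall>x \<in> X. m (rr v x) = m' x" by blast
    have "\<forall>z \<in> D. m (v \<cdot>\<^bsub>B\<^esub> z) = m' (qq v \<cdot>\<^bsub>B\<^esub> z)"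
      using m'(2) qr(3)[OF vD] by (simp add: X_def)
    then show ?thesis using qr(1)[OF vD] m'(1) by blast
  qed
  have nf: "\<exists>q \<in> Q. \<exists>m \<in> bounded_products p rs. \<forall>z \<in> D. sval B w \<cdot>\<^bsub>B\<^esub> z = m (q \<cdot>\<^bsub>B\<^esub> z)"
    if "w \<noteq> []" "set w \<subseteq> A" for w
    using that
  proof (induction w)
    case (Cons a w)
    have a: "a \<in> A" "a \<in> D" "set w \<subseteq> A" using Cons.prems AD by auto
    show ?case
    proof (cases "w = []")
      case True
      have "a \<in> V" using a(1) by (simp add: V_def)
      from step[OF this id_bounded_products[OF p(1)]] show ?thesis using True by simp
    next
      case False
      from Cons.IH[OF False a(3)] obtain q m where q: "q \<in> Q" "m \<in> bounded_products p rs"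
        "\<forall>z \<in> D. sval B w \<cdot>\<^bsub>B\<^esub> z = m (q \<cdot>\<^bsub>B\<^esub> z)" by blast
      have qD: "q \<in> D" using q(1) Q(1) by auto
      have wD: "sval B w \<in> D" unfolding D_def by (rule sval_in_sgenerate[OF False a(3)])
      have "sval B (a # w) \<cdot>\<^bsub>B\<^esub> z = m ((a \<cdot>\<^bsub>B\<^esub> q) \<cdot>\<^bsub>B\<^esub> z)" if z: "z \<in> D" for z
      proof -
        have "sval B (a # w) \<cdot>\<^bsub>B\<^esub> z = a \<cdot>\<^bsub>B\<^esub> m (q \<cdot>\<^bsub>B\<^esub> z)"
          using False as[OF a(2) wD z] q(3) z by (simp add: sval_Cons)
        also have "\<dots> = m (a \<cdot>\<^bsub>B\<^esub> (q \<cdot>\<^bsub>B\<^esub> z))"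
          using mD[OF q(2) subsetI[OF rsR] Dm[OF qD z] a(2)] by simp
        finally show ?thesis using as[OF a(2) qD z] by simp
      qed
      moreover have "a \<cdot>\<^bsub>B\<^esub> q \<in> V"
        using a(1) q(1) unfolding V_def by (intro UnI2 image_eqI[of _ _ "(a, q)"]) auto
      ultimately show ?thesis using step[OF _ q(2)] by simp
    qed
  qed simp
  \<comment> \<open>The last letter of a word serves as the value of the variable, so words of
    length one are counted separately.\<close>
  define W where "W = (\<lambda>(m, q, a). m (q \<cdot>\<^bsub>B\<^esub> a)) ` (bounded_products p rs \<times> Q \<times> A)"
  have "finite (A \<union> W)" unfolding W_def
    by (intro finite_UnI finite_imageI finite_cartesian_product finite_bounded_products B(2) Q(2))
  moreover have "D \<subseteq> A \<union> W"
  proof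
    fix x assume "x \<in> D"
    then have "x \<in> sgenerate B A" by (simp add: D_def)
    from sgenerate_sval[OF B(3) this]
    obtain ys where ys: "ys \<noteq> []" "set ys \<subseteq> A" "x = sval B ys" by blast
    define w a where "w = butlast ys" and "a = last ys"
    have wa: "ys = w @ [a]" using ys(1) by (simp add: w_def a_def)
    then have a: "a \<in> A" "set w \<subseteq> A" using ys(2) by auto
    show "x \<in> A \<union> W"
    proof (cases "w = []")
      case True
      then show ?thesis using ys(3) wa a(1) by simp
    next
      case False
      have "x = sval B w \<cdot>\<^bsub>B\<^esub> a"
        unfolding ys(3) wa using sval_append[OF False, of "[a]"] a B(3) by auto
      moreover from nf[OF False a(2)] obtain q m where "q \<in> Q" "m \<in> bounded_products p rs"
        "\<forall>z \<in> D. sval B w \<cdot>\<^bsub>B\<^esub> z = m (q \<cdot>\<^bsub>B\<^esub> z)" by blast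
      ultimately have "x = (\<lambda>(m, q, a). m (q \<cdot>\<^bsub>B\<^esub> a)) (m, q, a)"
        "(m, q, a) \<in> bounded_products p rs \<times> Q \<times> A" using a(1) AD by auto
      then have "x \<in> W" unfolding W_def by (rule image_eqI)
      then show ?thesis by simp
    qed
  qed
  ultimately have "finite D" by (rule finite_subset[rotated])
  then show False using B(4) by (simp add: D_def)
qed

end

section \<open>The ideal generated by the group elements\<close>

context sgrp
begin

lemma spow_periodic:
  assumes "x \<in> carrier S" "k \<ge> 2" "spow S x k = x" "n > 0"
  shows "spow S x (n + i * (k - 1)) = spow S x n"
proof -
  have step: "spow S x (n + (k - 1)) = spow S x n" if "n > 0" for n
  proof (cases "n = 1")
    case True
    then show ?thesis using assms(2,3) by simp
  next
    case False
    then have "n - 1 > 0" using that by simp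
    then have "spow S x (k + (n - 1)) = x \<cdot> spow S x (n - 1)"
      using spow_add[OF assms(1), of k "n - 1"] assms(2,3) by simp
    also have "\<dots> = spow S x n" using spow_Suc[OF \<open>n - 1 > 0\<close>] that by simp
    finally show ?thesis using assms(2) that by (simp add: add.commute)
  qed
  show ?thesis
  proof (induction i)
    case (Suc i)
    have "spow S x ((n + i * (k - 1)) + (k - 1)) = spow S x (n + i * (k - 1))"
      using assms(4) by (intro step) simp
    then show ?case using Suc by (simp add: ac_simps)
  qed simp
qed

lemma finite_monogenic:
  assumes "x \<in> carrier S" "k \<ge> 2" "spow S x k = x"
  shows "finite (sgenerate S {x})"
proof -
  have "spow S x n \<in> spow S x ` {..k}" if "n > 0" for n
    using that
  proof (induction n rule: less_induct)
    case (less n)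
    show ?case
    proof (cases "n \<le> k")
      case False
      define m where "m = n - (k - 1)"
      have m: "m < n" "m > 0" "n = m + 1 * (k - 1)" using False assms(2) by (simp_all add: m_def)
      then have "spow S x n = spow S x m" using spow_periodic[OF assms m(2), of 1] by simp
      then show ?thesis using less.IH[OF m(1,2)] by simp
    qed simp
  qed
  then have "sgenerate S {x} \<subseteq> spow S x ` {..k}"
    unfolding sgenerate_singleton[OF assms(1)] by auto
  then show ?thesis by (rule finite_subset) simp
qed

lemma monogenic_group:
  assumes x: "x \<in> carrier S" "k \<ge> 2" "spow S x k = x"
  shows "group \<lparr>carrier = sgenerate S {x}, monoid.mult = sprod S, one = spow S x (k - 1)\<rparr>"
proof (rule groupI)
  let ?G = "\<lparr>carrier = sgenerate S {x}, monoid.mult = sprod S, one = spow S x (k - 1)\<rparr>"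
  have C: "sgenerate S {x} \<subseteq> carrier S" using sgenerate_closed x(1) by simp
  have k1: "k - 1 > 0" using x(2) by simp
  have im: "\<exists>n > 0. y = spow S x n" if "y \<in> carrier ?G" for y
    using that by (auto simp: sgenerate_singleton[OF x(1)])
  show "\<one>\<^bsub>?G\<^esub> \<in> carrier ?G" using k1 by (simp add: sgenerate_singleton[OF x(1)])
  show "y \<otimes>\<^bsub>?G\<^esub> z \<in> carrier ?G" if "y \<in> carrier ?G" "z \<in> carrier ?G" for y z
    using that by (simp add: sgenerate.prod)
  show "y \<otimes>\<^bsub>?G\<^esub> z \<otimes>\<^bsub>?G\<^esub> w = y \<otimes>\<^bsub>?G\<^esub> (z \<otimes>\<^bsub>?G\<^esub> w)"
    if "y \<in> carrier ?G" "z \<in> carrier ?G" "w \<in> carrier ?G" for y z w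
    using that C by (simp add: assoc subset_iff)
  show "\<one>\<^bsub>?G\<^esub> \<otimes>\<^bsub>?G\<^esub> y = y" if y: "y \<in> carrier ?G" for y
  proof -
    from im[OF y] obtain n where n: "n > 0" "y = spow S x n" by (elim exE conjE)
    have "spow S x (k - 1) \<cdot> spow S x n = spow S x (n + 1 * (k - 1))"
      using spow_add[OF x(1) k1 n(1)] by (simp add: add.commute)
    then show ?thesis using spow_periodic[OF x n(1), of 1] n(2) by simp
  qed
  show "\<exists>z \<in> carrier ?G. z \<otimes>\<^bsub>?G\<^esub> y = \<one>\<^bsub>?G\<^esub>" if y: "y \<in> carrier ?G" for y
  proof -
    from im[OF y] obtain n where n: "n > 0" "y = spow S x n" by (elim exE conjE)
    \<comment> \<open>\<open>m + n\<close> is to be a multiple of the period \<open>k - 1\<close>;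
      taking \<open>n + 1\<close> periods keeps \<open>m\<close> positive even for
      \<open>k = 2\<close>.\<close>
    have "(n + 1) * 1 \<le> (n + 1) * (k - 1)" using k1 by (intro mult_left_mono) auto
    define m where "m = (n + 1) * (k - 1) - n"
    have m: "m > 0" "m + n = (k - 1) + n * (k - 1)"
      using \<open>(n + 1) * 1 \<le> (n + 1) * (k - 1)\<close> by (simp_all add: m_def)
    have "spow S x m \<cdot> y = spow S x (k - 1)"
      using spow_add[OF x(1) m(1) n(1)] spow_periodic[OF x k1, of n] n(2) m(2) by simp
    moreover have "spow S x m \<in> carrier ?G" using m(1) by (simp add: sgenerate_singleton[OF x(1)])
    ultimately show ?thesis by auto
  qed
qed

end

text \<open>\<open>B\<close> serves to keep \<open>PP\<close> and \<open>CC\<close> out of the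
  variety, and nothing relates it to \<open>S\<close>. Local R-finiteness enters once more for the
  Rees quotient, which is again a member of the variety.\<close>

lemma locally_R_finite_imp_right_ideal_condition:
  fixes B :: "'b sgrp" and S :: "'c sgrp" (structure)
  assumes inf: "infinite (UNIV :: 'a set)"
    and E: "\<forall>p \<in> E. is_identity p"
    and lR: "locally_R_finite_variety (variety E :: 'a sgrp set)"
    and B: "B \<in> variety E" "\<not> locally_finite B"
    and S: "S \<in> variety E"
  shows "\<exists>R. right_ideal S R \<and> periodic (sub S R) \<and> completely_regular (sub S R) \<and>
    locally_finite_extension S (left_multiples S R)"
proof -
  interpret sgrp S using S by (simp add: variety_def)
  obtain X where X: "finite X" "X \<subseteq> carrier B" "infinite (sgenerate B X)"
    using B(2) by (auto simp: locally_finite_def)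
  note PP = PP_not_in_variety[OF inf E lR B(1) X]
    and CC = CC_not_in_variety[OF inf E lR B(1) X]
  obtain p where p: "p > 0" "\<forall>S \<in> (variety E :: 'c sgrp set). \<forall>x \<in> carrier S.
      spow S x p \<cdot>\<^bsub>S\<^esub> spow S x p = spow S x p"
    using uniform_idempotent_power[OF NN_not_in_variety[OF inf E lR] E] by (elim exE conjE)
  have idem: "spow S x p \<cdot> spow S x p = spow S x p" "spow S x p \<in> carrier S" if "x \<in> carrier S" for x
    using bspec[OF bspec[OF p(2) S] that] spow_closed[OF that p(1)] by simp_all
  \<comment> \<open>\<open>e s\<close> is fixed by \<open>e\<close> on the left, so
    \<open>PP_excluded\<close> applies to it; in the second case \<open>e s\<close> is fixed on both
    sides, and \<open>CC_excluded\<close> takes over.\<close>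
  have es: "\<exists>k \<ge> 2. spow S (e \<cdot> s) k = e \<cdot> s"
    if e: "e \<in> carrier S" "e \<cdot> e = e" and s: "s \<in> carrier S" for e s
  proof -
    have c: "e \<cdot> s \<in> carrier S" using e(1) s by (rule closed)
    have l: "e \<cdot> (e \<cdot> s) = e \<cdot> s" using assoc[OF e(1,1) s] e(2) by simp
    from PP_excluded[OF PP E S e c l] show ?thesis
    proof
      assume "e \<cdot> s \<cdot> e = e \<cdot> s"
      from CC_excluded[OF CC E S e c l this] show ?thesis .
    qed
  qed
  define gr where "gr x \<longleftrightarrow> (\<exists>k \<ge> 2. spow S x k = x)" for x
  define R where "R = {x \<in> carrier S. gr x \<and> (\<forall>s \<in> carrier S. gr (x \<cdot> s))}"
  have Rc: "R \<subseteq> carrier S" by (auto simp: R_def)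
  have eR: "e \<in> R" if e: "e \<in> carrier S" "e \<cdot> e = e" for e
  proof -
    have "gr e" unfolding gr_def using spow_idem[OF e(2), of 2] by (intro exI[of _ 2]) simp
    moreover have "gr (e \<cdot> s)" if "s \<in> carrier S" for s using es[OF e that] by (simp add: gr_def)
    ultimately show ?thesis using e(1) by (simp add: R_def)
  qed
  obtain x0 where x0: "x0 \<in> carrier S" using nonempty by blast
  have f0: "spow S x0 p \<in> R" using eR idem[OF x0] by blast
  have Rm: "x \<cdot> s \<in> R" if "x \<in> R" "s \<in> carrier S" for x s
    using that by (auto simp: R_def closed assoc)
  have rR: "right_ideal S R" using f0 Rc Rm by (auto simp: right_ideal_def)
  have powR: "sgenerate S {x} \<subseteq> R" if x: "x \<in> R" for x
  proof
    show "y \<in> R" if "y \<in> sgenerate S {x}" for y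
      using that by induction (use x Rm Rc in auto)
  qed
  have "periodic (sub S R)"
    unfolding periodic_def
  proof
    fix x assume "x \<in> carrier (sub S R)"
    then obtain k where "x \<in> carrier S" "k \<ge> 2" "spow S x k = x" by (auto simp: R_def gr_def)
    then have "finite (sgenerate S {x})" by (rule finite_monogenic)
    then show "finite (sgenerate (sub S R) {x})" by simp
  qed
  moreover have "completely_regular (sub S R)"
    unfolding completely_regular_def
  proof
    fix x assume x: "x \<in> carrier (sub S R)"
    then obtain k where "x \<in> carrier S" "k \<ge> 2" "spow S x k = x" by (auto simp: R_def gr_def)
    then have "group \<lparr>carrier = sgenerate S {x}, monoid.mult = sprod S, one = spow S x (k - 1)\<rparr>"
      by (rule monogenic_group)
    moreover have "x \<in> sgenerate S {x}" by (rule sgenerate.incl) simp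
    ultimately show "\<exists>H e. x \<in> H \<and> H \<subseteq> carrier (sub S R) \<and>
        group \<lparr>carrier = H, monoid.mult = sprod (sub S R), one = e\<rparr>"
      using powR x by (intro exI[of _ "sgenerate S {x}"] exI[of _ "spow S x (k - 1)"]) simp
  qed
  moreover have "locally_finite_extension S (left_multiples S R)"
  proof -
    define J where "J = left_multiples S R"
    have J: "semigroup_ideal S J"
      unfolding semigroup_ideal_def
    proof (intro conjI ballI)
      show "J \<noteq> {}" using f0 Rc by (auto simp: J_def left_multiples_def)
      show "J \<subseteq> carrier S" using Rc closed by (auto simp: J_def left_multiples_def)
      fix j t assume j: "j \<in> J" and t: "t \<in> carrier S"
      then obtain s r where sr: "s \<in> carrier S" "r \<in> R" "j = s \<cdot> r"
        by (auto simp: J_def left_multiples_def)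
      have rc: "r \<in> carrier S" using sr(2) Rc by auto
      have "j \<cdot> t = s \<cdot> (r \<cdot> t)" "t \<cdot> j = (t \<cdot> s) \<cdot> r" using sr rc t by (simp_all add: assoc)
      then show "j \<cdot> t \<in> J" "t \<cdot> j \<in> J"
        using sr(1,2) Rm[OF sr(2) t] closed[OF t sr(1)] unfolding J_def left_multiples_def by blast+
    qed
    have eJ: "e \<in> J" if e: "e \<in> carrier S" "e \<cdot> e = e" for e
      using eR[OF e] e unfolding J_def left_multiples_def by force
    let ?Q = "rees_quotient S J" and ?\<pi> = "rees_class S J"
    note m = rees_class_smap[OF sgrp_axioms J]
    have QV: "?Q \<in> variety E" by (rule smap_variety[OF m S E])
    interpret Q: sgrp ?Q using QV by (simp add: variety_def)
    have Qex: "\<exists>x \<in> carrier S. U = ?\<pi> x" if "U \<in> carrier ?Q" for U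
      using that smap_image[OF m] by blast
    \<comment> \<open>The quotient is nil with a uniform exponent, because \<open>x ^ p\<close> is
      idempotent and all idempotents lie in \<open>J\<close>.\<close>
    have zero: "\<exists>j \<in> J. spow ?Q U p = ?\<pi> j" if U: "U \<in> carrier ?Q" for U
    proof -
      obtain x where x: "x \<in> carrier S" "U = ?\<pi> x" using Qex[OF U] by blast
      have "spow ?Q U p = ?\<pi> (spow S x p)"
        using smap_sval[OF m sgrp_axioms, of "replicate p x"] x p(1) by (simp add: spow_def)
      moreover have "spow S x p \<in> J" using eJ idem[OF x(1)] by blast
      ultimately show ?thesis by blast
    qed
    have absorb: "X \<cdot>\<^bsub>?Q\<^esub> ?\<pi> j = J" "?\<pi> j \<cdot>\<^bsub>?Q\<^esub> X = J" if X: "X \<in> carrier ?Q" and j: "j \<in> J" for X j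
    proof -
      obtain x where x: "x \<in> carrier S" "X = ?\<pi> x" using Qex[OF X] by blast
      have "j \<in> carrier S" "x \<cdot> j \<in> J" "j \<cdot> x \<in> J" using J x(1) j by (auto simp: semigroup_ideal_def)
      then show "X \<cdot>\<^bsub>?Q\<^esub> ?\<pi> j = J" "?\<pi> j \<cdot>\<^bsub>?Q\<^esub> X = J"
        using smap_mult[OF m, of x j] smap_mult[OF m, of j x] x by (simp_all add: rees_class_def)
    qed
    have "finite (sgenerate ?Q A)" if A: "finite A" "A \<subseteq> carrier ?Q" for A
    proof (cases "A = {}")
      case True
      then show ?thesis using Q.sgenerate_image[of "{}"] by simp
    next
      case False
      show ?thesis
      proof (rule R_trivial_subset_finite[OF inf E lR QV A False order_refl])
        fix X Y V W assume XY: "X \<in> sgenerate ?Q A" "Y \<in> sgenerate ?Q A" "X \<noteq> Y"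
          "V \<in> carrier ?Q" "W \<in> carrier ?Q" "X = Y \<cdot>\<^bsub>?Q\<^esub> V" "Y = X \<cdot>\<^bsub>?Q\<^esub> W"
        have c: "X \<in> carrier ?Q" using subsetD[OF Q.sgenerate_closed[OF A(2)] XY(1)] .
        \<comment> \<open>From \<open>X = Y V\<close> and \<open>Y = X W\<close> it follows that
          \<open>X = X U ^ n\<close> for all \<open>n > 0\<close>; at \<open>n = p\<close> this
          makes \<open>X\<close>, and then \<open>Y\<close>, the zero of the quotient.\<close>
        define U where "U = W \<cdot>\<^bsub>?Q\<^esub> V"
        have U: "U \<in> carrier ?Q" unfolding U_def using XY(4,5) by (intro Q.closed)
        have "X \<cdot>\<^bsub>?Q\<^esub> U = (X \<cdot>\<^bsub>?Q\<^esub> W) \<cdot>\<^bsub>?Q\<^esub> V"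
          unfolding U_def by (rule Q.assoc[OF c XY(5,4), symmetric])
        then have XU: "X \<cdot>\<^bsub>?Q\<^esub> U = X" unfolding XY(7)[symmetric] XY(6)[symmetric] .
        have "X \<cdot>\<^bsub>?Q\<^esub> spow ?Q U n = X" if "n > 0" for n
          using that
        proof (induction n rule: nat_induct_non_zero)
          case (Suc n)
          have "X \<cdot>\<^bsub>?Q\<^esub> (U \<cdot>\<^bsub>?Q\<^esub> spow ?Q U n) = (X \<cdot>\<^bsub>?Q\<^esub> U) \<cdot>\<^bsub>?Q\<^esub> spow ?Q U n"
            using Q.spow_closed[OF U Suc.hyps] by (rule Q.assoc[OF c U, symmetric])
          then show ?case using Suc XU by (simp add: Q.spow_Suc)
        qed (simp add: XU)
        from this[OF p(1)] have Xp: "X \<cdot>\<^bsub>?Q\<^esub> spow ?Q U p = X" .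
        from zero[OF U] obtain j where j: "j \<in> J" "spow ?Q U p = ?\<pi> j" by (rule bexE)
        have "X = J" using Xp absorb(1)[OF c j(1)] unfolding j(2) by (rule trans[OF sym])
        then have "X = ?\<pi> j" using j(1) by (simp only: rees_class_def if_True)
        then have "Y = J" using absorb(2)[OF XY(5) j(1)] XY(7) by (simp only:)
        then show False using \<open>X = J\<close> XY(3) by (simp only:)
      qed
    qed
    then have "locally_finite ?Q" by (simp add: locally_finite_def)
    then show ?thesis using J by (simp add: locally_finite_extension_def J_def)
  qed
  ultimately show ?thesis using rR by blast
qed

theorem theorem4p3:
  fixes E :: "identity set" and n :: nat
  assumes "infinite (UNIV :: 'a set)" and "infinite (UNIV :: 'b set)"
    and "infinite (UNIV :: 'c set)" and "infinite (UNIV :: 'd set)"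
    and "n > 0"
    and "\<forall>p \<in> E. is_identity p \<and> card (identity_letters p) \<le> n"
  shows "locally_R_finite_variety (variety E :: 'a sgrp set) \<longleftrightarrow>
      locally_finite_variety (variety E :: 'b sgrp set) \<or>
      ((\<forall>S \<in> (variety E :: 'c sgrp set). \<exists>R. right_ideal S R \<and>
            periodic (sub S R) \<and> completely_regular (sub S R) \<and>
            locally_finite_extension S (left_multiples S R)) \<and>
       (\<forall>G :: 'd monoid. novikov_adian G \<longrightarrow> L G \<notin> variety E))"
    (is "?lR \<longleftrightarrow> ?lf \<or> ?ideals \<and> ?noL")
proof
  have E: "\<forall>p \<in> E. is_identity p" using assms(6) by blast
  {
    assume lR: ?lR
    show "?lf \<or> ?ideals \<and> ?noL"
    proof (rule disjCI)
      assume "\<not> (?ideals \<and> ?noL)"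
      moreover have ?noL using L_not_in_variety[OF assms(1) E lR] by blast
      \<comment> \<open>One violating \<open>S\<close> over \<open>'c\<close> is enough: any member
        over \<open>'b\<close> that is not locally finite would supply the missing right ideal of
        \<open>S\<close>.\<close>
      ultimately obtain S :: "'c sgrp" where S: "S \<in> variety E"
        "\<not> (\<exists>R. right_ideal S R \<and> periodic (sub S R) \<and> completely_regular (sub S R) \<and>
          locally_finite_extension S (left_multiples S R))" by blast
      show ?lf
        unfolding locally_finite_variety_def
      proof (rule ballI, rule ccontr)
        fix B :: "'b sgrp" assume "B \<in> variety E" "\<not> locally_finite B"
        from locally_R_finite_imp_right_ideal_condition[OF assms(1) E lR this S(1)] S(2)
        show False by contradiction
      qed
    qed
  next
    assume "?lf \<or> ?ideals \<and> ?noL"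
    then show ?lR
    proof (elim disjE conjE)
      assume ?lf
      then show ?lR by (rule locally_finite_imp_locally_R_finite[OF assms(2) E])
    next
      assume ?ideals and noL: ?noL
      have "L G \<notin> variety E" if "novikov_adian G" for G :: "'d monoid" using noL that by blast
      from right_ideal_condition_imp_locally_R_finite[OF assms(3,4) E \<open>?ideals\<close> this]
      show ?lR by simp
    qed
  }
qed

end
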